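(* Let $Z=(\mathbb{R}^2\oplus_1\mathbb{R})\oplus_\infty\mathbb{R}$ be the cylindrical normed space with norm $$\|(x_1,x_2,x_3,x_4)\|_Z:=\max\left\{\sqrt{x_1^2+x_2^2}+|x_3|,\ |x_4|\right\}.$$ Then the following are equivalent for any graph $G=(V,E)$: (i) $G$ is minimally rigid in $Z$. (ii) $G$ is an edge-disjoint union of spanning subgraphs $H$, $T_1$ and $T_2$ where $H$ is $(2,3)$-tight and $T_1,T_2$ are trees.
   Context: All graphs are finite, simple and undirected. A graph $G=(V,E)$ is $(2,3)$-sparse if every subgraph $H=(V(H),E(H))$ of $G$ with at least one edge satisfies $|E(H)|\leq 2|V(H)|-3$; it is $(2,3)$-tight if it is $(2,3)$-sparse and $|E|=2|V|-3$. Let $Y$ be a finite dimensional real normed space. A framework in $Y$ is a pair $(G,p)$ with $G=(V,E)$ a graph and $p=(p_v)_{v\in V}\in Y^V$ (a placement of $G$) with $p_v\neq p_w$ for every $vw\in E$. The rigidity map is $f_G:Y^V\to\mathbb{R}^E$, $(x_v)_{v}\mapsto(\|x_v-x_w\|_Y)_{vw\in E}$. The framework is well-positioned if $f_G$ is differentiable at $p$; a well-positioned framework is independent if $df_G(p):Y^V\to\mathbb{R}^E$ is surjective. A rigid motion of $Y$ is a family of continuous paths $\alpha_x:[-1,1]\to Y$ ($x\in Y$) such that $\alpha_x(0)=x$, $\alpha_x$ is differentiable at $0$, and $\|\alpha_x(t)-\alpha_y(t)\|_Y=\|x-y\|_Y$ for all $x,y\in Y$, $t\in[-1,1]$. Maps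 $\eta:Y\to Y$ of the form $\eta(x)=\alpha_x'(0)$ are infinitesimal rigid motions; they form a linear space $\mathcal{T}(Y)$. Put $\mathcal{T}(G,p)=\{(\eta(p_v))_{v\in V}:\eta\in\mathcal{T}(Y)\}\subseteq\ker df_G(p)$. A well-positioned framework $(G,p)$ is infinitesimally rigid if $\ker df_G(p)=\mathcal{T}(G,p)$, and minimally infinitesimally rigid if it is both infinitesimally rigid and independent. A graph $G$ is minimally rigid in $Y$ if there is a well-positioned placement $p\in Y^V$ such that $(G,p)$ is minimally infinitesimally rigid.
   Formalization: The graph is assumed to have at least two vertices: a single vertex is minimally rigid in Z, but (ii) fails for it because a (2,3)-tight graph on one vertex would need −1 edges (the empty graph fails likewise). *)

theory Defs
  imports "HOL-Analysis.Analysis"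
begin

section \<open>Finite simple graphs\<close>

text \<open>
  A graph is given by a vertex set \<open>V\<close> and a set \<open>E\<close> of two-element subsets of \<open>V\<close>.
\<close>

definition simple_graph :: "'v set \<Rightarrow> 'v set set \<Rightarrow> bool" where
  "simple_graph V E \<longleftrightarrow> finite V \<and> (\<forall>e\<in>E. \<exists>v\<in>V. \<exists>w\<in>V. v \<noteq> w \<and> e = {v, w})"

definition subgraph :: "'v set \<Rightarrow> 'v set set \<Rightarrow> 'v set \<Rightarrow> 'v set set \<Rightarrow> bool" where
  "subgraph V' E' V E \<longleftrightarrow> simple_graph V' E' \<and> V' \<subseteq> V \<and> E' \<subseteq> E"

text \<open>The counts are taken in \<^typ>\<open>int\<close>, since subtraction on \<^typ>\<open>nat\<close> truncates.
  In particular a single vertex is not tight, although it is minimally rigid in every normed space;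
  this is why statements relating the two notions need at least two vertices.\<close>

definition sparse_2_3 :: "'v set \<Rightarrow> 'v set set \<Rightarrow> bool" where
  "sparse_2_3 V E \<longleftrightarrow>
     (\<forall>V' E'. subgraph V' E' V E \<and> E' \<noteq> {} \<longrightarrow> int (card E') \<le> 2 * int (card V') - 3)"

definition tight_2_3 :: "'v set \<Rightarrow> 'v set set \<Rightarrow> bool" where
  "tight_2_3 V E \<longleftrightarrow> sparse_2_3 V E \<and> int (card E) = 2 * int (card V) - 3"

definition connected_graph :: "'v set \<Rightarrow> 'v set set \<Rightarrow> bool" where
  "connected_graph V E \<longleftrightarrow> V \<noteq> {} \<and> (\<forall>v\<in>V. \<forall>w\<in>V. (v, w) \<in> {(a, b). {a, b} \<in> E}\<^sup>*)"

text \<open>A cycle is the list of its vertices in cyclic order, without repeating the first one.\<close>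

definition is_cycle :: "'v set set \<Rightarrow> 'v list \<Rightarrow> bool" where
  "is_cycle E c \<longleftrightarrow> 3 \<le> length c \<and> distinct c \<and>
     (\<forall>i<length c. {c ! i, c ! (Suc i mod length c)} \<in> E)"

definition is_tree :: "'v set \<Rightarrow> 'v set set \<Rightarrow> bool" where
  "is_tree V E \<longleftrightarrow> simple_graph V E \<and> connected_graph V E \<and> (\<nexists>c. is_cycle E c)"


section \<open>Infinitesimal rigid motions of a normed space\<close>

definition rigid_motion :: "('a::real_normed_vector \<Rightarrow> real \<Rightarrow> 'a) \<Rightarrow> bool" where
  "rigid_motion \<alpha> \<longleftrightarrow>
     (\<forall>x. continuous_on {-1..1} (\<alpha> x) \<and> \<alpha> x 0 = x \<and> \<alpha> x differentiable (at 0)) \<and>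
     (\<forall>x y. \<forall>t\<in>{-1..1}. norm (\<alpha> x t - \<alpha> y t) = norm (x - y))"

definition inf_rigid_motions :: "('a::real_normed_vector \<Rightarrow> 'a) set" where
  "inf_rigid_motions =
     {\<eta>. \<exists>\<alpha>. rigid_motion \<alpha> \<and> (\<forall>x. (\<alpha> x has_vector_derivative \<eta> x) (at 0))}"


section \<open>Frameworks\<close>

text \<open>
  The vertex set of a framework is the whole finite type \<open>'v\<close>, so that \<open>Y\<^sup>V\<close> is \<open>'a ^ 'v\<close>, and
  \<open>\<real>\<^sup>E\<close> is the subspace \<open>edge_space E\<close> of \<^typ>\<open>real ^ ('v::finite set)\<close> of vectors
  supported on \<open>E\<close>.
\<close>

definition edge_space :: "'v::finite set set \<Rightarrow> (real ^ ('v set)) set" where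
  "edge_space E = {y. \<forall>e. e \<notin> E \<longrightarrow> y $ e = 0}"

definition edge_length :: "'a::real_normed_vector ^ 'v \<Rightarrow> 'v::finite set \<Rightarrow> real" where
  "edge_length x e = (THE d. \<exists>v w. e = {v, w} \<and> d = norm (x $ v - x $ w))"

lemma edge_length_doubleton: "edge_length x {v, w} = norm (x $ v - x $ w)"
  unfolding edge_length_def
  by (rule the_equality) (auto simp: doubleton_eq_iff norm_minus_commute)

definition rigidity_map ::
    "'v::finite set set \<Rightarrow> 'a::real_normed_vector ^ 'v \<Rightarrow> real ^ ('v set)" where
  "rigidity_map E x = (\<chi> e. if e \<in> E then edge_length x e else 0)"

definition framework :: "'v::finite set set \<Rightarrow> 'a::real_normed_vector ^ 'v \<Rightarrow> bool" where
  "framework E p \<longleftrightarrow> simple_graph UNIV E \<and> (\<forall>v w. {v, w} \<in> E \<longrightarrow> p $ v \<noteq> p $ w)"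

definition well_positioned :: "'v::finite set set \<Rightarrow> 'a::real_normed_vector ^ 'v \<Rightarrow> bool" where
  "well_positioned E p \<longleftrightarrow> framework E p \<and> rigidity_map E differentiable (at p)"

abbreviation rigidity_derivative ::
    "'v::finite set set \<Rightarrow> 'a::real_normed_vector ^ 'v \<Rightarrow> 'a ^ 'v \<Rightarrow> real ^ ('v set)" where
  "rigidity_derivative E p \<equiv> frechet_derivative (rigidity_map E) (at p)"

definition independent_framework ::
    "'v::finite set set \<Rightarrow> 'a::real_normed_vector ^ 'v \<Rightarrow> bool" where
  "independent_framework E p \<longleftrightarrow>
     well_positioned E p \<and> range (rigidity_derivative E p) = edge_space E"

definition trivial_flexes :: "'a::real_normed_vector ^ 'v::finite \<Rightarrow> ('a ^ 'v) set" where
  "trivial_flexes p = (\<lambda>\<eta>. \<chi> v. \<eta> (p $ v)) ` inf_rigid_motions"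

definition inf_rigid :: "'v::finite set set \<Rightarrow> 'a::real_normed_vector ^ 'v \<Rightarrow> bool" where
  "inf_rigid E p \<longleftrightarrow>
     well_positioned E p \<and> {u. rigidity_derivative E p u = 0} = trivial_flexes p"

definition min_inf_rigid :: "'v::finite set set \<Rightarrow> 'a::real_normed_vector ^ 'v \<Rightarrow> bool" where
  "min_inf_rigid E p \<longleftrightarrow> inf_rigid E p \<and> independent_framework E p"

definition minimally_rigid_in ::
    "'a::real_normed_vector itself \<Rightarrow> 'v::finite set set \<Rightarrow> bool" where
  "minimally_rigid_in Y E \<longleftrightarrow> (\<exists>p :: 'a ^ 'v. well_positioned E p \<and> min_inf_rigid E p)"


section \<open>The cylindrical normed space\<close>

text \<open>
  A copy of \<open>\<real>\<^sup>4\<close>, whose norm replaces the Euclidean one of \<^typ>\<open>real ^ 4\<close>.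
\<close>

typedef cyl_space = "UNIV :: (real ^ 4) set"
  morphisms coords of_coords by simp

lemmas cyl_space_simps [simp] = of_coords_inverse [OF UNIV_I] coords_inverse

lemma cyl_space_eq_iff: "x = y \<longleftrightarrow> coords x = coords y"
  by (simp add: coords_inject)

instantiation cyl_space :: real_vector
begin

definition "0 = of_coords 0"
definition "x + y = of_coords (coords x + coords y)"
definition "- x = of_coords (- coords x)"
definition "x - y = of_coords (coords x - coords y)"
definition "r *\<^sub>R x = of_coords (r *\<^sub>R coords x)"

instance
  by standard
    (simp_all add: cyl_space_eq_iff zero_cyl_space_def plus_cyl_space_def uminus_cyl_space_def
      minus_cyl_space_def scaleR_cyl_space_def algebra_simps)

end

lemma coords_simps [simp]:
  "coords 0 = 0"
  "coords (x + y) = coords x + coords y"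
  "coords (- x) = - coords x"
  "coords (x - y) = coords x - coords y"
  "coords (r *\<^sub>R x) = r *\<^sub>R coords x"
  by (simp_all add: zero_cyl_space_def plus_cyl_space_def uminus_cyl_space_def
      minus_cyl_space_def scaleR_cyl_space_def)

instantiation cyl_space :: real_normed_vector
begin

definition norm_cyl_space_def:
  "norm x = max (sqrt ((coords x $ 1)\<^sup>2 + (coords x $ 2)\<^sup>2) + \<bar>coords x $ 3\<bar>) \<bar>coords x $ 4\<bar>"

definition dist_cyl_space_def: "dist (x :: cyl_space) y = norm (x - y)"

definition sgn_cyl_space_def: "sgn (x :: cyl_space) = inverse (norm x) *\<^sub>R x"

definition uniformity_cyl_space_def:
  "(uniformity :: (cyl_space \<times> cyl_space) filter) = (INF e\<in>{0<..}. principal {(x, y). dist x y < e})"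

definition open_cyl_space_def:
  "open (U :: cyl_space set) \<longleftrightarrow> (\<forall>x\<in>U. \<forall>\<^sub>F (x', y) in uniformity. x' = x \<longrightarrow> y \<in> U)"

instance
proof
  fix x y :: cyl_space and r :: real and U :: "cyl_space set"
  show "dist x y = norm (x - y)"
    by (rule dist_cyl_space_def)
  show "sgn x = inverse (norm x) *\<^sub>R x"
    by (rule sgn_cyl_space_def)
  show "uniformity = (INF e\<in>{0<..}. principal {(x :: cyl_space, y). dist x y < e})"
    by (rule uniformity_cyl_space_def)
  show "open U \<longleftrightarrow> (\<forall>x\<in>U. \<forall>\<^sub>F (x', y) in uniformity. x' = x \<longrightarrow> y \<in> U)"
    by (rule open_cyl_space_def)
  show "norm x = 0 \<longleftrightarrow> x = 0"
  proof
    assume n: "norm x = 0"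
    let ?s = "sqrt ((coords x $ 1)\<^sup>2 + (coords x $ 2)\<^sup>2)"
    have "0 \<le> ?s"
      by simp
    with n have "?s = 0" "coords x $ 3 = 0" "coords x $ 4 = 0"
      unfolding norm_cyl_space_def by linarith+
    then show "x = 0"
      by (simp add: cyl_space_eq_iff vec_eq_iff forall_4 sum_power2_eq_zero_iff)
  qed (simp add: norm_cyl_space_def)
  show "norm (x + y) \<le> norm x + norm y"
    using real_sqrt_sum_squares_triangle_ineq
        [of "coords x $ 1" "coords y $ 1" "coords x $ 2" "coords y $ 2"]
    unfolding norm_cyl_space_def coords_simps vector_add_component by linarith
  have "sqrt ((r * coords x $ 1)\<^sup>2 + (r * coords x $ 2)\<^sup>2)
      = \<bar>r\<bar> * sqrt ((coords x $ 1)\<^sup>2 + (coords x $ 2)\<^sup>2)"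
    by (simp add: power_mult_distrib real_sqrt_mult flip: distrib_left)
  then show "norm (r *\<^sub>R x) = \<bar>r\<bar> * norm x"
    by (simp add: norm_cyl_space_def abs_mult max_mult_distrib_left distrib_left)
qed

end

end

theory Submission
  imports Defs
begin

text \<open>
  At a well-positioned placement every edge is either spacelike (the first summand
  \<open>\<real>\<^sup>2 \<oplus>\<^sub>1 \<real>\<close> determines its length) or timelike (the fourth coordinate does), and the rigidity
  matrix splits accordingly. Timelike edges contribute signed incidence rows of a graph, so they
  must form a spanning tree. The row of a spacelike edge is a unit planar direction next to a sign,
  that is, a row of a planar rigidity matrix next to a row of an incidence matrix; an independent
  family of \<open>3|V| - 4\<close> such rows can be divided into one whose planar parts are independent, a
  \<open>(2,3)\<close>-tight graph, and one whose incidence parts are independent, a spanning tree.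

  Conversely, \<open>T\<^sub>2\<close> is realised as the intersection graph of discs in the plane. The signed radii of
  the discs serve as fourth coordinates and make exactly the edges of \<open>T\<^sub>2\<close> timelike. This is an
  open condition on the planar part, so by Laman's theorem \<open>H\<close> may be taken independent there, and
  the points may be taken so generic that no product of distinct edge lengths lies in a field \<open>K\<close>
  containing all their coordinates. After scaling by its length \<open>r\<^sub>e\<close> the row of a spacelike edge \<open>e\<close>
  is \<open>u\<^sub>e + r\<^sub>e w\<^sub>e\<close> with \<open>u\<^sub>e\<close>, \<open>w\<^sub>e\<close> over \<open>K\<close>. As \<open>r\<^sub>e\<close> is not in the field generated by \<open>K\<close> and the other
  lengths, such a combination can only be dependent on the other rows if both \<open>u\<^sub>e\<close> and \<open>w\<^sub>e\<close> are; so it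
  suffices that the rows \<open>u\<^sub>e\<close> (\<open>e\<close> in \<open>H\<close>) and \<open>w\<^sub>e\<close> (\<open>e\<close> in \<open>T\<^sub>1\<close>) are independent.
\<close>

section \<open>Independent families of vectors\<close>

text \<open>When the plane parts are not all equal, the trivial flexes of a placement form a space
  of dimension 5: two translations and a rotation of the plane, and one translation in each of the
  two other coordinates. So a minimally rigid placement has 4|V| - 5 edges. At most |V| - 1 of them
  can be timelike and at most (2|V| - 3) + (|V| - 1) spacelike, hence both bounds are attained; this
  is where the number 3|V| - 4 comes from. The obstacle is in the converse. The third and fourth
  coordinates enter the rows only through signs, which are locally constant, so perturbing them
  cannot create independence. What remains is the freedom of the planar directions, but each
  spacelike row carries its planar direction and its sign together, whether the edge belongs to
  \<open>H\<close> or to the first tree. The square roots hidden in the unit directions are what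
  allows the two blocks to be treated separately.\<close>

definition indep_family :: "'i set \<Rightarrow> ('i \<Rightarrow> 'a::real_vector) \<Rightarrow> bool" where
  "indep_family I f \<longleftrightarrow> (\<forall>c. (\<Sum>i\<in>I. c i *\<^sub>R f i) = 0 \<longrightarrow> (\<forall>i\<in>I. c i = 0))"

lemma indep_familyI:
  assumes "\<And>c i. (\<Sum>i\<in>I. c i *\<^sub>R f i) = 0 \<Longrightarrow> i \<in> I \<Longrightarrow> c i = 0"
  shows "indep_family I f"
  using assms unfolding indep_family_def by blast

lemma indep_familyD:
  "indep_family I f \<Longrightarrow> (\<Sum>i\<in>I. c i *\<^sub>R f i) = 0 \<Longrightarrow> i \<in> I \<Longrightarrow> c i = 0"
  unfolding indep_family_def by blast

lemma indep_family_cong: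
  "(\<And>i. i \<in> I \<Longrightarrow> f i = g i) \<Longrightarrow> indep_family I f \<longleftrightarrow> indep_family I g"
  unfolding indep_family_def by (simp cong: sum.cong)

lemma indep_family_subset:
  assumes "indep_family I f" "finite I" "J \<subseteq> I"
  shows "indep_family J f"
proof (rule indep_familyI)
  fix c i assume s: "(\<Sum>i\<in>J. c i *\<^sub>R f i) = 0" and "i \<in> J"
  have "(\<Sum>i\<in>I. (if i \<in> J then c i else 0) *\<^sub>R f i) = (\<Sum>i\<in>J. c i *\<^sub>R f i)"
    using assms by (intro sum.mono_neutral_cong_right) auto
  then have "(if i \<in> J then c i else 0) = 0"
    using s assms \<open>i \<in> J\<close> by (intro indep_familyD[OF assms(1)]) auto
  then show "c i = 0" using \<open>i \<in> J\<close> by simp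
qed

lemma indep_family_scale:
  assumes "\<And>i. i \<in> I \<Longrightarrow> r i \<noteq> 0"
  shows "indep_family I (\<lambda>i. r i *\<^sub>R f i) \<longleftrightarrow> indep_family I f"
proof
  assume L: "indep_family I (\<lambda>i. r i *\<^sub>R f i)"
  show "indep_family I f"
  proof (rule indep_familyI)
    fix c i assume s: "(\<Sum>i\<in>I. c i *\<^sub>R f i) = 0" and "i \<in> I"
    have "(\<Sum>i\<in>I. (c i / r i) *\<^sub>R r i *\<^sub>R f i) = (\<Sum>i\<in>I. c i *\<^sub>R f i)"
      using assms by (intro sum.cong) auto
    then have "c i / r i = 0"
      using indep_familyD[OF L, of "\<lambda>i. c i / r i"] s \<open>i \<in> I\<close> by simp
    then show "c i = 0" using assms \<open>i \<in> I\<close> by auto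
  qed
next
  assume R: "indep_family I f"
  show "indep_family I (\<lambda>i. r i *\<^sub>R f i)"
  proof (rule indep_familyI)
    fix c i assume s: "(\<Sum>i\<in>I. c i *\<^sub>R r i *\<^sub>R f i) = 0" and "i \<in> I"
    then have "c i * r i = 0"
      using indep_familyD[OF R, of "\<lambda>i. c i * r i"] by simp
    then show "c i = 0" using assms \<open>i \<in> I\<close> by auto
  qed
qed

lemma indep_family_inj:
  assumes "indep_family I f" "finite I"
  shows "inj_on f I"
proof (rule inj_onI, rule ccontr)
  fix i j assume ij: "i \<in> I" "j \<in> I" "f i = f j" "i \<noteq> j"
  let ?c = "\<lambda>k. if k = i then 1 else if k = j then -1 else 0::real"
  have "(\<Sum>k\<in>I. ?c k *\<^sub>R f k) = (\<Sum>k\<in>{i,j}. ?c k *\<^sub>R f k)"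
    using ij assms by (intro sum.mono_neutral_right) auto
  also have "\<dots> = 0" using ij by simp
  finally have "?c i = 0" using indep_familyD[OF assms(1), of ?c i] ij(1) by blast
  then show False by simp
qed

text \<open>Injectivity is the part that a set of vectors forgets: two different edges with equal
  rows must count as dependent.\<close>

lemma indep_family_iff_independent:
  fixes f :: "'i \<Rightarrow> 'a::euclidean_space"
  assumes "finite I"
  shows "indep_family I f \<longleftrightarrow> inj_on f I \<and> independent (f ` I)"
proof
  assume L: "indep_family I f"
  have inj: "inj_on f I" by (rule indep_family_inj[OF L assms])
  moreover have "independent (f ` I)"
  proof -
    have "\<forall>v\<in>f ` I. u v = 0" if "(\<Sum>v\<in>f ` I. u v *\<^sub>R v) = 0" for u
    proof -
      have "(\<Sum>i\<in>I. u (f i) *\<^sub>R f i) = 0"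
        using that by (simp add: sum.reindex[OF inj])
      then show ?thesis using indep_familyD[OF L, of "\<lambda>i. u (f i)"] by blast
    qed
    then show ?thesis using assms by (auto simp: independent_explicit)
  qed
  ultimately show "inj_on f I \<and> independent (f ` I)" ..
next
  assume R: "inj_on f I \<and> independent (f ` I)"
  show "indep_family I f"
  proof (rule indep_familyI)
    fix c i assume s: "(\<Sum>i\<in>I. c i *\<^sub>R f i) = 0" and "i \<in> I"
    let ?u = "\<lambda>v. c (the_inv_into I f v)"
    have "(\<Sum>v\<in>f ` I. ?u v *\<^sub>R v) = (\<Sum>i\<in>I. c i *\<^sub>R f i)"
      using R by (subst sum.reindex) (auto intro!: sum.cong simp: the_inv_into_f_f)
    then have "\<forall>v\<in>f ` I. ?u v = 0"
      using R s by (auto simp: independent_explicit)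
    then show "c i = 0" using \<open>i \<in> I\<close> R by (auto simp: the_inv_into_f_f)
  qed
qed

lemma indep_family_dim_span:
  fixes f :: "'i \<Rightarrow> 'a::euclidean_space"
  assumes "indep_family I f" "finite I"
  shows "dim (span (f ` I)) = card I"
  using assms by (simp add: indep_family_iff_independent dim_eq_card_independent card_image)

lemma indep_family_card_le:
  fixes f :: "'i \<Rightarrow> 'a::euclidean_space"
  assumes "indep_family I f" "finite I" "subspace S" "f ` I \<subseteq> S"
  shows "card I \<le> dim S"
proof -
  have "card I = dim (span (f ` I))" using assms by (simp only: indep_family_dim_span)
  also have "\<dots> \<le> dim S" using assms by (simp add: dim_subset)
  finally show ?thesis .
qed

lemma indep_family_span_eq:
  fixes f :: "'i \<Rightarrow> 'a::euclidean_space"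
  assumes "indep_family I f" "finite I" "subspace S" "f ` I \<subseteq> S" "card I = dim S"
  shows "span (f ` I) = S"
proof (rule subspace_dim_equal)
  show "span (f ` I) \<subseteq> S" using assms by (simp add: span_minimal)
  show "dim S \<le> dim (span (f ` I))" using assms indep_family_dim_span[of I f] by simp
qed (use assms in auto)

text \<open>Rank-nullity inside \<open>S\<close>: the annihilator of the \<open>f i\<close> is the
  orthogonal complement of their span.\<close>

lemma dim_annihilator:
  fixes f :: "'i \<Rightarrow> 'a::euclidean_space"
  assumes "subspace S" "f ` I \<subseteq> S"
  shows "dim {y\<in>S. \<forall>i\<in>I. f i \<bullet> y = 0} + dim (span (f ` I)) = dim S"
proof -
  have eq: "{y\<in>S. \<forall>x\<in>span (f ` I). orthogonal x y} = {y\<in>S. \<forall>i\<in>I. f i \<bullet> y = 0}"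
  proof -
    have "(\<forall>x\<in>span (f ` I). orthogonal x y) \<longleftrightarrow> (\<forall>i\<in>I. f i \<bullet> y = 0)" for y
    proof safe
      fix i assume "\<forall>x\<in>span (f ` I). orthogonal x y" "i \<in> I"
      then show "f i \<bullet> y = 0" by (auto simp: orthogonal_def span_base)
    next
      fix x assume "\<forall>i\<in>I. f i \<bullet> y = 0" "x \<in> span (f ` I)"
      then have "orthogonal y x"
        by - (rule orthogonal_to_span[of x "f ` I"], auto simp: orthogonal_def inner_commute)
      then show "orthogonal x y" by (simp add: orthogonal_commute)
    qed
    then show ?thesis by auto
  qed
  show ?thesis
    using dim_subspace_orthogonal_to_vectors[of "span (f ` I)" S] assms
    by (simp only: eq span_minimal subspace_span simp_thms)
qed

lemma indep_family_dim_annihilator: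
  fixes f :: "'i \<Rightarrow> 'a::euclidean_space"
  assumes "indep_family I f" "finite I"
  shows "dim {y. \<forall>i\<in>I. f i \<bullet> y = 0} + card I = DIM('a)"
  using dim_annihilator[of UNIV f I] indep_family_dim_span[OF assms] by (simp add: subspace_UNIV)

text \<open>Take the component of \<open>f i\<close> orthogonal to the other vectors and divide it
  by its squared norm. The dual family reads off coefficients, and later supplies preimages,
  determinants and test vectors.\<close>

lemma indep_family_dual:
  fixes f :: "'i \<Rightarrow> 'a::euclidean_space"
  assumes "indep_family I f" "finite I"
  obtains d where "\<And>i. d i \<in> span (f ` I)"
    "\<And>i j. i \<in> I \<Longrightarrow> j \<in> I \<Longrightarrow> d i \<bullet> f j = (if i = j then 1 else 0)"
proof -
  have "\<exists>d. d \<in> span (f ` I) \<and> (\<forall>j\<in>I. d \<bullet> f j = (if i = j then 1 else 0))" if "i \<in> I" for i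
  proof -
    have sub: "span (f ` (I - {i})) \<subseteq> span (f ` I)" by (intro span_mono) auto
    obtain y z where yz: "y \<in> span (span (f ` (I - {i})))"
      "\<And>w. w \<in> span (span (f ` (I - {i}))) \<Longrightarrow> orthogonal z w" "f i = y + z"
      using orthogonal_subspace_decomp_exists[of "span (f ` (I - {i}))" "f i"] by blast
    have y: "y \<in> span (f ` (I - {i}))" using yz(1) by (simp only: span_span)
    have z0: "z \<bullet> f j = 0" if "j \<in> I" "j \<noteq> i" for j
      using yz(2)[of "f j"] that by (auto simp: orthogonal_def span_base)
    have ni: "f i \<notin> span (f ` (I - {i}))"
    proof -
      have "independent (f ` I)" "inj_on f I"
        using assms by (auto simp: indep_family_iff_independent)
      moreover have "f ` I - {f i} = f ` (I - {i})" using \<open>inj_on f I\<close> \<open>i \<in> I\<close>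
        by (auto dest: inj_onD)
      ultimately show ?thesis using \<open>i \<in> I\<close> unfolding dependent_def by auto
    qed
    have zn: "z \<noteq> 0" using yz(3) y ni by (metis add.right_neutral)
    have "z \<bullet> y = 0" using yz(1,2) by (auto simp: orthogonal_def)
    then have zi: "z \<bullet> f i = z \<bullet> z" using yz(3) by (simp add: inner_add_right)
    have "z = f i - y" using yz(3) by simp
    then have "z \<in> span (f ` I)"
      using y sub \<open>i \<in> I\<close> by (auto intro!: span_diff intro: span_base)
    then show ?thesis
      using zn zi z0 by (intro exI[of _ "(1 / (z \<bullet> z)) *\<^sub>R z"]) (auto intro: span_scale)
  qed
  then obtain d where d: "\<And>i. i \<in> I \<Longrightarrow> d i \<in> span (f ` I) \<and> (\<forall>j\<in>I. d i \<bullet> f j = (if i = j then 1 else 0))"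
    by metis
  \<comment> \<open>Zero outside \<open>I\<close>, so that membership in the span holds for every
    index.\<close>
  show ?thesis
    by (rule that[of "\<lambda>i. if i \<in> I then d i else 0"]) (use d in \<open>auto simp: span_zero\<close>)
qed

lemma indep_family_dual_expand:
  fixes f :: "'i \<Rightarrow> 'a::euclidean_space"
  assumes "finite I"
    "\<And>i j. i \<in> I \<Longrightarrow> j \<in> I \<Longrightarrow> d i \<bullet> f j = (if i = j then 1 else 0)"
    and u: "u \<in> span (f ` I)"
  shows "u = (\<Sum>i\<in>I. (d i \<bullet> u) *\<^sub>R f i)"
  using u
proof (induction rule: span_induct)
  case base
  have "linear (\<lambda>u. u - (\<Sum>i\<in>I. (d i \<bullet> u) *\<^sub>R f i))"
    by (intro linear_compose_sub linear_compose_sum linear_id[unfolded id_def] ballI linearI)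
      (auto simp: inner_add_right scaleR_add_left)
  from linear_subspace_kernel[OF this] show ?case by (simp add: mem_Collect_eq[abs_def])
next
  case (step x)
  then obtain j where j: "j \<in> I" "x = f j" by auto
  have "(\<Sum>i\<in>I. (d i \<bullet> f j) *\<^sub>R f i) = (\<Sum>i\<in>I. if i = j then f i else 0)"
    using assms(2) j by (intro sum.cong) auto
  then show ?case using j assms(1) by simp
qed

lemma sum_dual_inner:
  fixes f g :: "'i \<Rightarrow> 'a::euclidean_space"
  assumes "finite I" "\<And>i j. i \<in> I \<Longrightarrow> j \<in> I \<Longrightarrow> d i \<bullet> f j = (if i = j then 1 else 0)"
    and "u \<in> span (f ` I)"
  shows "(\<Sum>i\<in>I. (d i \<bullet> u) * (f i \<bullet> y)) = u \<bullet> y"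
proof -
  have "u \<bullet> y = (\<Sum>i\<in>I. (d i \<bullet> u) *\<^sub>R f i) \<bullet> y"
    using indep_family_dual_expand[OF assms] by simp
  then show ?thesis by (simp add: inner_sum_left)
qed

text \<open>Both sides are the trace of the projection (a, b) to (0, b). The left side uses the
  basis \<open>(f i, g i)\<close>, with diagonal entries \<open>d i \<bullet> (0, g i)\<close>; the
  right side is what an orthonormal basis of \<open>W\<close> gives.\<close>

lemma trace_projection_basis:
  fixes f :: "'i \<Rightarrow> 'a::euclidean_space" and g :: "'i \<Rightarrow> 'b::euclidean_space"
  assumes "finite I" "subspace W" "\<And>i. i \<in> I \<Longrightarrow> g i \<in> W"
    and "\<And>i j. i \<in> I \<Longrightarrow> j \<in> I \<Longrightarrow> d i \<bullet> (f j, g j) = (if i = j then 1 else 0)"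
    and sp: "\<And>w. w \<in> W \<Longrightarrow> (0, w) \<in> span ((\<lambda>i. (f i, g i)) ` I)"
  shows "(\<Sum>i\<in>I. d i \<bullet> (0, g i)) = dim W"
proof -
  obtain B where B: "B \<subseteq> W" "pairwise orthogonal B" "\<And>x. x \<in> B \<Longrightarrow> norm x = 1"
    "independent B" "card B = dim W" "span B = W"
    using orthonormal_basis_subspace[OF assms(2)] by metis
  have fB: "finite B" using B(4) by (rule independent_imp_finite)
  have ex: "w = (\<Sum>b\<in>B. (b \<bullet> w) *\<^sub>R b)" if "w \<in> W" for w
  proof -
    have "b \<bullet> c = (if b = c then 1 else 0)" if "b \<in> B" "c \<in> B" for b c
      using B(2,3) that by (auto simp: pairwise_def orthogonal_def dot_square_norm)
    then show ?thesis
      using indep_family_dual_expand[of B "\<lambda>b. b" "\<lambda>b. b" w] fB that B(6) by auto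
  qed
  have "(\<Sum>i\<in>I. d i \<bullet> (0, g i)) = (\<Sum>i\<in>I. \<Sum>b\<in>B. (d i \<bullet> (0, b)) * (b \<bullet> g i))"
  proof (rule sum.cong)
    fix i assume i: "i \<in> I"
    have "d i \<bullet> (0, g i) = snd (d i) \<bullet> (\<Sum>b\<in>B. (b \<bullet> g i) *\<^sub>R b)"
      using ex[OF assms(3)[OF i]] by (simp add: inner_prod_def)
    then show "d i \<bullet> (0, g i) = (\<Sum>b\<in>B. (d i \<bullet> (0, b)) * (b \<bullet> g i))"
      by (simp add: inner_sum_right inner_prod_def mult.commute)
  qed simp
  also have "\<dots> = (\<Sum>b\<in>B. \<Sum>i\<in>I. (d i \<bullet> (0, b)) * ((f i, g i) \<bullet> (0, b)))"
    by (subst sum.swap) (simp add: inner_commute)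
  also have "\<dots> = (\<Sum>b\<in>B. (0::'a, b) \<bullet> (0, b))"
    using B(1) by (intro sum.cong refl sum_dual_inner assms(1,4) sp) auto
  also have "\<dots> = (\<Sum>b\<in>B. 1)"
    using B(3) by (intro sum.cong) (auto simp: dot_square_norm)
  finally show ?thesis using B(5) by simp
qed

text \<open>Replacing the vectors of a basis of \<open>U \<oplus> W\<close> one at a time by their \<open>W\<close>-parts: as long as fewer
  than \<open>dim W\<close> vectors have been replaced, the trace of the projection forces some other basis vector
  to have a nonzero coefficient in the expansion of its own \<open>W\<close>-part.\<close>

lemma indep_family_direct_sum_split:
  fixes a :: "'i \<Rightarrow> 'a::euclidean_space" and b :: "'i \<Rightarrow> 'b::euclidean_space"
  assumes fin: "finite I" and sub: "subspace U" "subspace W"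
    and mem: "\<And>i. i \<in> I \<Longrightarrow> a i \<in> U" "\<And>i. i \<in> I \<Longrightarrow> b i \<in> W"
    and ind: "indep_family I (\<lambda>i. (a i, b i))"
    and card: "card I = dim U + dim W"
  obtains J where "J \<subseteq> I" "card J = dim W" "indep_family J b" "indep_family (I - J) a"
proof -
  define F where "F J i = (if i \<in> J then 0 else a i, b i)" for J i
  have Fmem: "F J ` I \<subseteq> U \<times> W" for J
    using mem sub by (auto simp: F_def subspace_0)
  have dimUW: "dim (U \<times> W) = card I" using card sub by (simp add: dim_Times)
  have "\<exists>J. J \<subseteq> I \<and> card J = k \<and> indep_family I (F J)" if "k \<le> dim W" for k
    using that
  proof (induction k)
    case 0
    have "indep_family I (F {})" using ind by (simp add: F_def[abs_def])
    then show ?case by (intro exI[of _ "{}"]) simp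
  next
    case (Suc k)
    then obtain J where J: "J \<subseteq> I" "card J = k" "indep_family I (F J)" by auto
    have finJ: "finite J" using J(1) fin finite_subset by blast
    have sp: "span (F J ` I) = U \<times> W"
      by (intro indep_family_span_eq J fin subspace_Times sub Fmem) (simp add: dimUW)
    obtain d where d: "\<And>i j. i \<in> I \<Longrightarrow> j \<in> I \<Longrightarrow> d i \<bullet> F J j = (if i = j then 1 else 0)"
      using indep_family_dual[OF J(3) fin] by metis
    have "(\<Sum>i\<in>I. d i \<bullet> (0, b i)) = dim W"
    proof (rule trace_projection_basis[OF fin sub(2) mem(2)])
      show "d i \<bullet> (if j \<in> J then 0 else a j, b j) = (if i = j then 1 else 0)"
        if "i \<in> I" "j \<in> I" for i j
        using d[OF that] by (simp add: F_def)
      show "(0, w) \<in> span ((\<lambda>i. (if i \<in> J then 0 else a i, b i)) ` I)" if "w \<in> W" for w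
        using sp that sub unfolding F_def by (simp add: subspace_0)
    qed
    \<comment> \<open>On \<open>J\<close> the \<open>W\<close>-part is the basis vector itself, so
      these diagonal entries are 1 and add up to k, which is less than \<open>dim W\<close>. The
      rest of the trace cannot vanish.\<close>
    moreover have "(\<Sum>i\<in>J. d i \<bullet> (0, b i)) = (\<Sum>i\<in>J. d i \<bullet> F J i)"
      by (intro sum.cong) (auto simp: F_def)
    then have "(\<Sum>i\<in>J. d i \<bullet> (0, b i)) = k"
      using d J(1,2) by (simp add: subset_iff)
    moreover have "(\<Sum>i\<in>I. d i \<bullet> (0, b i)) =
        (\<Sum>i\<in>I - J. d i \<bullet> (0, b i)) + (\<Sum>i\<in>J. d i \<bullet> (0, b i))"
      using fin J(1) by (rule sum.subset_diff[rotated])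
    ultimately have "(\<Sum>i\<in>I - J. d i \<bullet> (0, b i)) \<noteq> 0"
      using Suc.prems by simp
    then obtain m where m: "m \<in> I - J" "d m \<bullet> (0, b m) \<noteq> 0"
      by (meson sum.neutral)
    have Fm: "F (insert m J) i = (if i = m then (0, b m) else F J i)" for i
      by (auto simp: F_def)
    have "indep_family I (F (insert m J))"
    proof (rule indep_familyI)
      fix c i assume s: "(\<Sum>i\<in>I. c i *\<^sub>R F (insert m J) i) = 0" and i: "i \<in> I"
      have split: "(\<Sum>i\<in>I. c i *\<^sub>R F (insert m J) i) =
          c m *\<^sub>R (0, b m) + (\<Sum>i\<in>I - {m}. c i *\<^sub>R F J i)"
        using m fin by (subst sum.remove[of I m]) (auto simp: Fm intro!: sum.cong)
      \<comment> \<open>Steinitz exchange: pairing with \<open>d m\<close> kills every vector except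
        the new one.\<close>
      have "d m \<bullet> (\<Sum>i\<in>I - {m}. c i *\<^sub>R F J i) = 0"
        using m d by (auto simp: inner_sum_right intro!: sum.neutral split: if_splits)
      then have "d m \<bullet> (\<Sum>i\<in>I. c i *\<^sub>R F (insert m J) i) = c m * (d m \<bullet> (0, b m))"
        unfolding split by (simp only: inner_add_right inner_scaleR_right)
      then have "0 = c m * (d m \<bullet> (0, b m))" using s by simp
      then have cm: "c m = 0" using m by simp
      then have "(\<Sum>i\<in>I. c i *\<^sub>R F J i) = 0"
        using s split m fin by (subst sum.remove[of I m]) (auto simp flip: zero_prod_def)
      then show "c i = 0" using J(3) i by (auto dest: indep_familyD)
    qed
    moreover have "card (insert m J) = Suc k" "insert m J \<subseteq> I"
      using m J finJ by auto
    ultimately show ?case by blast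
  qed
  then obtain J where J: "J \<subseteq> I" "card J = dim W" "indep_family I (F J)" by blast
  have finJ: "finite J" using J(1) fin finite_subset by blast
  have Jb: "indep_family J b"
  proof (rule indep_familyI)
    fix c i assume s: "(\<Sum>i\<in>J. c i *\<^sub>R b i) = 0" and "i \<in> J"
    have "(\<Sum>i\<in>J. c i *\<^sub>R F J i) = (\<Sum>i\<in>J. (0, c i *\<^sub>R b i))"
      by (intro sum.cong) (auto simp: F_def)
    also have "\<dots> = 0" using s by (simp add: prod_eq_iff fst_sum snd_sum)
    finally show "c i = 0"
      using indep_family_subset[OF J(3) fin J(1)] \<open>i \<in> J\<close> by (auto dest: indep_familyD)
  qed
  have spW: "span (b ` J) = W"
    using mem J by (intro indep_family_span_eq Jb finJ sub) auto
  have "indep_family (I - J) a"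
  proof (rule indep_familyI)
    fix c i assume s: "(\<Sum>i\<in>I - J. c i *\<^sub>R a i) = 0" and i: "i \<in> I - J"
    \<comment> \<open>The \<open>W\<close>-parts of the relation leave a defect \<open>w\<close>.
      Since the \<open>b j\<close> with \<open>j\<close> in \<open>J\<close> span \<open>W\<close>,
      the vectors \<open>(0, b j)\<close> cancel it, and the relation extends to all of
      \<open>I\<close>.\<close>
    define w where "w = (\<Sum>i\<in>I - J. c i *\<^sub>R b i)"
    have "w \<in> W" unfolding w_def using mem(2) sub by (intro subspace_sum subspace_scale) auto
    obtain d' where d': "\<And>i j. i \<in> J \<Longrightarrow> j \<in> J \<Longrightarrow> d' i \<bullet> b j = (if i = j then 1 else 0)"
      using indep_family_dual[OF Jb finJ] by metis
    define e where "e i = (if i \<in> J then - (d' i \<bullet> w) else c i)" for i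
    have "w = (\<Sum>i\<in>J. (d' i \<bullet> w) *\<^sub>R b i)"
      using \<open>w \<in> W\<close> spW by (intro indep_family_dual_expand[OF finJ d']) auto
    then have "(\<Sum>i\<in>I - J. e i *\<^sub>R b i) + (\<Sum>i\<in>J. e i *\<^sub>R b i) = 0"
      by (simp add: e_def w_def sum_negf)
    moreover have "(\<Sum>i\<in>I. e i *\<^sub>R F J i) =
        (\<Sum>i\<in>I - J. e i *\<^sub>R F J i) + (\<Sum>i\<in>J. e i *\<^sub>R F J i)"
      using fin J(1) by (rule sum.subset_diff[rotated])
    ultimately have "(\<Sum>i\<in>I. e i *\<^sub>R F J i) = 0"
      using s by (simp add: prod_eq_iff fst_sum snd_sum F_def e_def)
    then have "e i = 0" using J(3) i by (auto dest: indep_familyD)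
    then show "c i = 0" using i by (simp add: e_def)
  qed
  then show ?thesis using that J Jb by blast
qed

section \<open>Incidence rows and trees\<close>

text \<open>Summing over the other endpoint avoids orienting the edge. For an antisymmetric
  \<open>G\<close> this is a weighted incidence row; planar directions, signs and plain differences
  all take this form.\<close>

definition erow :: "('v \<Rightarrow> 'v \<Rightarrow> 'a::real_vector) \<Rightarrow> 'v::finite set \<Rightarrow> 'a ^ 'v" where
  "erow G e = (\<chi> v. \<Sum>u | e = {v, u}. G v u)"

lemma erow_nth:
  assumes "v \<noteq> w"
  shows "erow G {v, w} $ y = (if y = v then G v w else if y = w then G w v else 0)"
proof -
  have "{u. {v, w} = {y, u}} = (if y = v then {w} else if y = w then {v} else {})"
    by (auto simp: doubleton_eq_iff)
  then show ?thesis by (auto simp: erow_def)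
qed

lemma erow_inner:
  assumes "v \<noteq> w" "G w v = - G v w"
  shows "erow G {v, w} \<bullet> U = G v w \<bullet> (U $ v - U $ w)"
proof -
  have "erow G {v, w} \<bullet> U = (\<Sum>y\<in>UNIV. erow G {v, w} $ y \<bullet> U $ y)"
    by (simp add: inner_vec_def)
  also have "\<dots> = (\<Sum>y\<in>{v, w}. erow G {v, w} $ y \<bullet> U $ y)"
    by (rule sum.mono_neutral_right) (auto simp: erow_nth[OF assms(1)])
  also have "\<dots> = G v w \<bullet> (U $ v - U $ w)"
    using assms by (simp add: erow_nth inner_diff_right)
  finally show ?thesis .
qed

lemma simple_graph_edgeE:
  assumes "simple_graph V E" "e \<in> E"
  obtains v w where "v \<noteq> w" "e = {v, w}" "v \<in> V" "w \<in> V"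
  using assms unfolding simple_graph_def by blast

lemma simple_graph_neq: "simple_graph V E \<Longrightarrow> {v, w} \<in> E \<Longrightarrow> v \<noteq> w"
  unfolding simple_graph_def by (metis doubleton_eq_iff)

lemma simple_graph_subset: "simple_graph V E \<Longrightarrow> F \<subseteq> E \<Longrightarrow> simple_graph V F"
  unfolding simple_graph_def by blast

lemma rtrancl_distinct_path:
  assumes "(u, v) \<in> {(a, b). {a, b} \<in> F}\<^sup>*"
  obtains p where "p \<noteq> []" "hd p = u" "last p = v" "distinct p"
    "\<And>i. Suc i < length p \<Longrightarrow> {p ! i, p ! Suc i} \<in> F"
proof -
  have "\<exists>p. p \<noteq> [] \<and> hd p = u \<and> last p = v \<and> distinct p \<and>
      (\<forall>i. Suc i < length p \<longrightarrow> {p ! i, p ! Suc i} \<in> F)"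
    using assms
  proof (induction rule: converse_rtrancl_induct)
    case base
    then show ?case by (intro exI[of _ "[v]"]) auto
  next
    case (step y z)
    then obtain p where p: "p \<noteq> []" "hd p = z" "last p = v" "distinct p"
      "\<And>i. Suc i < length p \<Longrightarrow> {p ! i, p ! Suc i} \<in> F" by blast
    show ?case
    proof (cases "y \<in> set p")
      \<comment> \<open>The path already visits \<open>y\<close>, so the loop back to
        \<open>y\<close> is cut off.\<close>
      case True
      then obtain k where k: "k < length p" "p ! k = y" by (auto simp: in_set_conv_nth)
      then show ?thesis
        using p by (intro exI[of _ "drop k p"]) (auto simp: hd_drop_conv_nth)
    next
      case False
      have "{(y # p) ! i, (y # p) ! Suc i} \<in> F" if "Suc i < length (y # p)" for i
        using that p step(1) by (cases i) (auto simp: hd_conv_nth)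
      then show ?thesis using p False by (intro exI[of _ "y # p"]) auto
    qed
  qed
  then show ?thesis using that by blast
qed

text \<open>The edge uv closes a repetition-free path from u to v in \<open>F\<close>. As uv itself
  is not in \<open>F\<close>, the path has at least three vertices, which \<open>is_cycle\<close>
  requires.\<close>

lemma path_closes_cycle:
  assumes "(u, v) \<in> {(a, b). {a, b} \<in> F}\<^sup>*" "u \<noteq> v" "{u, v} \<notin> F" "F \<subseteq> T" "{u, v} \<in> T"
  shows "\<exists>c. is_cycle T c"
proof -
  obtain p where p: "p \<noteq> []" "hd p = u" "last p = v" "distinct p"
    "\<And>i. Suc i < length p \<Longrightarrow> {p ! i, p ! Suc i} \<in> F"
    using rtrancl_distinct_path[OF assms(1)] by blast
  have len: "length p \<noteq> 1" "length p \<noteq> 2"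
  proof -
    show "length p \<noteq> 1" using p assms(2) by (auto simp: length_Suc_conv)
    show "length p \<noteq> 2"
    proof
      assume l: "length p = 2"
      then have "{p ! 0, p ! Suc 0} \<in> F" using p(5)[of 0] by simp
      then show False using l p(1-3) assms(3) by (simp add: hd_conv_nth last_conv_nth)
    qed
  qed
  have "length p \<noteq> 0" using p(1) by simp
  then have "3 \<le> length p" using len by linarith
  moreover have "{p ! i, p ! (Suc i mod length p)} \<in> T" if "i < length p" for i
  proof (cases "Suc i < length p")
    case True
    then show ?thesis using p(5)[OF True] assms(4) by auto
  next
    case False
    then have i: "i = length p - 1" using that by simp
    then have "p ! i = v" "p ! (Suc i mod length p) = u"
      using p(1-3) that by (auto simp: hd_conv_nth last_conv_nth)
    then show ?thesis using assms(5) by (simp add: insert_commute)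
  qed
  ultimately show ?thesis using p(4) unfolding is_cycle_def by blast
qed

lemma rtrancl_edges_const:
  assumes "(v, w) \<in> {(a, b). {a, b} \<in> F}\<^sup>*" "\<And>a b. {a, b} \<in> F \<Longrightarrow> f a = f b"
  shows "f v = f w"
  using assms(1) by (induction rule: rtrancl_induct) (use assms(2) in auto)

lemma component_edge_iff:
  assumes "{a, b} \<in> F"
  shows "(v, a) \<in> {(a, b). {a, b} \<in> F}\<^sup>* \<longleftrightarrow> (v, b) \<in> {(a, b). {a, b} \<in> F}\<^sup>*"
proof -
  have "(a, b) \<in> {(a, b). {a, b} \<in> F}" "(b, a) \<in> {(a, b). {a, b} \<in> F}"
    using assms by (auto simp: insert_commute)
  then show ?thesis by (meson rtrancl.rtrancl_into_rtrancl)
qed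

text \<open>Deleting an edge separates its endpoints. The indicator of one side is orthogonal to all
  other rows but not to the row of the deleted edge, so the coefficient of that edge
  vanishes.\<close>

lemma tree_rows_indep:
  fixes G :: "'v::finite \<Rightarrow> 'v \<Rightarrow> real"
  assumes "is_tree UNIV T" and anti: "\<And>v w. G w v = - G v w"
    and nz: "\<And>v w. {v, w} \<in> T \<Longrightarrow> G v w \<noteq> 0"
  shows "indep_family T (erow G)"
proof (rule indep_familyI)
  fix c e assume s: "(\<Sum>e\<in>T. c e *\<^sub>R erow G e) = 0" and e: "e \<in> T"
  have sg: "simple_graph UNIV T" using assms(1) by (simp add: is_tree_def)
  obtain v w where vw: "v \<noteq> w" "e = {v, w}" using simple_graph_edgeE[OF sg e] .
  let ?R = "{(a, b). {a, b} \<in> T - {e}}\<^sup>*"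
  have w: "(v, w) \<notin> ?R"
    using path_closes_cycle[of v w "T - {e}" T] assms(1) vw e by (auto simp: is_tree_def)
  define U :: "real ^ 'v" where "U = (\<chi> y. if (v, y) \<in> ?R then 1 else 0)"
  have Uf: "erow G f \<bullet> U = 0" if f: "f \<in> T - {e}" for f
  proof -
    from f have "f \<in> T" by simp
    from simple_graph_edgeE[OF sg this] obtain a b where ab: "a \<noteq> b" "f = {a, b}" .
    then have "U $ a = U $ b" using component_edge_iff[of a b "T - {e}" v] f by (simp add: U_def)
    then show ?thesis using ab by (simp add: erow_inner[OF _ anti])
  qed
  have "0 = (\<Sum>e\<in>T. c e *\<^sub>R erow G e) \<bullet> U" using s by simp
  also have "\<dots> = (\<Sum>f\<in>T. c f * (erow G f \<bullet> U))" by (simp add: inner_sum_left)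
  also have "\<dots> = c e * (erow G e \<bullet> U)"
    using e Uf by (subst sum.remove[of T e]) auto
  also have "erow G e \<bullet> U = G v w"
    using vw w by (simp add: erow_inner[OF _ anti] U_def)
  finally show "c e = 0" using nz[of v w] vw e by simp
qed

lemma annihilator_connected:
  fixes G :: "'v::finite \<Rightarrow> 'v \<Rightarrow> real"
  assumes "simple_graph UNIV T" "connected_graph UNIV T" and anti: "\<And>v w. G w v = - G v w"
    and nz: "\<And>v w. {v, w} \<in> T \<Longrightarrow> G v w \<noteq> 0"
  shows "{U. \<forall>e\<in>T. erow G e \<bullet> U = 0} = span {1}"
proof safe
  fix U assume U: "\<forall>e\<in>T. erow G e \<bullet> U = 0"
  have "U $ a = U $ b" if "{a, b} \<in> T" for a b
    using U that simple_graph_neq[OF assms(1) that] nz by (fastforce simp: erow_inner[OF _ anti])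
  then have "U $ v = U $ w" for v w
    using rtrancl_edges_const[of v w T "\<lambda>v. U $ v"] assms(2) by (auto simp: connected_graph_def)
  then have "U = (U $ undefined) *\<^sub>R 1" by (simp add: vec_eq_iff)
  then show "U \<in> span {1}" by (metis span_base span_scale singletonI)
next
  fix U :: "real ^ 'v" and e assume U: "U \<in> span {1}" and e: "e \<in> T"
  obtain v w where "v \<noteq> w" "e = {v, w}" using simple_graph_edgeE[OF assms(1) e] .
  then show "erow G e \<bullet> U = 0"
    using U by (auto simp: erow_inner[OF _ anti] span_singleton)
qed

text \<open>A rank count: the rows are independent and only the constant vectors annihilate them.
  The injection \<open>f\<close> merely supplies an antisymmetric weight without zeros.\<close>

lemma tree_card:
  assumes "is_tree (UNIV :: 'v::finite set) T"
  shows "card T + 1 = CARD('v)"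
proof -
  obtain f :: "'v \<Rightarrow> nat" where f: "inj f"
    using finite_imp_inj_to_nat_seg[of "UNIV :: 'v set"] by auto
  define G where "G v w = real (f v) - real (f w)" for v w
  have sg: "simple_graph UNIV T" "connected_graph UNIV T" using assms by (auto simp: is_tree_def)
  have nz: "G v w \<noteq> 0" if "{v, w} \<in> T" for v w
    using simple_graph_neq[OF sg(1) that] f by (auto simp: G_def dest: injD)
  have anti: "G w v = - G v w" for v w by (simp add: G_def)
  have "dim {U. \<forall>e\<in>T. erow G e \<bullet> U = 0} + card T = CARD('v)"
    using indep_family_dim_annihilator[OF tree_rows_indep[OF assms anti nz]] by simp
  moreover have "dim {U. \<forall>e\<in>T. erow G e \<bullet> U = 0} = 1"
    by (subst annihilator_connected[OF sg anti nz]) (auto simp: dim_span)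
  ultimately show ?thesis by simp
qed

text \<open>By the edge count the annihilator \<open>K\<close> is a line, so it consists of the
  constant vectors; the indicator of a component lies in it, whence connectedness. If
  \<open>e\<close> lay on a cycle, its dual vector would be constant along the other edges of the
  cycle and therefore across \<open>e\<close>, although it pairs to 1 with the row of
  \<open>e\<close>.\<close>

lemma indep_rows_tree:
  fixes G :: "'v::finite \<Rightarrow> 'v \<Rightarrow> real"
  assumes sg: "simple_graph UNIV T" and anti: "\<And>v w. G w v = - G v w"
    and ind: "indep_family T (erow G)" and card: "card T + 1 = CARD('v)"
  shows "is_tree UNIV T"
proof -
  define K where "K = {U. \<forall>e\<in>T. erow G e \<bullet> U = 0}"
  have K: "U \<in> K" if "\<And>a b. {a, b} \<in> T \<Longrightarrow> U $ a = U $ b" for U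
    unfolding K_def
  proof safe
    fix e assume e: "e \<in> T"
    obtain v w where "v \<noteq> w" "e = {v, w}" using simple_graph_edgeE[OF sg e] .
    then show "erow G e \<bullet> U = 0" using that[of v w] e by (simp add: erow_inner[OF _ anti])
  qed
  have nz: "G v w \<noteq> 0" if "{v, w} \<in> T" for v w
  proof
    assume "G v w = 0"
    then have "erow G {v, w} = 0"
      using simple_graph_neq[OF sg that] anti[of w v] by (auto simp: vec_eq_iff erow_nth)
    then have "(\<Sum>e\<in>T. (if e = {v, w} then 1 else 0) *\<^sub>R erow G e) = 0"
      by (intro sum.neutral) auto
    from indep_familyD[OF ind this that] show False by simp
  qed
  have "dim K = 1"
    using indep_family_dim_annihilator[OF ind] card by (simp add: K_def)
  moreover have "subspace K"
    unfolding K_def subspace_def by (auto simp: inner_add_right)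
  ultimately have Keq: "K = span {1}"
    using subspace_dim_equal[of "span {1}" K] K by (simp add: span_minimal)
  have "connected_graph UNIV T"
    unfolding connected_graph_def
  proof (intro conjI ballI)
    fix v w :: 'v
    let ?R = "{(a, b). {a, b} \<in> T}\<^sup>*"
    define U :: "real ^ 'v" where "U = (\<chi> y. if (v, y) \<in> ?R then 1 else 0)"
    have "U \<in> K"
      using component_edge_iff[of _ _ T v] by (intro K) (auto simp: U_def)
    then have "U $ v = U $ w" unfolding Keq by (auto simp: span_singleton)
    then show "(v, w) \<in> ?R" by (auto simp: U_def split: if_splits)
  qed simp
  moreover have "\<not> is_cycle T c" for c
  proof
    assume "is_cycle T c"
    then have c: "3 \<le> length c" "distinct c" "\<And>i. i < length c \<Longrightarrow> {c ! i, c ! (Suc i mod length c)} \<in> T"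
      by (auto simp: is_cycle_def)
    let ?n = "length c - 1"
    define e where "e = {c ! ?n, c ! 0}"
    have "?n < length c" "Suc ?n = length c" using c(1) by linarith+
    then have e: "e \<in> T" using c(3)[of ?n] by (simp add: e_def)
    obtain d where d: "\<And>i j. i \<in> T \<Longrightarrow> j \<in> T \<Longrightarrow> d i \<bullet> erow G j = (if i = j then 1 else 0)"
      using indep_family_dual[OF ind finite] by metis
    have step: "d e $ (c ! i) = d e $ (c ! Suc i)" if "Suc i < length c" for i
    proof -
      have f: "{c ! i, c ! Suc i} \<in> T" using c(3)[of i] that by simp
      have "c ! i \<noteq> c ! Suc i" using c(2) that by (simp add: nth_eq_iff_index_eq)
      moreover have "{c ! i, c ! Suc i} \<noteq> e"
      proof
        assume "{c ! i, c ! Suc i} = e"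
        then consider "c ! i = c ! ?n" | "c ! i = c ! 0" "c ! Suc i = c ! ?n"
          unfolding e_def doubleton_eq_iff by blast
        then show False
        proof cases
          case 1
          then have "i = ?n" using nth_eq_iff_index_eq[OF c(2), of i ?n] that by simp
          then show False using that by simp
        next
          \<comment> \<open>This would make the cycle have length 2.\<close>
          case 2
          then have "i = 0" "Suc i = ?n"
            using nth_eq_iff_index_eq[OF c(2), of i 0] nth_eq_iff_index_eq[OF c(2), of "Suc i" ?n] that
            by (cases c; auto)+
          then show False using c(1) by simp
        qed
      qed
      then have "erow G {c ! i, c ! Suc i} \<bullet> d e = 0"
        using d[OF e f] by (simp add: inner_commute)
      ultimately show ?thesis using nz[OF f] by (simp add: erow_inner[OF _ anti])
    qed
    have "d e $ (c ! 0) = d e $ (c ! i)" if "i < length c" for i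
      using that by (induction i) (use step in auto)
    then have "d e $ (c ! ?n) = d e $ (c ! 0)" using \<open>?n < length c\<close> by (simp only:)
    moreover have "c ! ?n \<noteq> c ! 0"
      using nth_eq_iff_index_eq[OF c(2), of ?n 0] c(1) by (cases c; auto)
    ultimately have "erow G e \<bullet> d e = 0" unfolding e_def by (simp add: erow_inner[OF _ anti])
    then show False using d[OF e e] by (simp add: inner_commute)
  qed
  ultimately show ?thesis using sg by (simp add: is_tree_def)
qed

section \<open>Square roots over subfields of the reals\<close>

lemma indep_family_insert:
  fixes f :: "'i \<Rightarrow> 'a::euclidean_space"
  assumes "finite I" "e \<notin> I"
  shows "indep_family (insert e I) f \<longleftrightarrow> indep_family I f \<and> f e \<notin> span (f ` I)"
proof -
  have e: "e \<notin> I" "f ` (insert e I) = insert (f e) (f ` I)" using assms(2) by auto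
  show ?thesis
  proof (cases "f e \<in> f ` I")
    case True
    then have "\<not> inj_on f (insert e I)" "f e \<in> span (f ` I)"
      using e(1) by (auto simp: inj_on_def span_base)
    then show ?thesis using assms(1) by (simp add: indep_family_iff_independent del: inj_on_insert)
  next
    case False
    then have "inj_on f (insert e I) \<longleftrightarrow> inj_on f I" using e(1) by simp
    moreover have "independent (insert (f e) (f ` I)) \<longleftrightarrow> independent (f ` I) \<and> f e \<notin> span (f ` I)"
      using False by (simp add: independent_insert)
    ultimately show ?thesis
      using assms(1) e(2) by (simp only: indep_family_iff_independent finite_insert) blast
  qed
qed

definition real_subfield :: "real set \<Rightarrow> bool" where
  "real_subfield K \<longleftrightarrow> 0 \<in> K \<and> 1 \<in> K \<and> (\<forall>x\<in>K. \<forall>y\<in>K. x + y \<in> K \<and> x - y \<in> K \<and> x * y \<in> K) \<and>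
     (\<forall>x\<in>K. inverse x \<in> K)"

lemma real_subfield_closed:
  assumes "real_subfield K"
  shows "0 \<in> K" "1 \<in> K" "x \<in> K \<Longrightarrow> y \<in> K \<Longrightarrow> x + y \<in> K" "x \<in> K \<Longrightarrow> y \<in> K \<Longrightarrow> x - y \<in> K"
    "x \<in> K \<Longrightarrow> y \<in> K \<Longrightarrow> x * y \<in> K" "x \<in> K \<Longrightarrow> inverse x \<in> K" "x \<in> K \<Longrightarrow> y \<in> K \<Longrightarrow> x / y \<in> K"
    "x \<in> K \<Longrightarrow> - x \<in> K" "x \<in> K \<Longrightarrow> x ^ n \<in> K"
proof -
  show *: "0 \<in> K" "1 \<in> K" "\<And>x y. x \<in> K \<Longrightarrow> y \<in> K \<Longrightarrow> x + y \<in> K"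
    "\<And>x y. x \<in> K \<Longrightarrow> y \<in> K \<Longrightarrow> x - y \<in> K" "\<And>x y. x \<in> K \<Longrightarrow> y \<in> K \<Longrightarrow> x * y \<in> K"
    "\<And>x. x \<in> K \<Longrightarrow> inverse x \<in> K"
    using assms by (auto simp: real_subfield_def)
  show "x \<in> K \<Longrightarrow> y \<in> K \<Longrightarrow> x / y \<in> K" by (simp add: * divide_inverse)
  show "x \<in> K \<Longrightarrow> - x \<in> K" using *(4)[of 0 x] *(1) by simp
  show "x \<in> K \<Longrightarrow> x ^ n \<in> K" by (induction n) (auto simp: *)
qed

lemma real_subfield_sum:
  assumes "real_subfield K" "\<And>i. i \<in> I \<Longrightarrow> f i \<in> K"
  shows "sum f I \<in> K"
  using assms(2) by (induction I rule: infinite_finite_induct) (auto simp: real_subfield_closed[OF assms(1)])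

lemma real_subfield_prod:
  assumes "real_subfield K" "\<And>i. i \<in> I \<Longrightarrow> f i \<in> K"
  shows "prod f I \<in> K"
  using assms(2) by (induction I rule: infinite_finite_induct) (auto simp: real_subfield_closed[OF assms(1)])

lemma real_subfield_adjoin_sqrt:
  assumes K: "real_subfield K" and r: "r \<notin> K" "r\<^sup>2 \<in> K"
  shows "real_subfield {a + b * r | a b. a \<in> K \<and> b \<in> K}" (is "real_subfield ?L")
  unfolding real_subfield_def
proof (intro conjI ballI)
  note cl = real_subfield_closed[OF K]
  have "0 = 0 + 0 * r" "1 = 1 + 0 * r" by simp_all
  then show "0 \<in> ?L" "1 \<in> ?L" using cl(1,2) by blast+
  fix x assume "x \<in> ?L"
  then obtain a b where x: "x = a + b * r" "a \<in> K" "b \<in> K" by blast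
  show "inverse x \<in> ?L"
  proof (cases "a - b * r = 0")
    case True
    have "b = 0"
    proof (rule ccontr)
      assume "b \<noteq> 0"
      then have "r = a / b" using True by (simp add: field_simps)
      then show False using r x cl(7)[of a b] by simp
    qed
    then have "inverse x = inverse a + 0 * r" "inverse a \<in> K" "0 \<in> K" using x cl by auto
    then show ?thesis by blast
  next
    case False
    \<comment> \<open>The norm of \<open>a + b * r\<close>, an element of \<open>K\<close>;
      multiplying by the conjugate clears the root from the denominator.\<close>
    let ?d = "a\<^sup>2 - b\<^sup>2 * r\<^sup>2"
    have d: "?d = (a + b * r) * (a - b * r)" by (simp add: power2_eq_square algebra_simps)
    have dK: "?d \<in> K" using x r cl by simp
    have "inverse x = a / ?d + (- b / ?d) * r"
    proof (cases "x = 0")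
      case True
      then show ?thesis using d x by simp
    next
      case x0: False
      have "a / ?d + (- b / ?d) * r = (a - b * r) / ?d" by (simp add: diff_divide_distrib)
      also have "\<dots> = inverse x" unfolding d using x0 False x by (simp add: divide_simps)
      finally show ?thesis by simp
    qed
    moreover have "a / ?d \<in> K" "- b / ?d \<in> K" using x dK cl(7,8) by blast+
    ultimately show ?thesis by blast
  qed
  fix y assume "y \<in> ?L"
  then obtain a' b' where y: "y = a' + b' * r" "a' \<in> K" "b' \<in> K" by blast
  have "x + y = (a + a') + (b + b') * r" "x - y = (a - a') + (b - b') * r"
    "x * y = (a * a' + b * b' * r\<^sup>2) + (a * b' + b * a') * r"
    using x y by (auto simp: algebra_simps power2_eq_square)
  moreover have "a + a' \<in> K" "b + b' \<in> K" "a - a' \<in> K" "b - b' \<in> K"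
    "a * a' + b * b' * r\<^sup>2 \<in> K" "a * b' + b * a' \<in> K"
    using x(2,3) y(2,3) r(2) cl(3-5) by simp_all
  ultimately show "x + y \<in> ?L" "x - y \<in> ?L" "x * y \<in> ?L" by blast+
qed

text \<open>Adjoining one square root at a time preserves the hypothesis that no nonempty product of the
  remaining roots lies in the field.\<close>

lemma real_subfield_adjoin_other_sqrts:
  assumes "finite S" "e \<notin> S" "real_subfield K"
    and "\<And>i. i \<in> insert e S \<Longrightarrow> (r i)\<^sup>2 \<in> K"
    and "\<And>J. J \<subseteq> insert e S \<Longrightarrow> J \<noteq> {} \<Longrightarrow> prod r J \<notin> K"
  shows "\<exists>K'. real_subfield K' \<and> K \<subseteq> K' \<and> r ` S \<subseteq> K' \<and> r e \<notin> K'"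
  using assms
proof (induction S arbitrary: K rule: finite_induct)
  case empty
  then show ?case using empty(4)[of "{e}"] by (intro exI[of _ K]) auto
next
  case (insert j S)
  note cl = real_subfield_closed[OF insert.prems(2)]
  have rj: "r j \<notin> K" "(r j)\<^sup>2 \<in> K"
    using insert.prems(4)[of "{j}"] insert.prems(3) by auto
  define L where "L = {a + b * r j | a b. a \<in> K \<and> b \<in> K}"
  have L: "real_subfield L" unfolding L_def by (rule real_subfield_adjoin_sqrt[OF insert.prems(2) rj])
  have KL: "K \<subseteq> L" unfolding L_def
  proof
    fix x assume "x \<in> K"
    moreover have "x = x + 0 * r j" by simp
    ultimately show "x \<in> {a + b * r j | a b. a \<in> K \<and> b \<in> K}" using cl(1) by blast
  qed
  have "r j = 0 + 1 * r j" by simp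
  then have rL: "r j \<in> L" unfolding L_def using cl(1,2) by blast
  \<comment> \<open>If the product is \<open>a + b * r j\<close>, its square lies in
    \<open>K\<close>, which forces \<open>2 * a * b = 0\<close> because \<open>r j\<close> is not in
    \<open>K\<close>. Then either the product over \<open>J\<close> or the product over
    \<open>insert j J\<close> is in \<open>K\<close>, and both are excluded.\<close>
  have "prod r J \<notin> L" if J: "J \<subseteq> insert e S" "J \<noteq> {}" for J
  proof
    assume "prod r J \<in> L"
    then obtain a b where ab: "prod r J = a + b * r j" "a \<in> K" "b \<in> K" unfolding L_def by blast
    have finJ: "finite J" "j \<notin> J" using J insert by (auto intro: finite_subset)
    have nK: "prod r J \<notin> K" "prod r (insert j J) \<notin> K"
      using insert.prems(4)[of J] insert.prems(4)[of "insert j J"] J by auto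
    have "(\<Prod>i\<in>J. (r i)\<^sup>2) \<in> K"
      using J insert.prems(2,3) by (intro real_subfield_prod) auto
    then have *: "(a + b * r j)\<^sup>2 \<in> K" by (simp add: prod_power_distrib flip: ab(1))
    have sq2: "(a + b * r j)\<^sup>2 = a\<^sup>2 + b\<^sup>2 * (r j)\<^sup>2 + (2 * a * b) * r j"
      by (simp add: power2_eq_square algebra_simps)
    have "a\<^sup>2 + b\<^sup>2 * (r j)\<^sup>2 \<in> K" using ab rj cl by simp
    with * have "(a + b * r j)\<^sup>2 - (a\<^sup>2 + b\<^sup>2 * (r j)\<^sup>2) \<in> K"
      using cl(4) by blast
    then have K1: "(2 * a * b) * r j \<in> K" unfolding sq2 by simp
    have "2 * a * b \<in> K" using ab cl(3)[OF cl(2,2)] by (auto intro!: cl)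
    have "2 * a * b = 0"
    proof (rule ccontr)
      assume nz: "2 * a * b \<noteq> 0"
      have "r j = (2 * a * b * r j) / (2 * a * b)" using nz by simp
      then show False using cl(7)[OF K1 \<open>2 * a * b \<in> K\<close>] rj by simp
    qed
    then consider "a = 0" | "b = 0" by auto
    then show False
    proof cases
      case 1
      then have "prod r (insert j J) = b * (r j)\<^sup>2"
        using finJ ab by (simp add: power2_eq_square)
      then show False using nK ab rj cl by simp
    next
      case 2
      then show False using nK ab by simp
    qed
  qed
  moreover have "(r i)\<^sup>2 \<in> L" if "i \<in> insert e S" for i
    using that insert.prems(3)[of i] KL by (intro subsetD[OF KL]) auto
  ultimately have "\<exists>K'. real_subfield K' \<and> L \<subseteq> K' \<and> r ` S \<subseteq> K' \<and> r e \<notin> K'"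
    using insert.prems(1) L by (intro insert.IH) simp_all
  then obtain K' where "real_subfield K'" "L \<subseteq> K'" "r ` S \<subseteq> K'" "r e \<notin> K'" by (elim exE conjE)
  then show ?case using KL rL by blast
qed

section \<open>Vectors with entries in a subfield\<close>

definition entries_in :: "real set \<Rightarrow> 'a::euclidean_space \<Rightarrow> bool" where
  "entries_in K x \<longleftrightarrow> (\<forall>b\<in>Basis. x \<bullet> b \<in> K)"

lemma entries_in_inner:
  assumes "real_subfield K" "entries_in K x" "entries_in K y"
  shows "x \<bullet> y \<in> K"
  unfolding euclidean_inner[of x y]
  using assms by (intro real_subfield_sum) (auto simp: entries_in_def real_subfield_closed)

lemma entries_in_closed:
  assumes "real_subfield K" "entries_in K x"
  shows "entries_in K y \<Longrightarrow> entries_in K (x + y)" "entries_in K y \<Longrightarrow> entries_in K (x - y)"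
    "c \<in> K \<Longrightarrow> entries_in K (c *\<^sub>R x)"
  using assms real_subfield_closed[OF assms(1)]
  by (auto simp: entries_in_def inner_add_left inner_diff_left)

lemma inner_span_zero:
  assumes "\<And>b. b \<in> B \<Longrightarrow> y \<bullet> b = 0" "x \<in> span B"
  shows "y \<bullet> x = 0"
  using orthogonal_to_span[OF assms(2), of y] assms(1) by (simp add: orthogonal_def)

text \<open>Gram-Schmidt orthogonalisation without normalisation does not leave the field.\<close>

lemma orthogonal_part_entries_in:
  assumes "finite B" "real_subfield K" "\<And>b. b \<in> B \<Longrightarrow> entries_in K b" "entries_in K y"
  shows "\<exists>y'. entries_in K y' \<and> y - y' \<in> span B \<and> (\<forall>b\<in>B. y' \<bullet> b = 0)"
  using assms(1,3,4)
proof (induction B arbitrary: y rule: finite_induct)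
  case empty
  then show ?case by (intro exI[of _ y]) auto
next
  case (insert b B)
  obtain b' where b': "entries_in K b'" "b - b' \<in> span B" "\<forall>c\<in>B. b' \<bullet> c = 0"
    using insert.IH[of b] insert.prems by auto
  obtain y' where y': "entries_in K y'" "y - y' \<in> span B" "\<forall>c\<in>B. y' \<bullet> c = 0"
    using insert.IH[of y] insert.prems by auto
  have sub: "span B \<subseteq> span (insert b B)" by (intro span_mono) auto
  show ?case
  proof (cases "b' = 0")
    case True
    then have "y' \<bullet> b = 0" using inner_span_zero[of B y' b] y'(3) b'(2) by auto
    then show ?thesis using y' sub by blast
  next
    case False
    define k where "k = (y' \<bullet> b') / (b' \<bullet> b')"
    define z where "z = y' - k *\<^sub>R b'"
    have "k \<in> K"
      unfolding k_def by (intro real_subfield_closed(7)[OF assms(2)] entries_in_inner[OF assms(2)] y' b')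
    then have zK: "entries_in K z"
      unfolding z_def by (intro entries_in_closed[OF assms(2)] y' b')
    have zB: "z \<bullet> c = 0" if "c \<in> B" for c
      using that y' b' by (simp add: z_def inner_diff_left)
    have "z \<bullet> b' = 0" using False by (simp add: z_def k_def inner_diff_left)
    moreover have "z \<bullet> (b - b') = 0" using inner_span_zero[of B z] zB b'(2) by blast
    ultimately have zb: "z \<bullet> b = 0" by (simp add: inner_diff_right)
    have "b' \<in> span (insert b B)"
      using span_diff[of b "insert b B" "b - b'"] b'(2) sub by (auto intro: span_base)
    then have "(y - y') + k *\<^sub>R b' \<in> span (insert b B)"
      using y'(2) sub by (intro span_add span_scale) auto
    moreover have "y - z = (y - y') + k *\<^sub>R b'" by (simp add: z_def)
    ultimately have "y - z \<in> span (insert b B)" by (simp only:)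
    then show ?thesis using zK zB zb by (intro exI[of _ z]) auto
  qed
qed

text \<open>If \<open>y\<close> is the one of \<open>a\<close>, \<open>c\<close> outside the span,
  its part \<open>z\<close> orthogonal to \<open>B\<close> has entries in \<open>K\<close> and pairs
  to a nonzero number with \<open>y\<close>. Membership of the combination would give
  \<open>z \<bullet> a + r * (z \<bullet> c) = 0\<close>, and since \<open>r\<close> is not in
  \<open>K\<close> both inner products would vanish.\<close>

lemma combination_notin_span:
  assumes "finite B" "real_subfield K" "\<And>b. b \<in> B \<Longrightarrow> entries_in K b"
    and ac: "entries_in K a" "entries_in K c" "a \<notin> span B \<or> c \<notin> span B" and r: "r \<notin> K"
  shows "a + r *\<^sub>R c \<notin> span B"
proof
  assume sp: "a + r *\<^sub>R c \<in> span B"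
  obtain y where y: "y = a \<or> y = c" "y \<notin> span B" "entries_in K y" using ac by blast
  obtain z where z: "entries_in K z" "y - z \<in> span B" "\<And>b. b \<in> B \<Longrightarrow> z \<bullet> b = 0"
    using orthogonal_part_entries_in[OF assms(1-3) y(3)] by blast
  have "z \<noteq> 0" using z(2) y(2) by auto
  moreover have "z \<bullet> (y - z) = 0" using inner_span_zero[of B z] z by blast
  ultimately have zy: "z \<bullet> y \<noteq> 0" by (simp add: inner_diff_right)
  have "z \<bullet> (a + r *\<^sub>R c) = 0" using inner_span_zero[of B z] z(3) sp by blast
  then have eq: "z \<bullet> a + r * (z \<bullet> c) = 0" by (simp add: inner_add_right)
  have "z \<bullet> c = 0"
  proof (rule ccontr)
    assume "z \<bullet> c \<noteq> 0"
    then have "r = - (z \<bullet> a) / (z \<bullet> c)" using eq by (simp add: field_simps)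
    moreover have "- (z \<bullet> a) / (z \<bullet> c) \<in> K"
      by (intro real_subfield_closed(7,8)[OF assms(2)] entries_in_inner[OF assms(2) z(1)] ac)
    ultimately show False using r by simp
  qed
  then show False using zy y(1) eq by auto
qed

text \<open>The indices in \<open>P\<close> already carry the mixed vector, all others still carry
  \<open>u\<close> or \<open>w\<close> alone. When \<open>e\<close> joins \<open>P\<close>, the
  field \<open>K'\<close> contains the entries of all other current vectors but not
  \<open>r e\<close>; the current vector at \<open>e\<close> is \<open>u e\<close> or
  \<open>w e\<close> and lies outside their span, hence so does the mixture.\<close>

lemma indep_family_sqrt_combination:
  fixes u w :: "'i \<Rightarrow> 'a::euclidean_space"
  assumes fin: "finite A" and K: "real_subfield K"
    and ent: "\<And>i. i \<in> A \<Longrightarrow> entries_in K (u i)" "\<And>i. i \<in> A \<Longrightarrow> entries_in K (w i)"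
    and sq: "\<And>i. i \<in> A \<Longrightarrow> (r i)\<^sup>2 \<in> K"
    and pr: "\<And>J. J \<subseteq> A \<Longrightarrow> J \<noteq> {} \<Longrightarrow> prod r J \<notin> K"
    and ind: "indep_family A (\<lambda>i. if i \<in> H then u i else w i)"
  shows "indep_family A (\<lambda>i. u i + r i *\<^sub>R w i)"
proof -
  define F where "F P i = (if i \<in> P then u i + r i *\<^sub>R w i else if i \<in> H then u i else w i)" for P i
  have "indep_family A (F P)" if "P \<subseteq> A" "finite P" for P
    using that(2,1)
  proof (induction P rule: finite_induct)
    case empty
    then show ?case using ind by (simp add: F_def[abs_def])
  next
    case (insert e P)
    let ?I = "A - {e}"
    have e: "e \<in> A" "insert e ?I = A" "finite ?I" "e \<notin> ?I" using insert fin by auto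
    have IH: "indep_family ?I (F P)" "F P e \<notin> span (F P ` ?I)"
      using insert.IH insert.prems indep_family_insert[OF e(3,4), of "F P"] e(2) by auto
    obtain K' where K': "real_subfield K'" "K \<subseteq> K'" "r ` ?I \<subseteq> K'" "r e \<notin> K'"
      using real_subfield_adjoin_other_sqrts[OF e(3,4) K] sq pr unfolding e(2) by blast
    have ent': "entries_in K' (u i)" "entries_in K' (w i)" if "i \<in> A" for i
      using ent[OF that] K'(2) by (auto simp: entries_in_def)
    have FK: "entries_in K' b" if b: "b \<in> F P ` ?I" for b
    proof -
      from b obtain i where i: "i \<in> ?I" "b = F P i" by blast
      then show ?thesis using ent'[of i] K'(3)
        by (auto simp: F_def image_subset_iff intro!: entries_in_closed[OF K'(1)])
    qed
    have "F P e = u e \<or> F P e = w e" using insert.hyps(2) by (simp add: F_def)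
    then have "u e \<notin> span (F P ` ?I) \<or> w e \<notin> span (F P ` ?I)" using IH(2) by metis
    then have "u e + r e *\<^sub>R w e \<notin> span (F P ` ?I)"
      using combination_notin_span[OF finite_imageI[OF e(3)] K'(1) FK ent'[OF e(1)] _ K'(4)] by metis
    moreover have "F (insert e P) e = u e + r e *\<^sub>R w e" by (simp add: F_def)
    moreover have eq: "F (insert e P) i = F P i" if "i \<in> ?I" for i using that by (simp add: F_def)
    moreover have "F (insert e P) ` ?I = F P ` ?I" using eq by (intro image_cong) auto
    moreover have "indep_family ?I (F (insert e P))" by (rule iffD2[OF indep_family_cong[OF eq] IH(1)])
    ultimately have "indep_family (insert e ?I) (F (insert e P))"
      by (subst indep_family_insert[OF e(3,4)]) simp
    then show ?case unfolding e(2) .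
  qed
  from this[OF order_refl fin] show ?thesis by (simp add: F_def[abs_def] cong: indep_family_cong)
qed

section \<open>Points with generic distances\<close>

text \<open>The coefficients are real, but the polynomials are complex because the later argument
  counts orders of vanishing at non-real roots.\<close>

definition coeffs_in :: "real set \<Rightarrow> complex poly \<Rightarrow> bool" where
  "coeffs_in K f \<longleftrightarrow> (\<forall>i. coeff f i \<in> complex_of_real ` K)"

lemma of_real_image_closed:
  assumes "real_subfield K"
  shows "0 \<in> complex_of_real ` K" "1 \<in> complex_of_real ` K"
    "x \<in> complex_of_real ` K \<Longrightarrow> y \<in> complex_of_real ` K \<Longrightarrow> x + y \<in> complex_of_real ` K"
    "x \<in> complex_of_real ` K \<Longrightarrow> y \<in> complex_of_real ` K \<Longrightarrow> x - y \<in> complex_of_real ` K"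
    "x \<in> complex_of_real ` K \<Longrightarrow> y \<in> complex_of_real ` K \<Longrightarrow> x * y \<in> complex_of_real ` K"
proof -
  note cl = real_subfield_closed[OF assms]
  show "0 \<in> complex_of_real ` K" using cl(1) by (intro image_eqI[of _ _ 0]) auto
  show "1 \<in> complex_of_real ` K" using cl(2) by (intro image_eqI[of _ _ 1]) auto
  show "x \<in> complex_of_real ` K \<Longrightarrow> y \<in> complex_of_real ` K \<Longrightarrow> x + y \<in> complex_of_real ` K"
    using cl(3) by (auto simp flip: of_real_add)
  show "x \<in> complex_of_real ` K \<Longrightarrow> y \<in> complex_of_real ` K \<Longrightarrow> x - y \<in> complex_of_real ` K"
    using cl(4) by (auto simp flip: of_real_diff)
  show "x \<in> complex_of_real ` K \<Longrightarrow> y \<in> complex_of_real ` K \<Longrightarrow> x * y \<in> complex_of_real ` K"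
    using cl(5) by (auto simp flip: of_real_mult)
qed

lemma of_real_image_sum:
  assumes "real_subfield K" "\<And>i. i \<in> I \<Longrightarrow> f i \<in> complex_of_real ` K"
  shows "sum f I \<in> complex_of_real ` K"
  using assms(2)
  by (induction I rule: infinite_finite_induct) (simp_all add: of_real_image_closed[OF assms(1)])

lemma coeffs_in_closed:
  assumes "real_subfield K"
  shows "coeffs_in K 0" "coeffs_in K 1" "coeffs_in K [:0, 1:]" "c \<in> K \<Longrightarrow> coeffs_in K [:complex_of_real c:]"
    "coeffs_in K f \<Longrightarrow> coeffs_in K g \<Longrightarrow> coeffs_in K (f + g)"
    "coeffs_in K f \<Longrightarrow> coeffs_in K g \<Longrightarrow> coeffs_in K (f - g)"
    "coeffs_in K f \<Longrightarrow> coeffs_in K g \<Longrightarrow> coeffs_in K (f * g)"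
proof -
  note cl = of_real_image_closed[OF assms]
  show "coeffs_in K 0" "coeffs_in K 1" using cl(1,2) by (simp_all add: coeffs_in_def coeff_1)
  show "coeffs_in K [:0, 1:]" "c \<in> K \<Longrightarrow> coeffs_in K [:complex_of_real c:]"
    using cl(1,2) by (auto simp: coeffs_in_def coeff_pCons split: nat.split)
  show "coeffs_in K f \<Longrightarrow> coeffs_in K g \<Longrightarrow> coeffs_in K (f + g)"
    "coeffs_in K f \<Longrightarrow> coeffs_in K g \<Longrightarrow> coeffs_in K (f - g)"
    using cl(3,4) by (simp_all add: coeffs_in_def)
  show "coeffs_in K f \<Longrightarrow> coeffs_in K g \<Longrightarrow> coeffs_in K (f * g)"
    using cl(5) by (auto simp: coeffs_in_def coeff_mult intro!: of_real_image_sum[OF assms])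
qed

lemma coeffs_in_prod:
  assumes "real_subfield K" "\<And>i. i \<in> I \<Longrightarrow> coeffs_in K (f i)"
  shows "coeffs_in K (prod f I)"
  using assms(2)
  by (induction I rule: infinite_finite_induct) (simp_all add: coeffs_in_closed[OF assms(1)])

lemma countable_coeffs_in:
  assumes "countable K"
  shows "countable {f. coeffs_in K f}"
proof -
  have "{f. coeffs_in K f} \<subseteq> Poly ` lists (complex_of_real ` K)"
  proof
    fix f assume "f \<in> {f. coeffs_in K f}"
    then have "set (coeffs f) \<subseteq> complex_of_real ` K"
      by (auto simp: coeffs_in_def coeffs_def)
    moreover have "f = Poly (coeffs f)" by simp
    ultimately show "f \<in> Poly ` lists (complex_of_real ` K)" by blast
  qed
  moreover have "countable (Poly ` lists (complex_of_real ` K))"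
    using assms by (intro countable_image countable_lists)
  ultimately show ?thesis using countable_subset by blast
qed

definition transcendental_over :: "real set \<Rightarrow> real \<Rightarrow> bool" where
  "transcendental_over K t \<longleftrightarrow> (\<forall>f. coeffs_in K f \<longrightarrow> poly f (complex_of_real t) = 0 \<longrightarrow> f = 0)"

text \<open>Countably many nonzero polynomials have countably many roots in total, too few to cover
  an interval.\<close>

lemma transcendental_over_exists:
  assumes "countable K" "lo < hi"
  obtains t where "lo < t" "t < hi" "transcendental_over K t"
proof -
  let ?A = "\<Union>f\<in>{f. coeffs_in K f} - {0}. {t. poly f (complex_of_real t) = 0}"
  have "countable {t. poly f (complex_of_real t) = 0}" if "f \<noteq> 0" for f
  proof -
    have "finite (complex_of_real -` {z. poly f z = 0})"
      using poly_roots_finite[OF that] by (intro finite_vimageI) (auto simp: inj_on_def)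
    then show ?thesis by (simp add: vimage_def countable_finite)
  qed
  then have "countable ?A"
    using countable_coeffs_in[OF assms(1)] by (intro countable_UN) auto
  then have "\<not> {lo<..<hi} \<subseteq> ?A"
    using uncountable_open_interval[of lo hi] assms(2) countable_subset by auto
  then obtain t where "t \<in> {lo<..<hi}" "t \<notin> ?A" by blast
  then have "lo < t" "t < hi" "t \<notin> ?A" by simp_all
  then show ?thesis using that by (auto simp: transcendental_over_def)
qed

text \<open>The field K(t), as the values at t of rational functions. A vanishing denominator does
  no harm, since division by zero yields 0, which is in the field anyway.\<close>

definition adjoin :: "real set \<Rightarrow> real \<Rightarrow> real set" where
  "adjoin K t = {z. \<exists>f g. coeffs_in K f \<and> coeffs_in K g \<and>
     complex_of_real z = poly f (complex_of_real t) / poly g (complex_of_real t)}"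

lemma adjoinE:
  assumes "z \<in> adjoin K t" "real_subfield K"
  obtains f g where "coeffs_in K f" "coeffs_in K g" "poly g (complex_of_real t) \<noteq> 0"
    "complex_of_real z = poly f (complex_of_real t) / poly g (complex_of_real t)"
proof -
  obtain f g where fg: "coeffs_in K f" "coeffs_in K g"
    "complex_of_real z = poly f (complex_of_real t) / poly g (complex_of_real t)"
    using assms(1) by (auto simp: adjoin_def)
  show ?thesis
  proof (cases "poly g (complex_of_real t) = 0")
    case True
    then show ?thesis using fg coeffs_in_closed(1,2)[OF assms(2)] that[of 0 1] by auto
  next
    case False
    then show ?thesis using fg that by blast
  qed
qed

lemma adjoinI:
  "coeffs_in K f \<Longrightarrow> coeffs_in K g \<Longrightarrow>
    complex_of_real z = poly f (complex_of_real t) / poly g (complex_of_real t) \<Longrightarrow> z \<in> adjoin K t"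
  unfolding adjoin_def by blast

lemma real_subfield_adjoin:
  assumes K: "real_subfield K"
  shows "real_subfield (adjoin K t)" "K \<subseteq> adjoin K t" "t \<in> adjoin K t"
proof -
  note cl = coeffs_in_closed[OF K]
  show sub: "K \<subseteq> adjoin K t"
  proof
    fix x assume "x \<in> K"
    then show "x \<in> adjoin K t"
      using cl(4)[of x] cl(2) by (intro adjoinI[of _ "[:complex_of_real x:]" 1]) auto
  qed
  show "t \<in> adjoin K t" using cl(2,3) by (intro adjoinI[of _ "[:0, 1:]" 1]) auto
  show "real_subfield (adjoin K t)"
    unfolding real_subfield_def
  proof (intro conjI ballI)
    show "0 \<in> adjoin K t" "1 \<in> adjoin K t" using sub real_subfield_closed(1,2)[OF K] by auto
    fix x assume "x \<in> adjoin K t"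
    then obtain f g where x: "coeffs_in K f" "coeffs_in K g" "poly g (complex_of_real t) \<noteq> 0"
      "complex_of_real x = poly f (complex_of_real t) / poly g (complex_of_real t)"
      by (rule adjoinE[OF _ K])
    show "inverse x \<in> adjoin K t"
      by (rule adjoinI[OF x(2,1)]) (simp add: x(4))
    fix y assume "y \<in> adjoin K t"
    then obtain f' g' where y: "coeffs_in K f'" "coeffs_in K g'" "poly g' (complex_of_real t) \<noteq> 0"
      "complex_of_real y = poly f' (complex_of_real t) / poly g' (complex_of_real t)"
      by (rule adjoinE[OF _ K])
    show "x + y \<in> adjoin K t"
      by (rule adjoinI[of _ "f * g' + f' * g" "g * g'"])
        (use x y in \<open>auto intro!: cl simp: add_frac_eq mult.commute\<close>)
    show "x - y \<in> adjoin K t"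
      by (rule adjoinI[of _ "f * g' - f' * g" "g * g'"])
        (use x y in \<open>auto intro!: cl simp: diff_frac_eq mult.commute\<close>)
    show "x * y \<in> adjoin K t"
      by (rule adjoinI[of _ "f * f'" "g * g'"]) (use x y in \<open>auto intro!: cl\<close>)
  qed
qed

lemma countable_adjoin:
  assumes "countable K"
  shows "countable (adjoin K t)"
proof -
  let ?P = "{f. coeffs_in K f}"
  have "adjoin K t \<subseteq>
      (\<lambda>(f, g). Re (poly f (complex_of_real t) / poly g (complex_of_real t))) ` (?P \<times> ?P)"
  proof
    fix z assume "z \<in> adjoin K t"
    then obtain f g where "coeffs_in K f" "coeffs_in K g"
      "complex_of_real z = poly f (complex_of_real t) / poly g (complex_of_real t)"
      by (auto simp: adjoin_def)
    then show "z \<in> (\<lambda>(f, g). Re (poly f (complex_of_real t) / poly g (complex_of_real t))) ` (?P \<times> ?P)"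
      by (intro image_eqI[of _ _ "(f, g)"]) (auto simp flip: \<open>complex_of_real z = _\<close>)
  qed
  moreover have "countable (?P \<times> ?P)" using countable_coeffs_in[OF assms] by simp
  ultimately show ?thesis using countable_subset by blast
qed

lemma countable_real_subfield_containing:
  assumes "finite B"
  shows "\<exists>K. real_subfield K \<and> countable K \<and> B \<subseteq> K"
  using assms
proof (induction B rule: finite_induct)
  case empty
  have "real_subfield \<rat>" by (auto simp: real_subfield_def)
  then show ?case using countable_rat by blast
next
  case (insert b B)
  then obtain K where "real_subfield K" "countable K" "B \<subseteq> K" by blast
  then show ?case
    using real_subfield_adjoin[of K b] countable_adjoin[of K b] by (intro exI[of _ "adjoin K b"]) auto
qed

text \<open>The polynomial (X - a)^2 + d^2. With X the real part of a moving point, it is the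
  squared distance to a point of real part a whose imaginary part differs by d.\<close>

definition norm_poly :: "real \<Rightarrow> real \<Rightarrow> complex poly" where
  "norm_poly a d = [:complex_of_real (a\<^sup>2 + d\<^sup>2), complex_of_real (- 2 * a), 1:]"

lemma poly_norm_poly: "poly (norm_poly a d) z = (z - complex_of_real a)\<^sup>2 + (complex_of_real d)\<^sup>2"
  by (simp add: norm_poly_def power2_eq_square algebra_simps)

lemma norm_poly_factor:
  "norm_poly a d = [:- (complex_of_real a + \<i> * complex_of_real d), 1:] *
     [:- (complex_of_real a - \<i> * complex_of_real d), 1:]"
  by (simp add: norm_poly_def power2_eq_square algebra_simps)

lemma order_norm_poly:
  assumes "d \<noteq> 0"
  shows "order (complex_of_real a + \<i> * complex_of_real d) (norm_poly a d) = 1"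
proof -
  let ?r = "complex_of_real a + \<i> * complex_of_real d"
  have "order ?r (norm_poly a d) = order ?r [:- ?r, 1:] +
      order ?r [:- (complex_of_real a - \<i> * complex_of_real d), 1:]"
    unfolding norm_poly_factor by (rule order_mult) (simp del: mult_pCons_left mult_pCons_right)
  also have "order ?r [:- ?r, 1:] = 1"
    using order_power_n_n[of ?r 1] by simp
  also have "order ?r [:- (complex_of_real a - \<i> * complex_of_real d), 1:] = 0"
    using assms by (intro order_0I) simp
  finally show ?thesis by simp
qed

text \<open>At the root a + i d of one factor, the imaginary part of the other factor is 2 (a - a')
  d.\<close>

lemma norm_poly_common_root:
  assumes "poly (norm_poly a' d') (complex_of_real a + \<i> * complex_of_real d) = 0" "d \<noteq> 0"
  shows "a' = a"
proof -
  have "(\<i> * complex_of_real d + complex_of_real (a - a'))\<^sup>2 + (complex_of_real d')\<^sup>2 = 0"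
    using assms(1) by (simp add: poly_norm_poly algebra_simps)
  from arg_cong[OF this, of Im] have "2 * (a - a') * d = 0"
    by (simp add: power2_eq_square algebra_simps)
  then show ?thesis using assms(2) by simp
qed

lemma coeffs_in_norm_poly:
  assumes "real_subfield K" "a \<in> K" "d \<in> K"
  shows "coeffs_in K (norm_poly a d)"
proof -
  note cl = real_subfield_closed[OF assms(1)]
  have "a\<^sup>2 + d\<^sup>2 \<in> K" "- 2 * a \<in> K"
    using assms(2,3) cl cl(8)[OF cl(3)[OF assms(2,2)]] by simp_all
  then show ?thesis
    using of_real_image_closed(1,2)[OF assms(1)]
    unfolding norm_poly_def coeffs_in_def
    by (auto simp: coeff_pCons simp del: of_real_add of_real_mult split: nat.split)
qed

text \<open>A root of one factor is not real and is not a root of any other factor, so the product has odd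
  order there.\<close>

lemma prod_norm_poly_not_square:
  assumes "finite Q" "Q \<noteq> {}" "inj_on a Q" "\<And>u. u \<in> Q \<Longrightarrow> d u \<noteq> 0" "g \<noteq> 0" "c \<noteq> 0"
  shows "g ^ 2 * ([:c:] * (\<Prod>u\<in>Q. norm_poly (a u) (d u))) \<noteq> f ^ 2"
proof
  assume eq: "g ^ 2 * ([:c:] * (\<Prod>u\<in>Q. norm_poly (a u) (d u))) = f ^ 2"
  obtain u where u: "u \<in> Q" using assms(2) by blast
  let ?z = "complex_of_real (a u) + \<i> * complex_of_real (d u)"
  let ?R = "\<Prod>w\<in>Q - {u}. norm_poly (a w) (d w)"
  have R: "poly ?R ?z \<noteq> 0"
  proof
    assume "poly ?R ?z = 0"
    then obtain w where "w \<in> Q - {u}" "poly (norm_poly (a w) (d w)) ?z = 0"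
      using assms(1) by (auto simp: poly_prod)
    then show False
      using norm_poly_common_root[of "a w" "d w" "a u" "d u"] assms(3,4) u by (auto dest: inj_onD)
  qed
  have nz: "norm_poly (a u) (d u) \<noteq> 0" "?R \<noteq> 0" using R by (auto simp: norm_poly_def)
  have eq2: "f ^ 2 = g ^ 2 * ([:c:] * (norm_poly (a u) (d u) * ?R))"
    using eq u assms(1) by (simp add: prod.remove[of Q u])
  have "order ?z (f ^ 2) = order ?z (g ^ 2) + (order ?z [:c:] + (order ?z (norm_poly (a u) (d u)) + order ?z ?R))"
    unfolding eq2 using nz assms(5,6) by (subst order_mult | simp)+
  moreover have "order ?z ?R = 0" using R by (rule order_0I)
  moreover have "order ?z [:c:] = 0" using assms(6) by (intro order_0I) simp
  moreover have "f \<noteq> 0" using eq2 nz assms(5,6) by auto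
  then have "order ?z (f ^ 2) = 2 * order ?z f" "order ?z (g ^ 2) = 2 * order ?z g"
    using assms(5) by (simp_all add: power2_eq_square order_mult)
  ultimately have "2 * order ?z f = 2 * order ?z g + 1"
    using order_norm_poly[of "d u" "a u"] assms(4)[OF u] by simp
  then show False by presburger
qed

text \<open>Compare leading coefficients: a constant that is a square of a rational function over
  \<open>K\<close> is a square in \<open>K\<close>.\<close>

lemma leading_coeff_square_quotient:
  assumes "real_subfield K" "coeffs_in K f" "coeffs_in K g" "g \<noteq> 0"
    and "g ^ 2 * [:complex_of_real c:] = f ^ 2"
  shows "\<exists>y\<in>K. c = y\<^sup>2"
proof -
  obtain x where x: "x \<in> K" "lead_coeff f = complex_of_real x" using assms(2) by (auto simp: coeffs_in_def)
  obtain y where y: "y \<in> K" "lead_coeff g = complex_of_real y" using assms(3) by (auto simp: coeffs_in_def)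
  have lc: "lead_coeff [:complex_of_real c:] = complex_of_real c" by simp
  have "lead_coeff g ^ 2 * complex_of_real c = lead_coeff f ^ 2"
    using arg_cong[OF assms(5), of lead_coeff] by (simp only: lead_coeff_mult lead_coeff_power lc)
  then have "complex_of_real (y\<^sup>2 * c) = complex_of_real (x\<^sup>2)" using x y by simp
  then have "y\<^sup>2 * c = x\<^sup>2" by (simp only: of_real_eq_iff)
  moreover have "y \<noteq> 0" using y assms(4) by auto
  ultimately have "c = (x / y)\<^sup>2" by (simp add: field_simps)
  then show ?thesis using real_subfield_closed(7)[OF assms(1) x(1) y(1)] by blast
qed

section \<open>Adding points one at a time\<close>

definition vertex_pairs :: "'v set \<Rightarrow> 'v set set" where
  "vertex_pairs P = {e. \<exists>u\<in>P. \<exists>w\<in>P. u \<noteq> w \<and> e = {u, w}}"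

text \<open>Suppose the product were f(t) / g(t). Its square is a constant \<open>c\<close> of
  \<open>K\<close>, from the pairs inside \<open>P\<close>, times a product of values of
  \<open>norm_poly\<close> at t, one for each pair at \<open>v\<close>. As t is transcendental,
  squaring gives an identity of polynomials. If some pair contains \<open>v\<close>, orders of
  vanishing contradict it; otherwise \<open>c\<close> is a square in \<open>K\<close>, so the
  product over the pairs inside \<open>P\<close> was already in \<open>K\<close>.\<close>

lemma prod_edge_length_insert_notin:
  fixes a b :: "'v::finite \<Rightarrow> real" and P :: "'v set"
  defines "x \<equiv> (\<lambda>a. (\<chi> v. Complex (a v) (b v)))"
  assumes K: "real_subfield K" and b: "inj b" "range b \<subseteq> K" and a: "a ` P \<subseteq> K" "inj_on a P"
    and pr: "\<And>S. S \<subseteq> vertex_pairs P \<Longrightarrow> S \<noteq> {} \<Longrightarrow> prod (edge_length (x a)) S \<notin> K"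
    and v: "v \<notin> P" and t: "transcendental_over K t"
    and S: "S \<subseteq> vertex_pairs (insert v P)" "S \<noteq> {}"
  shows "prod (edge_length (x (a(v := t)))) S \<notin> adjoin K t"
proof
  let ?l = "edge_length (x (a(v := t)))"
  assume "prod ?l S \<in> adjoin K t"
  then obtain f g where fg: "coeffs_in K f" "coeffs_in K g" "poly g (complex_of_real t) \<noteq> 0"
    "complex_of_real (prod ?l S) = poly f (complex_of_real t) / poly g (complex_of_real t)"
    by (rule adjoinE[OF _ K])
  define Q where "Q = {u \<in> P. {u, v} \<in> S}"
  define S0 where "S0 = S \<inter> vertex_pairs P"
  have Seq: "S = S0 \<union> (\<lambda>u. {u, v}) ` Q"
  proof (intro equalityI subsetI)
    fix e assume e: "e \<in> S"
    then have "e \<in> vertex_pairs (insert v P)" using S(1) by blast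
    then obtain u w where uw: "u \<in> insert v P" "w \<in> insert v P" "u \<noteq> w" "e = {u, w}"
      unfolding vertex_pairs_def by blast
    show "e \<in> S0 \<union> (\<lambda>u. {u, v}) ` Q"
    proof (cases "u = v \<or> w = v")
      case True
      then have "e = {if u = v then w else u, v}" using uw by (auto simp: insert_commute)
      moreover have "(if u = v then w else u) \<in> P" using uw True by auto
      ultimately show ?thesis using e by (auto simp: Q_def)
    next
      case False
      then show ?thesis using uw e by (auto simp: S0_def vertex_pairs_def)
    qed
  qed (auto simp: S0_def Q_def)
  have disj: "S0 \<inter> (\<lambda>u. {u, v}) ` Q = {}"
    using v by (auto simp: S0_def vertex_pairs_def Q_def doubleton_eq_iff)
  have inj: "inj_on (\<lambda>u. {u, v}) Q" by (auto simp: inj_on_def doubleton_eq_iff)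
  have l0: "?l e = edge_length (x a) e" if e: "e \<in> S0" for e
  proof -
    from e obtain u w where "u \<in> P" "w \<in> P" "e = {u, w}" by (auto simp: S0_def vertex_pairs_def)
    then show ?thesis using v by (auto simp: edge_length_doubleton x_def)
  qed
  have lsq: "(edge_length (x a') {u, w})\<^sup>2 = (a' u - a' w)\<^sup>2 + (b u - b w)\<^sup>2" for a' u w
    by (simp add: edge_length_doubleton x_def cmod_power2)
  define c where "c = (\<Prod>e\<in>S0. edge_length (x a) e)\<^sup>2"
  have "(edge_length (x a) e)\<^sup>2 \<in> K" if e: "e \<in> S0" for e
  proof -
    from e obtain u w where "u \<in> P" "w \<in> P" "e = {u, w}" by (auto simp: S0_def vertex_pairs_def)
    moreover from this have "a u \<in> K" "a w \<in> K" "b u \<in> K" "b w \<in> K" using a b by auto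
    ultimately show ?thesis using lsq[of a u w] real_subfield_closed[OF K] by simp
  qed
  then have cK: "c \<in> K"
    unfolding c_def prod_power_distrib by (intro real_subfield_prod[OF K])
  have "edge_length (x a) e \<noteq> 0" if e: "e \<in> S0" for e
  proof -
    from e obtain u w where "u \<noteq> w" "e = {u, w}" by (auto simp: S0_def vertex_pairs_def)
    then show ?thesis using b(1) by (auto simp: edge_length_doubleton x_def complex_eq_iff dest: injD)
  qed
  then have c0: "c \<noteq> 0" by (simp add: c_def)
  let ?q = "\<Prod>u\<in>Q. norm_poly (a u) (b u - b v)"
  have "prod ?l S = prod ?l S0 * prod ?l ((\<lambda>u. {u, v}) ` Q)"
    unfolding Seq using disj by (intro prod.union_disjoint) auto
  also have "prod ?l S0 = prod (edge_length (x a)) S0" using l0 by (intro prod.cong) auto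
  also have "prod ?l ((\<lambda>u. {u, v}) ` Q) = (\<Prod>u\<in>Q. ?l {u, v})" using inj by (simp add: prod.reindex)
  finally have "prod ?l S = prod (edge_length (x a)) S0 * (\<Prod>u\<in>Q. ?l {u, v})" .
  then have "(prod ?l S)\<^sup>2 = c * (\<Prod>u\<in>Q. (?l {u, v})\<^sup>2)"
    by (simp only: c_def power_mult_distrib prod_power_distrib)
  also have "(\<Prod>u\<in>Q. (?l {u, v})\<^sup>2) = (\<Prod>u\<in>Q. (t - a u)\<^sup>2 + (b u - b v)\<^sup>2)"
    unfolding lsq using v by (intro prod.cong) (auto simp: Q_def power2_commute)
  finally have E: "(prod ?l S)\<^sup>2 = c * (\<Prod>u\<in>Q. (t - a u)\<^sup>2 + (b u - b v)\<^sup>2)" .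
  have "(complex_of_real (prod ?l S))\<^sup>2 = complex_of_real ((prod ?l S)\<^sup>2)" by (rule of_real_power[symmetric])
  also have "\<dots> = complex_of_real c * poly ?q (complex_of_real t)"
    unfolding E by (simp add: poly_prod poly_norm_poly)
  finally have sq: "(complex_of_real (prod ?l S))\<^sup>2 = complex_of_real c * poly ?q (complex_of_real t)" .
  define h where "h = g ^ 2 * ([:complex_of_real c:] * ?q) - f ^ 2"
  have "b u \<in> K" for u using b(2) by auto
  then have "coeffs_in K ?q"
    using a(1) real_subfield_closed(4)[OF K]
    by (intro coeffs_in_prod[OF K] coeffs_in_norm_poly[OF K]) (auto simp: Q_def)
  then have "coeffs_in K h"
    unfolding h_def power2_eq_square by (intro coeffs_in_closed[OF K] fg cK)
  moreover have "poly h (complex_of_real t) = 0"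
  proof -
    define Z where "Z = complex_of_real (prod ?l S)"
    have "poly f (complex_of_real t) = Z * poly g (complex_of_real t)"
      using fg(3) fg(4)[folded Z_def] by simp
    then show ?thesis
      using sq[folded Z_def] by (simp add: h_def power_mult_distrib)
  qed
  ultimately have "h = 0" using t by (simp add: transcendental_over_def)
  then have eq: "g ^ 2 * ([:complex_of_real c:] * ?q) = f ^ 2" by (simp add: h_def)
  have g0: "g \<noteq> 0" using fg(3) by auto
  show False
  proof (cases "Q = {}")
    case True
    then obtain y where y: "y \<in> K" "c = y\<^sup>2"
      using leading_coeff_square_quotient[OF K fg(1,2) g0, of c] eq by auto
    then have "prod (edge_length (x a)) S0 = y \<or> prod (edge_length (x a)) S0 = - y"
      by (simp add: c_def power2_eq_iff)
    then have "prod (edge_length (x a)) S0 \<in> K" using y real_subfield_closed(8)[OF K] by auto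
    moreover have "S0 \<subseteq> vertex_pairs P" "S0 \<noteq> {}" using True Seq S(2) by (auto simp: S0_def)
    ultimately show False using pr by blast
  next
    case False
    have "inj_on a Q" using a(2) by (rule inj_on_subset) (auto simp: Q_def)
    moreover have "b u - b v \<noteq> 0" if "u \<in> Q" for u using that v b(1) by (auto simp: Q_def dest: injD)
    ultimately show False
      using prod_norm_poly_not_square[of Q a "\<lambda>u. b u - b v" g "complex_of_real c" f] False g0 c0 eq
      by auto
  qed
qed

text \<open>The imaginary parts \<open>b\<close> are fixed in advance inside \<open>K0\<close> and
  only real parts are chosen, each transcendental over the field of the earlier ones. Distinct
  imaginary parts make the roots of the factors non-real, distinct real parts keep the factors
  without common roots, and countability keeps transcendental choices available in every
  interval.\<close>

lemma generic_real_parts: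
  fixes b lo hi :: "'v::finite \<Rightarrow> real" and P :: "'v set"
  assumes K0: "real_subfield K0" "countable K0" and b: "inj b" "range b \<subseteq> K0" and lh: "\<And>u. lo u < hi u"
  shows "\<exists>a K. real_subfield K \<and> countable K \<and> K0 \<subseteq> K \<and> (\<forall>u\<in>P. lo u < a u \<and> a u < hi u) \<and>
    a ` P \<subseteq> K \<and> inj_on a P \<and>
    (\<forall>S. S \<subseteq> vertex_pairs P \<longrightarrow> S \<noteq> {} \<longrightarrow>
      prod (edge_length (\<chi> v. Complex (a v) (b v))) S \<notin> K)"
  using finite[of P]
proof (induction P rule: finite_induct)
  case empty
  then show ?case using K0 by (intro exI[of _ b] exI[of _ K0]) (auto simp: vertex_pairs_def)
next
  case (insert v P)
  from insert.IH obtain a K where K: "real_subfield K" "countable K" "K0 \<subseteq> K"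
    and a: "\<forall>u\<in>P. lo u < a u \<and> a u < hi u" "a ` P \<subseteq> K" "inj_on a P"
    and pr0: "\<forall>S. S \<subseteq> vertex_pairs P \<longrightarrow> S \<noteq> {} \<longrightarrow>
      prod (edge_length (\<chi> v. Complex (a v) (b v))) S \<notin> K"
    by (elim exE conjE)
  have pr: "prod (edge_length (\<chi> v. Complex (a v) (b v))) S \<notin> K"
    if "S \<subseteq> vertex_pairs P" "S \<noteq> {}" for S
    using pr0[rule_format, OF that] .
  obtain t where t: "lo v < t" "t < hi v" "transcendental_over K t"
    using transcendental_over_exists[OF K(2) lh] by blast
  have "t \<notin> K"
  proof
    assume "t \<in> K"
    then have "coeffs_in K ([:0, 1:] - [:complex_of_real t:])"
      by (intro coeffs_in_closed[OF K(1)])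
    moreover have "poly ([:0, 1:] - [:complex_of_real t:]) (complex_of_real t) = 0" by simp
    ultimately have "[:0, 1:] - [:complex_of_real t:] = 0"
      using t(3) unfolding transcendental_over_def by blast
    then show False by simp
  qed
  have bK: "range b \<subseteq> K" using b(2) K(3) by blast
  note notin = prod_edge_length_insert_notin[OF K(1) b(1) bK a(2,3) pr insert.hyps(2) t(3)]
  have "a(v := t) ` insert v P \<subseteq> adjoin K t"
    using a(2) real_subfield_adjoin[OF K(1), of t] by auto
  moreover have "inj_on (a(v := t)) (insert v P)"
    using a(2,3) \<open>t \<notin> K\<close> insert.hyps(2) by (auto simp: inj_on_def)
  moreover have "K0 \<subseteq> adjoin K t" using K(3) real_subfield_adjoin[OF K(1), of t] by auto
  moreover have "\<forall>u\<in>insert v P. lo u < (a(v := t)) u \<and> (a(v := t)) u < hi u"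
    using a(1) t insert.hyps(2) by auto
  moreover have "\<forall>S. S \<subseteq> vertex_pairs (insert v P) \<longrightarrow> S \<noteq> {} \<longrightarrow>
      prod (edge_length (\<chi> w. Complex ((a(v := t)) w) (b w))) S \<notin> adjoin K t"
    by (intro allI impI notin)
  ultimately show ?case
    using real_subfield_adjoin(1)[OF K(1), of t] countable_adjoin[OF K(2), of t]
    by (intro exI[of _ "a(v := t)"] exI[of _ "adjoin K t"] conjI)
qed

lemma inj_choice_infinite:
  fixes I :: "'v::finite \<Rightarrow> 'a set"
  assumes "\<And>v. infinite (I v)"
  shows "\<exists>b. inj b \<and> (\<forall>v. b v \<in> I v)"
proof -
  have "\<exists>b. inj_on b P \<and> (\<forall>v\<in>P. b v \<in> I v)" if "finite P" for P
    using that
  proof (induction P rule: finite_induct)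
    case (insert v P)
    then obtain b where b: "inj_on b P" "\<forall>v\<in>P. b v \<in> I v" by blast
    have "infinite (I v - b ` P)" using assms[of v] insert.hyps(1) by simp
    then have "I v - b ` P \<noteq> {}" by (metis finite.emptyI)
    then obtain y where "y \<in> I v - b ` P" by blast
    then show ?case
      using b insert.hyps by (intro exI[of _ "b(v := y)"]) (auto simp: inj_on_def)
  qed simp
  from this[of UNIV] show ?thesis by simp
qed

lemma generic_points_exist:
  fixes X :: "(complex ^ 'v::finite) set"
  assumes "open X" "X \<noteq> {}"
  obtains x K where "x \<in> X" "real_subfield K" "entries_in K x"
    "\<And>S. S \<subseteq> vertex_pairs UNIV \<Longrightarrow> S \<noteq> {} \<Longrightarrow> prod (edge_length x) S \<notin> K"
proof -
  obtain x0 where "x0 \<in> X" using assms(2) by blast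
  then obtain \<epsilon> where \<epsilon>: "\<epsilon> > 0" "ball x0 \<epsilon> \<subseteq> X" using assms(1) by (meson open_contains_ball)
  \<comment> \<open>Moving each of the two coordinates of each point by less than \<delta> changes
    the placement by at most 2 \<delta> per vertex, that is by at most \<epsilon> / 2 in
    total.\<close>
  define \<delta> where "\<delta> = \<epsilon> / (4 * real CARD('v))"
  have \<delta>: "\<delta> > 0" using \<epsilon> by (simp add: \<delta>_def)
  obtain b :: "'v \<Rightarrow> real" where b: "inj b" "\<And>v. b v \<in> {Im (x0 $ v) - \<delta><..<Im (x0 $ v) + \<delta>}"
    using inj_choice_infinite[of "\<lambda>v. {Im (x0 $ v) - \<delta><..<Im (x0 $ v) + \<delta>}"] \<delta>
    by (auto simp: infinite_Ioo)
  obtain K0 where K0: "real_subfield K0" "countable K0" "range b \<subseteq> K0"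
    using countable_real_subfield_containing[of "range b"] by auto
  have "\<And>u. Re (x0 $ u) - \<delta> < Re (x0 $ u) + \<delta>" using \<delta> by simp
  from generic_real_parts[where lo = "\<lambda>u. Re (x0 $ u) - \<delta>" and hi = "\<lambda>u. Re (x0 $ u) + \<delta>",
      OF K0(1,2) b(1) K0(3) this, of UNIV]
  obtain a K where K: "real_subfield K" "countable K" "K0 \<subseteq> K"
    and a: "\<forall>u\<in>UNIV. Re (x0 $ u) - \<delta> < a u \<and> a u < Re (x0 $ u) + \<delta>"
    and aK: "a ` UNIV \<subseteq> K" and "inj_on a UNIV"
    and pr: "\<forall>S. S \<subseteq> vertex_pairs UNIV \<longrightarrow> S \<noteq> {} \<longrightarrow>
      prod (edge_length (\<chi> v. Complex (a v) (b v))) S \<notin> K"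
    by (elim exE conjE)
  define x where "x = (\<chi> v. Complex (a v) (b v))"
  have "norm (x - x0) \<le> (\<Sum>v\<in>UNIV. norm ((x - x0) $ v))"
    by (simp add: norm_le_l1_cart norm_vec_def L2_set_le_sum)
  also have "\<dots> \<le> (\<Sum>v\<in>(UNIV :: 'v set). 2 * \<delta>)"
  proof (rule sum_mono)
    fix v :: 'v
    have "norm ((x - x0) $ v) \<le> \<bar>a v - Re (x0 $ v)\<bar> + \<bar>b v - Im (x0 $ v)\<bar>"
      using cmod_le[of "(x - x0) $ v"] by (simp add: x_def)
    moreover have "\<bar>a v - Re (x0 $ v)\<bar> < \<delta>" "\<bar>b v - Im (x0 $ v)\<bar> < \<delta>"
      using a[THEN bspec, of v] b(2)[of v] by (auto simp: abs_diff_less_iff)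
    ultimately show "norm ((x - x0) $ v) \<le> 2 * \<delta>" by linarith
  qed
  also have "\<dots> < \<epsilon>" using \<epsilon>(1) by (simp add: \<delta>_def)
  finally have "x \<in> X" using \<epsilon>(2) by (auto simp: dist_norm norm_minus_commute)
  moreover have "entries_in K x"
    using K(3) K0(3) aK by (auto simp: entries_in_def Basis_vec_def Basis_complex_def inner_axis x_def)
  ultimately show ?thesis using that K(1) pr unfolding x_def by blast
qed

section \<open>Generic placements in the plane\<close>

text \<open>Rows of the planar rigidity matrix for half the squared lengths. Unlike rows of unit
  directions they are linear in the placement, so determinants built from them are polynomial along
  lines.\<close>

definition drow :: "complex ^ 'v::finite \<Rightarrow> 'v set \<Rightarrow> complex ^ 'v" where
  "drow x = erow (\<lambda>v w. x $ v - x $ w)"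

lemma drow_nth:
  "v \<noteq> w \<Longrightarrow> drow x {v, w} $ y = (if y = v then x $ v - x $ w else if y = w then x $ w - x $ v else 0)"
  unfolding drow_def by (rule erow_nth)

lemma linear_drow: "linear (\<lambda>x. drow x e)"
  by (rule linearI)
    (simp_all add: drow_def erow_def vec_eq_iff sum.distrib scaleR_sum_right algebra_simps
      flip: sum_subtractf sum.distrib)

text \<open>A stand-in for nonempty Zariski-open sets that needs only polynomials in one variable.\<close>

definition generic_on_lines :: "('a::real_vector \<Rightarrow> bool) \<Rightarrow> bool" where
  "generic_on_lines P \<longleftrightarrow> (\<exists>y. P y) \<and> (\<forall>x y. P y \<longrightarrow> finite {t::real. \<not> P (x + t *\<^sub>R (y - x))})"

lemma generic_on_linesI:
  assumes "P y" "\<And>x y. P y \<Longrightarrow> finite {t::real. \<not> P (x + t *\<^sub>R (y - x))}"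
  shows "generic_on_lines P"
  using assms unfolding generic_on_lines_def by blast

lemma generic_on_lines_conj:
  assumes P: "generic_on_lines P" and Q: "generic_on_lines Q"
  shows "generic_on_lines (\<lambda>x. P x \<and> Q x)"
proof -
  obtain y z where yz: "P y" "Q z" using assms by (auto simp: generic_on_lines_def)
  \<comment> \<open>The definition controls lines that end at a good point. The line through
    \<open>y\<close> and \<open>z\<close> ends at \<open>z\<close> for \<open>Q\<close> and,
    traversed backwards, at \<open>y\<close> for \<open>P\<close>; the substitution 1 - s brings
    both exceptional sets to one parameter.\<close>
  let ?A = "{t::real. \<not> Q (y + t *\<^sub>R (z - y))}" and ?B = "{s::real. \<not> P (z + s *\<^sub>R (y - z))}"
  have "finite ?A" "finite ?B" using P Q yz by (auto simp: generic_on_lines_def)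
  then have "finite (?A \<union> (\<lambda>s. 1 - s) ` ?B)" by simp
  then obtain t where t: "t \<notin> ?A \<union> (\<lambda>s. 1 - s) ` ?B"
    using ex_new_if_finite[OF infinite_UNIV_char_0] by blast
  then have "1 - t \<notin> ?B" by (auto intro: image_eqI[of _ _ "1 - t"])
  moreover have "z + (1 - t) *\<^sub>R (y - z) = y + t *\<^sub>R (z - y)" by (simp add: algebra_simps)
  ultimately have "P (y + t *\<^sub>R (z - y)) \<and> Q (y + t *\<^sub>R (z - y))" using t by auto
  moreover have "finite {t. \<not> (P (x + t *\<^sub>R (y - x)) \<and> Q (x + t *\<^sub>R (y - x)))}" if "P y \<and> Q y" for x y
  proof -
    have "{t. \<not> (P (x + t *\<^sub>R (y - x)) \<and> Q (x + t *\<^sub>R (y - x)))} =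
        {t. \<not> P (x + t *\<^sub>R (y - x))} \<union> {t. \<not> Q (x + t *\<^sub>R (y - x))}" by auto
    then show ?thesis using P Q that by (simp add: generic_on_lines_def)
  qed
  ultimately show ?thesis by (intro generic_on_linesI)
qed

text \<open>A line from a point of \<open>X\<close> to a good point stays in \<open>X\<close> for a
  whole interval of parameters, and only finitely many parameters are bad.\<close>

lemma generic_on_lines_dense:
  fixes P :: "'a::real_normed_vector \<Rightarrow> bool"
  assumes "generic_on_lines P" "open X" "X \<noteq> {}"
  shows "\<exists>x\<in>X. P x"
proof -
  obtain x y where xy: "x \<in> X" "P y" using assms by (auto simp: generic_on_lines_def)
  let ?f = "\<lambda>t::real. x + t *\<^sub>R (y - x)"
  have "open (?f -` X)"
    using assms(2) by (intro open_vimage continuous_intros) auto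
  moreover have "0 \<in> ?f -` X" using xy by simp
  ultimately obtain d where "d > 0" "ball 0 d \<subseteq> ?f -` X" using open_contains_ball by blast
  moreover from this have "{0<..<d} \<subseteq> ball 0 d" by (auto simp: dist_real_def)
  ultimately have inf: "infinite (?f -` X)" using infinite_Ioo[of 0 d] infinite_super by blast
  have "finite {t. \<not> P (?f t)}" using assms(1) xy by (simp add: generic_on_lines_def)
  from finite_subset[of "?f -` X", OF _ this] inf have "\<not> ?f -` X \<subseteq> {t. \<not> P (?f t)}" by (rule contrapos_nn[rotated])
  then show ?thesis by auto
qed

section \<open>Conditions on placements that are generic on lines\<close>

lemma finite_poly_nonroots:
  fixes p :: "real poly"
  assumes "poly p 1 \<noteq> 0" "\<And>t. \<not> Q t \<Longrightarrow> poly p t = 0"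
  shows "finite {t. \<not> Q t}"
proof (rule finite_subset)
  show "{t. \<not> Q t} \<subseteq> {t. poly p t = 0}" using assms(2) by auto
  show "finite {t. poly p t = 0}" using assms(1) by (intro poly_roots_finite) auto
qed

text \<open>Up to sign, the imaginary part is twice the area of the triangle abc.\<close>

definition noncollinear :: "complex \<Rightarrow> complex \<Rightarrow> complex \<Rightarrow> bool" where
  "noncollinear a b c \<longleftrightarrow> Im ((b - a) * cnj (c - a)) \<noteq> 0"

lemma generic_noncollinear:
  fixes a b c :: "'v::finite"
  assumes "a \<noteq> b" "a \<noteq> c" "b \<noteq> c"
  shows "generic_on_lines (\<lambda>x. noncollinear (x $ a) (x $ b) (x $ c))"
proof (rule generic_on_linesI)
  let ?y = "(\<chi> v. if v = a then 0 else if v = b then 1 else \<i>) :: complex ^ 'v"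
  show "noncollinear (?y $ a) (?y $ b) (?y $ c)"
    using assms by (auto simp: noncollinear_def)
  fix x y :: "complex ^ 'v" assume y: "noncollinear (y $ a) (y $ b) (y $ c)"
  let ?z = "\<lambda>t. x + t *\<^sub>R (y - x)"
  define \<alpha> \<beta> \<gamma> \<delta> where "\<alpha> = x $ b - x $ a" "\<beta> = (y - x) $ b - (y - x) $ a"
    "\<gamma> = x $ c - x $ a" "\<delta> = (y - x) $ c - (y - x) $ a"
  define p where "p = [:Im (\<alpha> * cnj \<gamma>), Im (\<alpha> * cnj \<delta>) + Im (\<beta> * cnj \<gamma>), Im (\<beta> * cnj \<delta>):]"
  have p: "poly p t = Im ((?z t $ b - ?z t $ a) * cnj (?z t $ c - ?z t $ a))" for t
  proof -
    have "?z t $ b - ?z t $ a = \<alpha> + t *\<^sub>R \<beta>" "?z t $ c - ?z t $ a = \<gamma> + t *\<^sub>R \<delta>"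
      by (simp_all add: \<alpha>_\<beta>_\<gamma>_\<delta>_def algebra_simps)
    then show ?thesis by (simp only:) (simp add: p_def algebra_simps)
  qed
  show "finite {t. \<not> noncollinear (?z t $ a) (?z t $ b) (?z t $ c)}"
  proof (rule finite_poly_nonroots)
    show "poly p 1 \<noteq> 0" using y unfolding p by (simp add: noncollinear_def)
    show "poly p t = 0" if "\<not> noncollinear (?z t $ a) (?z t $ b) (?z t $ c)" for t
      using that unfolding p noncollinear_def by blast
  qed
qed

lemma generic_distinct:
  fixes a b :: "'v::finite"
  assumes "a \<noteq> b"
  shows "generic_on_lines (\<lambda>x :: complex ^ 'v. x $ a \<noteq> x $ b)"
proof (rule generic_on_linesI)
  let ?y = "(\<chi> v. if v = a then 0 else 1) :: complex ^ 'v"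
  show "?y $ a \<noteq> ?y $ b"
    using assms by simp
  fix x y :: "complex ^ 'v" assume y: "y $ a \<noteq> y $ b"
  let ?z = "\<lambda>t. x + t *\<^sub>R (y - x)"
  define \<alpha> \<beta> where "\<alpha> = x $ b - x $ a" "\<beta> = (y - x) $ b - (y - x) $ a"
  define p where "p = [:\<alpha> \<bullet> \<alpha>, 2 * (\<alpha> \<bullet> \<beta>), \<beta> \<bullet> \<beta>:]"
  have p: "poly p t = (?z t $ b - ?z t $ a) \<bullet> (?z t $ b - ?z t $ a)" for t
  proof -
    have "?z t $ b - ?z t $ a = \<alpha> + t *\<^sub>R \<beta>"
      by (simp add: \<alpha>_\<beta>_def algebra_simps)
    then show ?thesis
      by (simp only:) (simp add: p_def inner_add_left inner_add_right inner_commute algebra_simps)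
  qed
  show "finite {t. \<not> ?z t $ a \<noteq> ?z t $ b}"
  proof (rule finite_poly_nonroots)
    show "poly p 1 \<noteq> 0" using y unfolding p by simp
    show "poly p t = 0" if "\<not> ?z t $ a \<noteq> ?z t $ b" for t using that unfolding p by simp
  qed
qed

lemma poly_det:
  fixes Q :: "real poly ^ 'n::finite ^ 'n"
  shows "poly (det Q) t = det (\<chi> i j. poly (Q $ i $ j) t)"
  by (simp add: det_def poly_sum poly_prod)

text \<open>Pairing the rows with the dual basis at one independent placement gives a determinant whose
  nonvanishing certifies independence elsewhere.\<close>

lemma drow_indep_certificate:
  fixes H :: "'v::finite set set"
  assumes "indep_family H (drow y)"
  obtains M :: "complex ^ 'v \<Rightarrow> real ^ ('v set) ^ ('v set)" where
    "det (M y) \<noteq> 0" "\<And>z. det (M z) \<noteq> 0 \<Longrightarrow> indep_family H (drow z)"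
    "continuous_on UNIV (\<lambda>z. det (M z))"
    "\<And>x y. \<exists>p. \<forall>t. poly p t = det (M (x + t *\<^sub>R (y - x)))"
proof -
  obtain d where d: "\<And>i j. i \<in> H \<Longrightarrow> j \<in> H \<Longrightarrow> d i \<bullet> drow y j = (if i = j then 1 else 0)"
    using indep_family_dual[OF assms finite] by metis
  \<comment> \<open>Padding by the identity outside \<open>H\<close>, since the matrices are indexed
    by all subsets of the vertex type.\<close>
  define m where "m z e f = (if e \<in> H \<and> f \<in> H then d e \<bullet> drow z f else if e = f then 1 else 0)"
    for z :: "complex ^ 'v" and e f
  define M where "M z = (\<chi> e f. m z e f)" for z
  show ?thesis
  proof (rule that[of M])
    have "M y = mat 1" using d by (auto simp: M_def m_def mat_def vec_eq_iff)
    then show "det (M y) \<noteq> 0" by simp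
  next
    fix z assume nz: "det (M z) \<noteq> 0"
    show "indep_family H (drow z)"
    proof (rule indep_familyI)
      fix c e assume s: "(\<Sum>e\<in>H. c e *\<^sub>R drow z e) = 0" and e: "e \<in> H"
      define C :: "real ^ 'v set" where "C = (\<chi> f. if f \<in> H then c f else 0)"
      have "(M z *v C) $ e = 0" for e
      proof (cases "e \<in> H")
        case True
        have "(M z *v C) $ e = (\<Sum>f\<in>UNIV. m z e f * C $ f)"
          by (simp add: matrix_vector_mult_def M_def)
        also have "\<dots> = (\<Sum>f\<in>H. c f * (d e \<bullet> drow z f))"
          using True by (intro sum.mono_neutral_cong_right) (auto simp: C_def m_def)
        also have "\<dots> = d e \<bullet> (\<Sum>e\<in>H. c e *\<^sub>R drow z e)" by (simp add: inner_sum_right)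
        finally show ?thesis using s by simp
      next
        case False
        then show ?thesis
          by (auto simp: matrix_vector_mult_def M_def m_def C_def intro!: sum.neutral)
      qed
      then have "M z *v C = 0" by (simp add: vec_eq_iff)
      moreover have "invertible (M z)" using nz by (simp add: invertible_det_nz)
      ultimately have "C = 0" using matrix_left_invertible_ker[of "M z"]
        by (auto simp: invertible_def)
      then show "c e = 0" using e by (auto simp: C_def vec_eq_iff dest: spec[of _ e])
    qed
  next
    have "continuous_on UNIV (\<lambda>z. m z e f)" for e f
      unfolding m_def using linear_continuous_on[OF linear_conv_bounded_linear[THEN iffD1, OF linear_drow]]
      by (cases "e \<in> H \<and> f \<in> H") (auto intro!: continuous_intros)
    then show "continuous_on UNIV (\<lambda>z. det (M z))"
      unfolding det_def M_def by (auto intro!: continuous_intros)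
  next
    fix x y :: "complex ^ 'v"
    define Q :: "real poly ^ 'v set ^ 'v set" where
      "Q = (\<chi> e f. if e \<in> H \<and> f \<in> H then [:d e \<bullet> drow x f, d e \<bullet> drow (y - x) f:] else if e = f then 1 else 0)"
    have dl: "drow (x + t *\<^sub>R (y - x)) f = drow x f + t *\<^sub>R drow (y - x) f" for t f
      using linear_add[OF linear_drow[of f]] linear_scale[OF linear_drow[of f]] by simp
    have "M (x + t *\<^sub>R (y - x)) = (\<chi> i j. poly (Q $ i $ j) t)" for t
      by (auto simp: M_def m_def Q_def vec_eq_iff dl inner_add_right)
    then show "\<exists>p. \<forall>t. poly p t = det (M (x + t *\<^sub>R (y - x)))"
      by (intro exI[of _ "det Q"]) (simp add: poly_det)
  qed
qed

lemma generic_drow_indep: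
  fixes H :: "'v::finite set set"
  assumes "indep_family H (drow y)"
  shows "generic_on_lines (\<lambda>x. indep_family H (drow x))"
proof (rule generic_on_linesI)
  show "indep_family H (drow y)" by fact
  fix x y :: "complex ^ 'v" assume "indep_family H (drow y)"
  then obtain M :: "complex ^ 'v \<Rightarrow> real ^ ('v set) ^ ('v set)" where M:
    "det (M y) \<noteq> 0" "\<And>z. det (M z) \<noteq> 0 \<Longrightarrow> indep_family H (drow z)"
    "\<exists>p. \<forall>t. poly p t = det (M (x + t *\<^sub>R (y - x)))"
    by (rule drow_indep_certificate) blast
  then obtain p where "\<forall>t. poly p t = det (M (x + t *\<^sub>R (y - x)))" by blast
  then show "finite {t. \<not> indep_family H (drow (x + t *\<^sub>R (y - x)))}"
    using M(1,2) by (intro finite_poly_nonroots[of p]) auto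
qed

lemma open_drow_indep:
  fixes H :: "'v::finite set set"
  shows "open {x. indep_family H (drow x)}"
proof (subst open_subopen, safe)
  fix y :: "complex ^ 'v" assume "indep_family H (drow y)"
  then obtain M :: "complex ^ 'v \<Rightarrow> real ^ ('v set) ^ ('v set)" where M:
    "det (M y) \<noteq> 0" "\<And>z. det (M z) \<noteq> 0 \<Longrightarrow> indep_family H (drow z)"
    "continuous_on UNIV (\<lambda>z. det (M z))"
    by (rule drow_indep_certificate) blast
  have "open {z. det (M z) \<noteq> 0}"
    by (intro open_Collect_neq M(3) continuous_on_const)
  then show "\<exists>T. open T \<and> y \<in> T \<and> T \<subseteq> {x. indep_family H (drow x)}"
    using M(1,2) by (intro exI[of _ "{z. det (M z) \<noteq> 0}"]) auto
qed

section \<open>The Henneberg induction\<close>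

definition induced_count :: "'v set set \<Rightarrow> 'v set \<Rightarrow> nat" where
  "induced_count H Y = card {e \<in> H. e \<subseteq> Y}"

text \<open>Testing induced subgraphs suffices, since they have the most edges on their vertex set.
  The 3 stands on the left to avoid truncated subtraction.\<close>

definition sparse_count :: "'v::finite set set \<Rightarrow> bool" where
  "sparse_count H \<longleftrightarrow> (\<forall>Y. 2 \<le> card Y \<longrightarrow> induced_count H Y + 3 \<le> 2 * card Y)"

lemma sparse_count_if_sparse:
  assumes sg: "simple_graph UNIV H" and sp: "sparse_2_3 (UNIV :: 'v::finite set) H"
  shows "sparse_count H"
  unfolding sparse_count_def
proof (intro allI impI)
  fix Y :: "'v set" assume Y: "2 \<le> card Y"
  show "induced_count H Y + 3 \<le> 2 * card Y"
  proof (cases "{e \<in> H. e \<subseteq> Y} = {}")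
    case False
    have "subgraph Y {e \<in> H. e \<subseteq> Y} UNIV H"
      using sg unfolding subgraph_def simple_graph_def by fastforce
    then have "int (card {e \<in> H. e \<subseteq> Y}) \<le> 2 * int (card Y) - 3"
      using sp False unfolding sparse_2_3_def by blast
    then show ?thesis unfolding induced_count_def by linarith
  next
    case True
    then have "induced_count H Y = 0" by (simp only: induced_count_def card.empty)
    then show ?thesis using Y by simp
  qed
qed

lemma induced_count_mono: "H \<subseteq> H' \<Longrightarrow> induced_count H Y \<le> induced_count (H' :: 'v::finite set set) Y"
  unfolding induced_count_def by (intro card_mono) auto

lemma sparse_count_subset: "sparse_count H \<Longrightarrow> H' \<subseteq> H \<Longrightarrow> sparse_count H'"
  unfolding sparse_count_def by (meson add_le_mono1 induced_count_mono le_trans)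

lemma induced_count_supermodular:
  fixes H :: "'v::finite set set"
  shows "induced_count H Y + induced_count H Z \<le> induced_count H (Y \<union> Z) + induced_count H (Y \<inter> Z)"
proof -
  let ?A = "{e \<in> H. e \<subseteq> Y}" and ?B = "{e \<in> H. e \<subseteq> Z}"
  have "card ?A + card ?B = card (?A \<union> ?B) + card (?A \<inter> ?B)" by (rule card_Un_Int) auto
  also have "?A \<inter> ?B = {e \<in> H. e \<subseteq> Y \<inter> Z}" by auto
  also have "card (?A \<union> ?B) \<le> card {e \<in> H. e \<subseteq> Y \<union> Z}" by (intro card_mono) auto
  finally show ?thesis by (simp add: induced_count_def)
qed

lemma handshake:
  fixes H :: "'v::finite set set"
  assumes "simple_graph UNIV H"
  shows "(\<Sum>v\<in>UNIV. card {e \<in> H. v \<in> e}) = 2 * card H"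
proof -
  have two: "card e = 2" if "e \<in> H" for e
    using simple_graph_edgeE[OF assms that] by (metis card_2_iff)
  have "(\<Sum>v\<in>UNIV. card {e \<in> H. v \<in> e}) = (\<Sum>v\<in>UNIV. \<Sum>e\<in>H. if v \<in> e then 1 else 0)"
    by (simp add: sum.If_cases Int_def)
  also have "\<dots> = (\<Sum>e\<in>H. \<Sum>v\<in>UNIV. if v \<in> e then 1 else 0)" by (rule sum.swap)
  also have "\<dots> = (\<Sum>e\<in>H. 2)" using two by (intro sum.cong) (simp_all add: sum.If_cases)
  finally show ?thesis by simp
qed

text \<open>The degrees of the non-isolated vertices add up to twice the number of edges, at most
  \<open>4 * card (\<Union>H) - 6\<close>, so their average is below 4.\<close>

lemma sparse_count_low_degree:
  fixes H :: "'v::finite set set"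
  assumes sg: "simple_graph UNIV H" and sp: "sparse_count H" and "H \<noteq> {}"
  obtains v where "v \<in> \<Union>H" "card {e \<in> H. v \<in> e} \<le> 3"
proof (rule ccontr)
  assume contra: "\<not> thesis"
  let ?X = "\<Union>H"
  have ge: "4 \<le> card {e \<in> H. v \<in> e}" if "v \<in> ?X" for v
    using contra that \<open>\<And>v. v \<in> \<Union>H \<Longrightarrow> card {e \<in> H. v \<in> e} \<le> 3 \<Longrightarrow> thesis\<close> by force
  obtain e where "e \<in> H" using \<open>H \<noteq> {}\<close> by blast
  then obtain a b where "a \<noteq> b" "e = {a, b}" using simple_graph_edgeE[OF sg] by metis
  then have "{a, b} \<subseteq> ?X" "card {a, b} = 2" using \<open>e \<in> H\<close> by auto
  then have "2 \<le> card ?X" by (metis card_mono finite)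
  then have "induced_count H ?X + 3 \<le> 2 * card ?X" using sp by (simp add: sparse_count_def)
  moreover have "{e \<in> H. e \<subseteq> ?X} = H" by auto
  then have "induced_count H ?X = card H" by (simp add: induced_count_def)
  moreover have "4 * card ?X \<le> (\<Sum>v\<in>?X. card {e \<in> H. v \<in> e})"
    using sum_mono[of ?X "\<lambda>_. 4" "\<lambda>v. card {e \<in> H. v \<in> e}"] ge by simp
  moreover have "(\<Sum>v\<in>?X. card {e \<in> H. v \<in> e}) \<le> (\<Sum>v\<in>UNIV. card {e \<in> H. v \<in> e})"
    by (intro sum_mono2) auto
  ultimately show False using handshake[OF sg] by linarith
qed

lemma induced_count_remove_vertex:
  "(\<And>e. e \<in> H \<Longrightarrow> v \<notin> e) \<Longrightarrow> induced_count H (Y - {v}) = induced_count H Y"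
  unfolding induced_count_def by (intro arg_cong[of _ _ card]) auto

text \<open>The obstruction to adding ab after deleting v is a set Y that already attains the bound
  for \<open>H\<close>, contains a and b, and avoids v. If ab is an edge, Y = {a, b} serves.
  Otherwise take a set violating the bound in the new graph and remove v, which carries no edge
  there.\<close>

lemma blocked_pair:
  fixes H :: "'v::finite set set"
  assumes sp: "sparse_count H" and ab: "a \<noteq> b" "a \<noteq> v" "b \<noteq> v"
    and block: "{a, b} \<in> H \<or> \<not> sparse_count (insert {a, b} {e \<in> H. v \<notin> e})"
  shows "\<exists>Y. v \<notin> Y \<and> a \<in> Y \<and> b \<in> Y \<and> 2 * card Y \<le> induced_count H Y + 3"
proof (cases "{a, b} \<in> H")
  case True
  then have "card {{a, b}} \<le> induced_count H {a, b}"
    unfolding induced_count_def by (intro card_mono) auto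
  then show ?thesis using ab by (intro exI[of _ "{a, b}"]) auto
next
  case False
  let ?H0 = "{e \<in> H. v \<notin> e}"
  let ?H1 = "insert {a, b} ?H0"
  obtain Y where Y: "2 \<le> card Y" "2 * card Y < induced_count ?H1 Y + 3"
    using block False by (auto simp: sparse_count_def not_le)
  have H0: "induced_count ?H0 Y \<le> induced_count H Y" by (rule induced_count_mono) auto
  have "{a, b} \<subseteq> Y"
  proof (rule ccontr)
    assume "\<not> {a, b} \<subseteq> Y"
    then have "{e \<in> ?H1. e \<subseteq> Y} = {e \<in> ?H0. e \<subseteq> Y}" by auto
    then have "induced_count ?H1 Y = induced_count ?H0 Y" by (simp add: induced_count_def)
    moreover have "induced_count H Y + 3 \<le> 2 * card Y" using sp Y(1) by (simp add: sparse_count_def)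
    ultimately show False using Y(2) H0 by linarith
  qed
  have "{e \<in> ?H1. e \<subseteq> Y} \<subseteq> insert {a, b} {e \<in> ?H0. e \<subseteq> Y}" by auto
  then have "induced_count ?H1 Y \<le> card (insert {a, b} {e \<in> ?H0. e \<subseteq> Y})"
    unfolding induced_count_def by (intro card_mono) auto
  also have "\<dots> \<le> Suc (induced_count ?H0 Y)"
    unfolding induced_count_def by (rule card_insert_le_m1[of "Suc _", simplified]) auto
  also have "induced_count ?H0 Y = induced_count ?H0 (Y - {v})"
    by (rule induced_count_remove_vertex[symmetric]) auto
  also have "\<dots> \<le> induced_count H (Y - {v})" by (rule induced_count_mono) auto
  finally have "induced_count ?H1 Y \<le> Suc (induced_count H (Y - {v}))" by simp
  moreover have "card (Y - {v}) \<le> card Y" by (intro card_mono) auto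
  ultimately have "2 * card (Y - {v}) \<le> induced_count H (Y - {v}) + 3" using Y(2) by linarith
  then show ?thesis using \<open>{a, b} \<subseteq> Y\<close> ab by (intro exI[of _ "Y - {v}"]) auto
qed

text \<open>Suppose each pair is blocked by a set attaining the bound (\<open>bl\<close>). No such
  set contains a, b and c, since adding v and its three edges would break sparsity
  (\<open>A\<close>). If two blocking sets shared two vertices, supermodularity would make their
  union such a set (\<open>B\<close>). So they meet pairwise in single vertices and share no edge;
  their union U has 3 vertices fewer than the three sizes together and at least 2 (|U| + 3) - 9 = 2
  |U| - 3 edges, against \<open>A\<close> again.\<close>

lemma sparse_count_reduce_degree_3:
  fixes H :: "'v::finite set set"
  assumes sg: "simple_graph UNIV H" and sp: "sparse_count H" and v: "{v, a} \<in> H" "{v, b} \<in> H" "{v, c} \<in> H"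
    and dist: "a \<noteq> b" "a \<noteq> c" "b \<noteq> c" "a \<noteq> v" "b \<noteq> v" "c \<noteq> v"
  shows "\<exists>p\<in>{(a, b, c), (b, c, a), (a, c, b)}.
    {fst p, fst (snd p)} \<notin> H \<and> sparse_count (insert {fst p, fst (snd p)} {e \<in> H. v \<notin> e})"
proof (rule ccontr)
  assume contra: "\<not> ?thesis"
  define bl where "bl Y \<longleftrightarrow> v \<notin> Y \<and> 2 * card Y \<le> induced_count H Y + 3" for Y
  obtain Y1 where Y1: "bl Y1" "a \<in> Y1" "b \<in> Y1"
    using blocked_pair[OF sp, of a b v] contra dist unfolding bl_def by auto
  obtain Y2 where Y2: "bl Y2" "b \<in> Y2" "c \<in> Y2"
    using blocked_pair[OF sp, of b c v] contra dist unfolding bl_def by auto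
  obtain Y3 where Y3: "bl Y3" "a \<in> Y3" "c \<in> Y3"
    using blocked_pair[OF sp, of a c v] contra dist unfolding bl_def by auto
  have A: False if Y: "bl Y" "a \<in> Y" "b \<in> Y" "c \<in> Y" for Y
  proof -
    let ?E = "{{v, a}, {v, b}, {v, c}}"
    have vY: "v \<notin> Y" using Y(1) by (simp add: bl_def)
    have "card ({e \<in> H. e \<subseteq> Y} \<union> ?E) \<le> induced_count H (insert v Y)"
      unfolding induced_count_def using v Y by (intro card_mono) auto
    moreover have "card ({e \<in> H. e \<subseteq> Y} \<union> ?E) = induced_count H Y + card ?E"
      unfolding induced_count_def using vY by (intro card_Un_disjoint) auto
    moreover have "card ?E = 3" using dist by (auto simp: doubleton_eq_iff card_insert_if)
    moreover have "card {a, b} \<le> card (insert v Y)" using Y by (intro card_mono) auto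
    then have "induced_count H (insert v Y) + 3 \<le> 2 * card (insert v Y)"
      using sp dist by (simp add: sparse_count_def)
    moreover have "card (insert v Y) = Suc (card Y)" using vY by simp
    ultimately show False using Y(1) unfolding bl_def by linarith
  qed
  have B: "card (Y \<inter> Z) < 2" if YZ: "bl Y" "bl Z" "{a, b, c} \<subseteq> Y \<union> Z" for Y Z
  proof (rule ccontr)
    assume "\<not> card (Y \<inter> Z) < 2"
    then have "induced_count H (Y \<inter> Z) + 3 \<le> 2 * card (Y \<inter> Z)"
      using sp by (simp add: sparse_count_def)
    moreover have "card Y + card Z = card (Y \<union> Z) + card (Y \<inter> Z)" by (rule card_Un_Int) auto
    ultimately have "bl (Y \<union> Z)"
      using YZ(1,2) induced_count_supermodular[of H Y Z] unfolding bl_def by auto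
    then show False using A[of "Y \<union> Z"] YZ(3) by auto
  qed
  have single: "Y \<inter> Z = {y}" if "card (Y \<inter> Z) < 2" "y \<in> Y" "y \<in> Z" for Y Z and y :: 'v
  proof -
    have "card (Y \<inter> Z) \<noteq> 0" using that by auto
    then have "card (Y \<inter> Z) = 1" using that(1) by linarith
    then show ?thesis using that(2,3) by (metis IntI card_1_singletonE singletonD)
  qed
  have s12: "Y1 \<inter> Y2 = {b}" using B[of Y1 Y2] Y1 Y2 by (intro single) auto
  have s13: "Y1 \<inter> Y3 = {a}" using B[of Y1 Y3] Y1 Y3 by (intro single) auto
  have s23: "Y2 \<inter> Y3 = {c}" using B[of Y2 Y3] Y2 Y3 by (intro single) auto
  let ?e = "\<lambda>Y. {e \<in> H. e \<subseteq> Y}"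
  let ?U = "Y1 \<union> Y2 \<union> Y3"
  have disj: "?e Y \<inter> ?e Z = {}" if YZ: "Y \<inter> Z = {y}" for Y Z y
  proof (rule ccontr)
    assume "?e Y \<inter> ?e Z \<noteq> {}"
    then obtain e where e: "e \<in> H" "e \<subseteq> Y \<inter> Z" by blast
    obtain p q where "p \<noteq> q" "e = {p, q}" using simple_graph_edgeE[OF sg e(1)] by metis
    then show False using e(2) YZ by auto
  qed
  have "card (?e Y1 \<union> ?e Y2 \<union> ?e Y3) = card (?e Y1 \<union> ?e Y2) + card (?e Y3)"
    using disj[OF s13] disj[OF s23] by (intro card_Un_disjoint) auto
  also have "card (?e Y1 \<union> ?e Y2) = card (?e Y1) + card (?e Y2)"
    using disj[OF s12] by (intro card_Un_disjoint) auto
  finally have "card (?e Y1 \<union> ?e Y2 \<union> ?e Y3) =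
      induced_count H Y1 + induced_count H Y2 + induced_count H Y3"
    by (simp add: induced_count_def)
  moreover have "card (?e Y1 \<union> ?e Y2 \<union> ?e Y3) \<le> induced_count H ?U"
    unfolding induced_count_def by (intro card_mono) auto
  moreover have "card Y1 + card Y2 = card (Y1 \<union> Y2) + card (Y1 \<inter> Y2)"
    "card (Y1 \<union> Y2) + card Y3 = card ?U + card ((Y1 \<union> Y2) \<inter> Y3)"
    by (rule card_Un_Int; simp)+
  moreover have "(Y1 \<union> Y2) \<inter> Y3 = {a, c}" using s13 s23 by blast
  then have "card ((Y1 \<union> Y2) \<inter> Y3) = 2" using dist by simp
  moreover have "card (Y1 \<inter> Y2) = 1" using s12 by simp
  ultimately have "bl ?U" using Y1(1) Y2(1) Y3(1) unfolding bl_def by auto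
  then show False using A[of ?U] Y1 Y2 by auto
qed

section \<open>Extending an independent placement by one vertex\<close>

lemma drow_update_eq:
  assumes "v \<notin> e" "\<And>w. w \<noteq> v \<Longrightarrow> x $ w = y $ w"
  shows "drow x e = drow y e"
  unfolding drow_def erow_def vec_eq_iff
  using assms by (auto intro!: sum.cong)

lemma sum_edges_at_vertex:
  fixes H :: "'v::finite set set" and f :: "'v set \<Rightarrow> 'a::real_vector"
  assumes sg: "simple_graph UNIV H"
  shows "sum f H = sum f {e \<in> H. v \<notin> e} + (\<Sum>u | {v, u} \<in> H. f {v, u})"
proof -
  have eq: "H - {e \<in> H. v \<notin> e} = (\<lambda>u. {v, u}) ` {u. {v, u} \<in> H}"
  proof (intro equalityI subsetI)
    fix e assume e: "e \<in> H - {e \<in> H. v \<notin> e}"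
    then have "e \<in> H" by blast
    from simple_graph_edgeE[OF sg this] obtain p q where pq: "p \<noteq> q" "e = {p, q}" .
    show "e \<in> (\<lambda>u. {v, u}) ` {u. {v, u} \<in> H}"
    proof (cases "p = v")
      case True
      then show ?thesis using e pq by auto
    next
      case False
      then have "e = {v, p}" using e pq by auto
      then show ?thesis using e by auto
    qed
  qed auto
  have "sum f H = sum f (H - {e \<in> H. v \<notin> e}) + sum f {e \<in> H. v \<notin> e}"
    by (rule sum.subset_diff) auto
  also have "sum f (H - {e \<in> H. v \<notin> e}) = (\<Sum>u | {v, u} \<in> H. f {v, u})"
    unfolding eq by (subst sum.reindex) (auto simp: inj_on_def doubleton_eq_iff)
  finally show ?thesis by simp
qed

lemma card_edges_at_vertex:
  fixes H :: "'v::finite set set"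
  assumes "simple_graph UNIV H"
  shows "card {e \<in> H. v \<in> e} = card {u. {v, u} \<in> H}"
proof -
  have "card H = card {e \<in> H. v \<notin> e} + card {u. {v, u} \<in> H}"
    using sum_edges_at_vertex[OF assms, of "\<lambda>_. 1 :: real" v] by simp
  moreover have "card H = card {e \<in> H. v \<notin> e} + card {e \<in> H. v \<in> e}"
    by (subst card_Un_disjoint[symmetric]) (auto intro: arg_cong[of _ _ card])
  ultimately show ?thesis by simp
qed

lemma drow_nth_sum_edges:
  fixes H :: "'v::finite set set"
  assumes sg: "simple_graph UNIV H"
  shows "(\<Sum>e\<in>H. c e *\<^sub>R drow x e) $ v = (\<Sum>u | {v, u} \<in> H. c {v, u} *\<^sub>R (x $ v - x $ u))"
proof -
  have "(\<Sum>e | e \<in> H \<and> v \<notin> e. c e *\<^sub>R drow x e) $ v = 0"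
    by (auto simp: drow_def erow_def intro!: sum.neutral)
  moreover have "(\<Sum>u | {v, u} \<in> H. c {v, u} *\<^sub>R drow x {v, u}) $ v =
      (\<Sum>u | {v, u} \<in> H. c {v, u} *\<^sub>R (x $ v - x $ u))"
    using simple_graph_neq[OF sg] by (auto simp: drow_nth intro!: sum.cong)
  ultimately show ?thesis
    using sum_edges_at_vertex[OF sg, of "\<lambda>e. c e *\<^sub>R drow x e" v] by simp
qed

text \<open>The coordinate at \<open>v\<close> of a relation involves only the vectors from the
  neighbours to the new position; their independence removes all edges at \<open>v\<close>, and the
  rest is a relation for the old placement.\<close>

lemma drow_indep_extend:
  fixes H :: "'v::finite set set"
  assumes sg: "simple_graph UNIV H" and ind: "indep_family {e \<in> H. v \<notin> e} (drow x)"
    and z: "indep_family {u. {v, u} \<in> H} (\<lambda>u. z - x $ u)"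
  shows "\<exists>y. indep_family H (drow y)"
proof -
  define y where "y = (\<chi> w. if w = v then z else x $ w)"
  have "indep_family H (drow y)"
  proof (rule indep_familyI)
    fix c e assume s: "(\<Sum>e\<in>H. c e *\<^sub>R drow y e) = 0" and e: "e \<in> H"
    have "(\<Sum>u | {v, u} \<in> H. c {v, u} *\<^sub>R (z - x $ u)) = (\<Sum>u | {v, u} \<in> H. c {v, u} *\<^sub>R (y $ v - y $ u))"
    proof (rule sum.cong[OF refl])
      fix u assume "u \<in> {u. {v, u} \<in> H}"
      then have "u \<noteq> v" using simple_graph_neq[OF sg, of v u] by blast
      then show "c {v, u} *\<^sub>R (z - x $ u) = c {v, u} *\<^sub>R (y $ v - y $ u)" by (simp add: y_def)
    qed
    also have "\<dots> = 0" using s drow_nth_sum_edges[OF sg, of c y v] by simp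
    finally have cv: "c {v, u} = 0" if "{v, u} \<in> H" for u
      using indep_familyD[OF z, of "\<lambda>u. c {v, u}"] that by simp
    then have "(\<Sum>e | e \<in> H \<and> v \<notin> e. c e *\<^sub>R drow y e) = 0"
      using s sum_edges_at_vertex[OF sg, of "\<lambda>e. c e *\<^sub>R drow y e" v] by simp
    moreover have "drow y e = drow x e" if "v \<notin> e" for e
      using that by (rule drow_update_eq) (simp add: y_def)
    ultimately have "(\<Sum>e | e \<in> H \<and> v \<notin> e. c e *\<^sub>R drow x e) = 0" by simp
    then have c0: "c e = 0" if "e \<in> H" "v \<notin> e" for e
      using indep_familyD[OF ind] that by simp
    show "c e = 0"
    proof (cases "v \<in> e")
      case True
      obtain p q where "p \<noteq> q" "e = {p, q}" using simple_graph_edgeE[OF sg e] by metis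
      then have "e = {v, if p = v then q else p}" using True by auto
      then show ?thesis using cv e by metis
    qed (use c0 e in blast)
  qed
  then show ?thesis by blast
qed

lemma indep_family_differences_exist:
  fixes f :: "'v \<Rightarrow> complex"
  assumes "finite N" "card N \<le> 2" "inj_on f N"
  shows "\<exists>z. indep_family N (\<lambda>u. z - f u)"
proof -
  consider "card N = 0" | "card N = 1" | "card N = 2" using assms(2) by linarith
  then show ?thesis
  proof cases
    case 1
    then show ?thesis using assms(1) by (auto intro!: indep_familyI)
  next
    case 2
    then obtain a where "N = {a}" using card_1_singletonE by metis
    then show ?thesis by (intro exI[of _ "f a + 1"] indep_familyI) auto
  next
    case 3
    then obtain a b where N: "N = {a, b}" "a \<noteq> b" by (auto simp: card_2_iff)
    define d where "d = f b - f a"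
    have d: "d \<noteq> 0" using assms(3) N by (auto simp: d_def)
    \<comment> \<open>The new point makes a right angle at \<open>f a\<close>; the two differences
      are then i d and (i - 1) d.\<close>
    show ?thesis
    proof (intro exI[of _ "f a + \<i> * d"] indep_familyI)
      fix c i assume s: "(\<Sum>u\<in>N. c u *\<^sub>R (f a + \<i> * d - f u)) = 0" and i: "i \<in> N"
      have "(of_real (c a) * \<i> + of_real (c b) * (\<i> - 1)) * d = 0"
        using s N by (simp add: d_def scaleR_conv_of_real algebra_simps)
      then have "of_real (c a) * \<i> + of_real (c b) * (\<i> - 1) = 0" using d by simp
      then have "c b = 0" "c a = 0" by (auto simp: complex_eq_iff)
      then show "c i = 0" using i N by auto
    qed
  qed
qed

text \<open>Placing the new vertex at the midpoint of \<open>a b\<close> makes the sum of the two rows there a multiple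
  of the row of the removed edge \<open>a b\<close>.\<close>

lemma drow_indep_split_edge:
  fixes H :: "'v::finite set set"
  assumes sg: "simple_graph UNIV H" and N: "{u. {v, u} \<in> H} = {a, b, c}"
    and dist: "a \<noteq> b" "a \<noteq> c" "b \<noteq> c" and ab: "{a, b} \<notin> H"
    and ind: "indep_family (insert {a, b} {e \<in> H. v \<notin> e}) (drow x)"
    and nc: "noncollinear (x $ a) (x $ b) (x $ c)"
  shows "\<exists>y. indep_family H (drow y)"
proof -
  have v: "v \<noteq> a" "v \<noteq> b" "v \<noteq> c" using N simple_graph_neq[OF sg] by blast+
  define y where "y = (\<chi> w. if w = v then (x $ a + x $ b) / 2 else x $ w)"
  have yv: "y $ v = (x $ a + x $ b) / 2" "y $ a = x $ a" "y $ b = x $ b" "y $ c = x $ c"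
    using v by (auto simp: y_def)
  have mid: "drow y {v, a} + drow y {v, b} = (1/2) *\<^sub>R drow x {a, b}"
    using v dist by (auto simp: vec_eq_iff drow_nth yv complex_eq_iff add_divide_distrib diff_divide_distrib)
  have "indep_family H (drow y)"
  proof (rule indep_familyI)
    fix k e assume s: "(\<Sum>e\<in>H. k e *\<^sub>R drow y e) = 0" and e: "e \<in> H"
    have "0 = k {v, a} *\<^sub>R (y $ v - y $ a) + k {v, b} *\<^sub>R (y $ v - y $ b) + k {v, c} *\<^sub>R (y $ v - y $ c)"
      using s drow_nth_sum_edges[OF sg, of k y v] unfolding N using dist by (simp add: add.assoc)
    \<comment> \<open>With \<alpha> = b - a and \<gamma> = c - a, the differences from the midpoint
      to a, b, c are \<alpha>/2, -\<alpha>/2 and \<alpha>/2 - \<gamma>; the factor 2 clears the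
      halves. As \<alpha> and \<gamma> are independent, the coefficient at c vanishes and those at a
      and b agree.\<close>
    moreover have "complex_of_real (k {v, a} - k {v, b}) * (x $ b - x $ a) +
        complex_of_real (k {v, c}) * ((x $ b - x $ a) - 2 * (x $ c - x $ a)) =
      2 * (k {v, a} *\<^sub>R (y $ v - y $ a) + k {v, b} *\<^sub>R (y $ v - y $ b) + k {v, c} *\<^sub>R (y $ v - y $ c))"
      by (simp add: yv scaleR_conv_of_real field_simps)
    ultimately have E: "0 = complex_of_real (k {v, a} - k {v, b}) * (x $ b - x $ a) +
        complex_of_real (k {v, c}) * ((x $ b - x $ a) - 2 * (x $ c - x $ a))"
      by (metis mult_zero_right)
    define \<alpha> where "\<alpha> = x $ b - x $ a"
    define \<gamma> where "\<gamma> = x $ c - x $ a"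
    have "0 = complex_of_real (k {v, a} - k {v, b}) * \<alpha> + complex_of_real (k {v, c}) * (\<alpha> - 2 * \<gamma>)"
      using E by (simp only: \<alpha>_def \<gamma>_def)
    then have eq: "complex_of_real (k {v, a} - k {v, b} + k {v, c}) * \<alpha> = complex_of_real (2 * k {v, c}) * \<gamma>"
      by (simp add: algebra_simps)
    have nc': "Im (\<alpha> * cnj \<gamma>) \<noteq> 0" using nc by (simp add: noncollinear_def \<alpha>_def \<gamma>_def)
    have "Im ((complex_of_real (k {v, a} - k {v, b} + k {v, c}) * \<alpha>) * cnj \<gamma>) = Im ((complex_of_real (2 * k {v, c}) * \<gamma>) * cnj \<gamma>)"
      unfolding eq ..
    then have "(k {v, a} - k {v, b} + k {v, c}) * Im (\<alpha> * cnj \<gamma>) = 0"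
      by (simp add: algebra_simps)
    then have 1: "k {v, a} - k {v, b} + k {v, c} = 0" using nc' by simp
    then have "complex_of_real (2 * k {v, c}) * \<gamma> = 0" using eq by simp
    moreover have "\<gamma> \<noteq> 0" using nc' by auto
    ultimately have kc: "k {v, c} = 0" by simp
    then have kab: "k {v, a} = k {v, b}" using 1 by simp
    let ?H0 = "{e \<in> H. v \<notin> e}"
    have H0: "drow y e = drow x e" if "v \<notin> e" for e
      using that by (rule drow_update_eq) (simp add: y_def)
    have "0 = (\<Sum>e\<in>?H0. k e *\<^sub>R drow y e) + k {v, b} *\<^sub>R (drow y {v, a} + drow y {v, b})"
      using s sum_edges_at_vertex[OF sg, of "\<lambda>e. k e *\<^sub>R drow y e" v] dist kc kab unfolding N
      by (simp add: scaleR_add_right)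
    also have "(\<Sum>e\<in>?H0. k e *\<^sub>R drow y e) = (\<Sum>e\<in>?H0. k e *\<^sub>R drow x e)"
      using H0 by (intro sum.cong) auto
    finally have z: "(\<Sum>e\<in>?H0. k e *\<^sub>R drow x e) + (k {v, b} / 2) *\<^sub>R drow x {a, b} = 0"
      by (simp add: mid)
    \<comment> \<open>The two equal coefficients at the new vertex become one coefficient on the
      removed edge, halved by \<open>mid\<close>.\<close>
    define l where "l e = (if e = {a, b} then k {v, b} / 2 else k e)" for e
    have "(\<Sum>e\<in>insert {a, b} ?H0. l e *\<^sub>R drow x e) = 0"
    proof -
      have "(\<Sum>e\<in>?H0. l e *\<^sub>R drow x e) = (\<Sum>e\<in>?H0. k e *\<^sub>R drow x e)"
        using ab by (intro sum.cong) (auto simp: l_def)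
      then show ?thesis using z ab by (simp add: l_def add.commute)
    qed
    note l0 = indep_familyD[OF ind this]
    have "k {v, b} = 0" using l0[of "{a, b}"] by (simp add: l_def)
    then have kv: "k {v, u} = 0" if "{v, u} \<in> H" for u using that N kab kc by auto
    have k0: "k e = 0" if "e \<in> H" "v \<notin> e" for e
      using l0[of e] that ab by (auto simp: l_def split: if_splits)
    show "k e = 0"
    proof (cases "v \<in> e")
      case True
      obtain p q where "p \<noteq> q" "e = {p, q}" using simple_graph_edgeE[OF sg e] by metis
      then have "e = {v, if p = v then q else p}" using True by auto
      then show ?thesis using kv e by metis
    qed (use k0 e in blast)
  qed
  then show ?thesis by blast
qed

text \<open>The vertex type is fixed, so the induction runs on the number of non-isolated vertices
  and deleting a vertex means deleting its edges. Before a vertex is put back, genericity lets the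
  old placement be changed so that its two neighbours are distinct, or its three neighbours not
  collinear.\<close>

lemma laman_independent_placement:
  fixes H :: "'v::finite set set"
  assumes "simple_graph UNIV H" "sparse_count H"
  shows "\<exists>x. indep_family H (drow x)"
  using assms
proof (induction "card (\<Union>H)" arbitrary: H rule: less_induct)
  case less
  note sg = less.prems(1) and sp = less.prems(2)
  show ?case
  proof (cases "H = {}")
    case True
    then show ?thesis by (auto simp: indep_family_def)
  next
    case False
    obtain v where v: "v \<in> \<Union>H" "card {e \<in> H. v \<in> e} \<le> 3"
      using sparse_count_low_degree[OF sg sp False] .
    let ?N = "{u. {v, u} \<in> H}" and ?H0 = "{e \<in> H. v \<notin> e}"
    have smaller: "card (\<Union>F) < card (\<Union>H)" if "\<Union>F \<subseteq> \<Union>H - {v}" for F :: "'v set set"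
    proof (rule psubset_card_mono)
      have "v \<notin> \<Union>F" "\<Union>F \<subseteq> \<Union>H" using that by blast+
      then show "\<Union>F \<subset> \<Union>H" using v(1) by blast
    qed simp
    have IH: "\<exists>x. indep_family F (drow x)"
      if "simple_graph UNIV F" "sparse_count F" "\<Union>F \<subseteq> \<Union>H - {v}" for F
      using less.hyps[OF smaller[OF that(3)] that(1,2)] .
    have H0: "simple_graph UNIV ?H0" "sparse_count ?H0" "\<Union>?H0 \<subseteq> \<Union>H - {v}"
      using simple_graph_subset[OF sg, of ?H0] sparse_count_subset[OF sp, of ?H0] by auto
    have card: "card ?N \<le> 3" using v(2) card_edges_at_vertex[OF sg, of v] by simp
    show ?thesis
    proof (cases "card ?N \<le> 2")
      case True
      obtain x0 where x0: "indep_family ?H0 (drow x0)" using IH[OF H0] by blast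
      have "\<exists>x. indep_family ?H0 (drow x) \<and> inj_on (\<lambda>u. x $ u) ?N"
      proof (cases "card ?N = 2")
        case True
        then obtain a b where ab: "?N = {a, b}" "a \<noteq> b" by (auto simp: card_2_iff)
        obtain x where "indep_family ?H0 (drow x)" "x $ a \<noteq> x $ b"
          using generic_on_lines_conj[OF generic_drow_indep[OF x0] generic_distinct[OF ab(2)]]
          unfolding generic_on_lines_def by blast
        then show ?thesis unfolding ab(1) by (intro exI[of _ x]) auto
      next
        case False
        then have "card ?N = 0 \<or> card ?N = 1" using \<open>card ?N \<le> 2\<close> by linarith
        then have "inj_on (\<lambda>u. x0 $ u) ?N"
        proof
          assume "card ?N = 0"
          then have "?N = {}" by (simp only: card_0_eq finite)
          then show ?thesis by (simp only: inj_on_empty)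
        next
          assume "card ?N = 1"
          then obtain u where "?N = {u}" by (rule card_1_singletonE)
          then show ?thesis by (simp only: inj_on_def) simp
        qed
        then show ?thesis using x0 by blast
      qed
      then obtain x where x: "indep_family ?H0 (drow x)" "inj_on (\<lambda>u. x $ u) ?N" by blast
      obtain z where "indep_family ?N (\<lambda>u. z - x $ u)"
        using indep_family_differences_exist[OF finite True x(2)] by blast
      then show ?thesis by (rule drow_indep_extend[OF sg x(1)])
    next
      case False
      then have "card ?N = 3" using card by linarith
      then obtain a b c where N: "?N = {a, b, c}" "a \<noteq> b" "a \<noteq> c" "b \<noteq> c"
        by (auto simp: card_3_iff)
      have split: ?thesis
        if N': "?N = {p, q, r}" "p \<noteq> q" "p \<noteq> r" "q \<noteq> r"
          and pq: "{p, q} \<notin> H" "sparse_count (insert {p, q} ?H0)" for p q r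
      proof -
        have nb: "{v, p} \<in> H" "{v, q} \<in> H" using N'(1) by blast+
        then have "p \<noteq> v" "q \<noteq> v" using simple_graph_neq[OF sg] by blast+
        moreover have "simple_graph UNIV (insert {p, q} ?H0)"
          using H0(1) N'(2) unfolding simple_graph_def by blast
        ultimately have "\<exists>x. indep_family (insert {p, q} ?H0) (drow x)"
          using pq(2) nb by (intro IH) auto
        then obtain x0 where x0: "indep_family (insert {p, q} ?H0) (drow x0)" by blast
        obtain x where "indep_family (insert {p, q} ?H0) (drow x)" "noncollinear (x $ p) (x $ q) (x $ r)"
          using generic_on_lines_conj[OF generic_drow_indep[OF x0] generic_noncollinear[OF N'(2-4)]]
          unfolding generic_on_lines_def by blast
        then show ?thesis by (rule drow_indep_split_edge[OF sg N' pq(1)])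
      qed
      have nb: "{v, a} \<in> H" "{v, b} \<in> H" "{v, c} \<in> H" using N(1) by blast+
      then have "a \<noteq> v" "b \<noteq> v" "c \<noteq> v" using simple_graph_neq[OF sg] by blast+
      from sparse_count_reduce_degree_3[OF sg sp nb N(2-4) this]
      consider "{a, b} \<notin> H" "sparse_count (insert {a, b} ?H0)"
        | "{b, c} \<notin> H" "sparse_count (insert {b, c} ?H0)"
        | "{a, c} \<notin> H" "sparse_count (insert {a, c} ?H0)"
        by auto
      then show ?thesis
      proof cases
        case 1
        then show ?thesis by (rule split[OF N])
      next
        case 2
        have "?N = {b, c, a}" unfolding N(1) by blast
        then show ?thesis using split[of b c a] N 2 by blast
      next
        case 3
        have "?N = {a, c, b}" unfolding N(1) by blast
        then show ?thesis using split[of a c b] N 3 by blast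
      qed
    qed
  qed
qed

section \<open>The norm of the cylindrical space\<close>

definition plane :: "cyl_space \<Rightarrow> complex" where "plane z = Complex (coords z $ 1) (coords z $ 2)"
definition height :: "cyl_space \<Rightarrow> real" where "height z = coords z $ 3"
definition axial :: "cyl_space \<Rightarrow> real" where "axial z = coords z $ 4"
definition mk_cyl :: "complex \<Rightarrow> real \<Rightarrow> real \<Rightarrow> cyl_space" where
  "mk_cyl X h s = of_coords (\<chi> i. if i = 1 then Re X else if i = 2 then Im X else if i = 3 then h else s)"

lemma mk_cyl_simps [simp]:
  "plane (mk_cyl X h s) = X" "height (mk_cyl X h s) = h" "axial (mk_cyl X h s) = s"
  by (simp_all add: plane_def height_def axial_def mk_cyl_def)

lemma mk_cyl_collapse [simp]: "mk_cyl (plane z) (height z) (axial z) = z"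
  by (simp add: cyl_space_eq_iff vec_eq_iff forall_4 plane_def height_def axial_def mk_cyl_def)

lemma cyl_space_eqI: "plane z = plane w \<Longrightarrow> height z = height w \<Longrightarrow> axial z = axial w \<Longrightarrow> z = w"
  by (metis mk_cyl_collapse)

lemma cyl_parts_linear [simp]:
  "plane (z + w) = plane z + plane w" "plane (z - w) = plane z - plane w" "plane (r *\<^sub>R z) = r *\<^sub>R plane z"
  "plane 0 = 0"
  "height (z + w) = height z + height w" "height (z - w) = height z - height w" "height (r *\<^sub>R z) = r * height z"
  "height 0 = 0"
  "axial (z + w) = axial z + axial w" "axial (z - w) = axial z - axial w" "axial (r *\<^sub>R z) = r * axial z"
  "axial 0 = 0"
  by (simp_all add: plane_def height_def axial_def complex_eq_iff)

lemma norm_cyl: "norm z = max (norm (plane z) + \<bar>height z\<bar>) \<bar>axial z\<bar>"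
  by (simp add: norm_cyl_space_def plane_def height_def axial_def cmod_def)

lemma bounded_linear_parts: "bounded_linear plane" "bounded_linear height" "bounded_linear axial"
  by (rule bounded_linear_intro[where K = 1]; auto simp: norm_cyl le_max_iff_disj)+

lemma mk_cyl_linear:
  "mk_cyl (X + Y) (h + h') (s + s') = mk_cyl X h s + mk_cyl Y h' s'"
  "mk_cyl (X - Y) (h - h') (s - s') = mk_cyl X h s - mk_cyl Y h' s'"
  "mk_cyl (r *\<^sub>R X) (r * h) (r * s) = r *\<^sub>R mk_cyl X h s"
  by (rule cyl_space_eqI; simp)+

lemma bounded_linear_mk_cyl: "bounded_linear (\<lambda>(X, h, s). mk_cyl X h s)"
proof (rule bounded_linear_intro[where K = 3])
  fix x :: "complex \<times> real \<times> real"
  obtain X h s where x: "x = (X, h, s)" by (cases x) auto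
  have "norm X \<le> norm x" using norm_fst_le[of X "(h, s)"] by (simp add: x)
  moreover have "norm (h, s) \<le> norm x" using norm_snd_le[of "(h, s)" X] by (simp add: x)
  moreover have "norm h \<le> norm (h, s)" "norm s \<le> norm (h, s)"
    using norm_fst_le[of h s] norm_snd_le[of s h] by auto
  ultimately show "norm (case x of (X, h, s) \<Rightarrow> mk_cyl X h s) \<le> norm x * 3"
    by (auto simp: x norm_cyl)
qed (auto simp: mk_cyl_linear)

text \<open>The points at which the norm is differentiable. The planar norm and the absolute value
  of the height each have a corner at 0, visible only where they determine the norm; the light cone
  is a corner of the maximum.\<close>

definition smooth_dir :: "cyl_space \<Rightarrow> bool" where
  "smooth_dir z \<longleftrightarrow> (\<bar>axial z\<bar> < norm (plane z) + \<bar>height z\<bar> \<and> plane z \<noteq> 0 \<and> height z \<noteq> 0) \<or>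
     norm (plane z) + \<bar>height z\<bar> < \<bar>axial z\<bar>"

definition norm_deriv :: "cyl_space \<Rightarrow> cyl_space \<Rightarrow> real" where
  "norm_deriv z k = (if \<bar>axial z\<bar> < norm (plane z) + \<bar>height z\<bar>
     then sgn (plane z) \<bullet> plane k + sgn (height z) * height k else sgn (axial z) * axial k)"

lemma has_derivative_abs_real:
  assumes "(f has_derivative f') (at z)" "f z \<noteq> (0::real)"
  shows "((\<lambda>w. \<bar>f w\<bar>) has_derivative (\<lambda>k. sgn (f z) * f' k)) (at z)"
  using has_derivative_compose[OF assms(1) has_derivative_norm[OF assms(2)]]
  by (simp add: mult.commute real_norm_def)

lemma open_less_cyl:
  "open {w. \<bar>axial w\<bar> < norm (plane w) + \<bar>height w\<bar>}" "open {w. norm (plane w) + \<bar>height w\<bar> < \<bar>axial w\<bar>}"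
  by (intro open_Collect_less continuous_intros bounded_linear.continuous_on[OF bounded_linear_parts(1)]
      bounded_linear.continuous_on[OF bounded_linear_parts(2)]
      bounded_linear.continuous_on[OF bounded_linear_parts(3)])+

lemma norm_has_derivative_cyl:
  assumes "smooth_dir z"
  shows "(norm has_derivative norm_deriv z) (at z)"
proof -
  note pd = bounded_linear.has_derivative[OF bounded_linear_parts(1) has_derivative_ident]
    and hd = bounded_linear.has_derivative[OF bounded_linear_parts(2) has_derivative_ident]
    and ad = bounded_linear.has_derivative[OF bounded_linear_parts(3) has_derivative_ident]
  show ?thesis
  proof (cases "\<bar>axial z\<bar> < norm (plane z) + \<bar>height z\<bar>")
    case True
    then have nz: "plane z \<noteq> 0" "height z \<noteq> 0" using assms by (auto simp: smooth_dir_def)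
    have "((\<lambda>w. norm (plane w)) has_derivative (\<lambda>k. sgn (plane z) \<bullet> plane k)) (at z)"
      using has_derivative_compose[OF pd has_derivative_norm[OF nz(1)]] by (simp add: inner_commute)
    from has_derivative_add[OF this has_derivative_abs_real[OF hd nz(2)]]
    have "((\<lambda>w. norm (plane w) + \<bar>height w\<bar>) has_derivative norm_deriv z) (at z)"
      using True by (simp add: norm_deriv_def[abs_def])
    then show ?thesis
      by (rule has_derivative_transform_within_open[OF _ open_less_cyl(1)])
        (use True in \<open>auto simp: norm_cyl\<close>)
  next
    case False
    then have lt: "norm (plane z) + \<bar>height z\<bar> < \<bar>axial z\<bar>" using assms by (auto simp: smooth_dir_def)
    then have "axial z \<noteq> 0" using norm_ge_zero[of "plane z"] by (auto simp del: norm_ge_zero)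
    from has_derivative_abs_real[OF ad this]
    have "((\<lambda>w. \<bar>axial w\<bar>) has_derivative norm_deriv z) (at z)"
      using False by (simp add: norm_deriv_def[abs_def])
    then show ?thesis
      by (rule has_derivative_transform_within_open[OF _ open_less_cyl(2)])
        (use lt in \<open>auto simp: norm_cyl\<close>)
  qed
qed

lemma abs_not_differentiable_0:
  assumes "f differentiable (at (0::real))" "\<And>t::real. \<bar>t\<bar> < 1 \<Longrightarrow> f t = \<bar>t\<bar>"
  shows False
proof -
  obtain D where D: "(f has_real_derivative D) (at 0)"
    using assms(1) by (auto simp: real_differentiable_def)
  have f0: "f 0 = 0" using assms(2)[of 0] by simp
  have lim: "((\<lambda>h. f h / h) \<longlongrightarrow> D) (at 0)"
    using D f0 by (simp add: DERIV_def)
  have "((\<lambda>h. f h / h) \<longlongrightarrow> 1) (at_right 0)"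
  proof (rule Lim_transform_eventually[OF tendsto_const])
    show "\<forall>\<^sub>F x in at_right 0. 1 = f x / x"
      unfolding eventually_at_right_field using assms(2) by (intro exI[of _ 1]) auto
  qed
  moreover have "((\<lambda>h. f h / h) \<longlongrightarrow> -1) (at_left 0)"
  proof (rule Lim_transform_eventually[OF tendsto_const])
    show "\<forall>\<^sub>F x in at_left 0. -1 = f x / x"
      unfolding eventually_at_left_field using assms(2) by (intro exI[of _ "-1"]) auto
  qed
  moreover have "((\<lambda>h. f h / h) \<longlongrightarrow> D) (at_right 0)" "((\<lambda>h. f h / h) \<longlongrightarrow> D) (at_left 0)"
    using lim by (auto intro: tendsto_mono at_le)
  ultimately have "D = 1" "D = -1"
    using tendsto_unique[OF trivial_limit_at_right_real] tendsto_unique[OF trivial_limit_at_left_real] by blast+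
  then show False by simp
qed

text \<open>In each of the three nonsmooth cases some line through \<open>z\<close> sees a corner of the norm.\<close>

lemma smooth_dir_if_differentiable:
  assumes "z \<noteq> 0" and diff: "\<And>k. (\<lambda>t::real. norm (z + t *\<^sub>R k)) differentiable (at 0)"
  shows "smooth_dir z"
proof (rule ccontr)
  assume ns: "\<not> smooth_dir z"
  let ?N = "norm (plane z) + \<bar>height z\<bar>"
  consider "\<bar>axial z\<bar> < ?N" "plane z = 0" | "\<bar>axial z\<bar> < ?N" "height z = 0" | "\<bar>axial z\<bar> = ?N"
    using ns by (force simp: smooth_dir_def)
  then show False
  proof cases
    case 1
    have "(\<lambda>t. norm (z + t *\<^sub>R mk_cyl 1 0 0) - \<bar>height z\<bar>) differentiable (at 0)"
      by (intro derivative_intros diff)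
    then show False
      by (rule abs_not_differentiable_0) (use 1 in \<open>auto simp: norm_cyl\<close>)
  next
    case 2
    have "(\<lambda>t. norm (z + t *\<^sub>R mk_cyl 0 1 0) - norm (plane z)) differentiable (at 0)"
      by (intro derivative_intros diff)
    then show False
      by (rule abs_not_differentiable_0) (use 2 in \<open>auto simp: norm_cyl\<close>)
  next
    case 3
    have N: "?N > 0"
    proof (rule ccontr)
      assume "\<not> ?N > 0"
      then have "?N = 0" by (smt (verit) norm_ge_zero)
      then have "plane z = 0" "height z = 0" "axial z = 0"
        using 3 norm_ge_zero[of "plane z"] by (auto simp: add_nonneg_eq_0_iff)
      then have "z = 0" by (intro cyl_space_eqI) auto
      then show False using assms(1) by simp
    qed
    \<comment> \<open>This direction scales the first summand of the norm and leaves the axial one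
      fixed, so the norm is \<open>?N\<close> times the maximum of 1 + t and 1. Rescaling and
      subtracting t turns that into the absolute value.\<close>
    let ?k = "mk_cyl (plane z) (height z) 0"
    have "(\<lambda>t. 2 * (norm (z + t *\<^sub>R ?k) / ?N - 1) - t) differentiable (at 0)"
      using N by (intro derivative_intros diff) auto
    then show False
    proof (rule abs_not_differentiable_0)
      fix t :: real assume t: "\<bar>t\<bar> < 1"
      have "norm (plane z + t *\<^sub>R plane z) = (1 + t) * norm (plane z)"
        using t norm_scaleR[of "1 + t" "plane z"] by (simp add: scaleR_add_left)
      moreover have "\<bar>height z + t * height z\<bar> = (1 + t) * \<bar>height z\<bar>"
        using t abs_mult[of "1 + t" "height z"] by (simp add: distrib_right)
      ultimately have "norm (z + t *\<^sub>R ?k) = max ((1 + t) * ?N) ?N"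
        using 3 by (simp add: norm_cyl distrib_left)
      also have "\<dots> = ?N * max (1 + t) 1"
        using N by (simp add: max_mult_distrib_right mult.commute)
      finally have "norm (z + t *\<^sub>R ?k) / ?N = max (1 + t) 1" using N by simp
      then show "2 * (norm (z + t *\<^sub>R ?k) / ?N - 1) - t = \<bar>t\<bar>" by (simp add: max_def abs_if)
    qed
  qed
qed

section \<open>Infinitesimal rigid motions of the cylindrical space\<close>

definition planar_motion :: "real \<Rightarrow> complex \<Rightarrow> real \<Rightarrow> real \<Rightarrow> cyl_space \<Rightarrow> cyl_space" where
  "planar_motion \<theta> c d e z = mk_cyl (\<i> * complex_of_real \<theta> * plane z + c) d e"

lemma planar_motion_inf_rigid: "planar_motion \<theta> c d e \<in> inf_rigid_motions"
proof -
  define f where "f z t = (cis (\<theta> * t) * plane z + complex_of_real t * c, height z + t * d, axial z + t * e)" for z t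
  define \<alpha> where "\<alpha> z t = (case f z t of (X, h, s) \<Rightarrow> mk_cyl X h s)" for z t
  have \<alpha>: "\<alpha> z t = mk_cyl (cis (\<theta> * t) * plane z + complex_of_real t * c) (height z + t * d) (axial z + t * e)" for z t
    by (simp add: \<alpha>_def f_def)
  have der: "(\<alpha> z has_vector_derivative mk_cyl (\<i> * complex_of_real \<theta> * cis (\<theta> * t) * plane z + c) d e) (at t)" for z t
  proof -
    have "((\<lambda>t. cis (\<theta> * t)) has_vector_derivative \<i> * complex_of_real \<theta> * cis (\<theta> * t)) (at t)"
    proof -
      have "((\<lambda>z. exp (\<i> * complex_of_real \<theta> * z)) has_field_derivative
          \<i> * complex_of_real \<theta> * exp (\<i> * complex_of_real \<theta> * complex_of_real t)) (at (complex_of_real t))"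
        by (auto intro!: derivative_eq_intros)
      from has_vector_derivative_real_field[OF this] show ?thesis
        by (simp add: cis_conv_exp mult.assoc)
    qed
    then have "((\<lambda>t. cis (\<theta> * t) * plane z + complex_of_real t * c) has_vector_derivative
        (\<i> * complex_of_real \<theta> * cis (\<theta> * t) * plane z + c)) (at t)"
      by (auto intro!: derivative_eq_intros)
    moreover have "((\<lambda>t. height z + t * d) has_vector_derivative d) (at t)"
      "((\<lambda>t. axial z + t * e) has_vector_derivative e) (at t)"
      by (auto intro!: derivative_eq_intros)
    ultimately have "(f z has_vector_derivative (\<i> * complex_of_real \<theta> * cis (\<theta> * t) * plane z + c, d, e)) (at t)"
      unfolding f_def by (intro has_vector_derivative_Pair)
    from bounded_linear.has_vector_derivative[OF bounded_linear_mk_cyl this]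
    show ?thesis by (simp add: \<alpha>_def[abs_def])
  qed
  have "rigid_motion \<alpha>"
    unfolding rigid_motion_def
  proof (intro conjI allI ballI)
    fix z
    show "continuous_on {-1..1} (\<alpha> z)"
      using der by (intro continuous_at_imp_continuous_on) (auto intro: has_vector_derivative_continuous)
    show "\<alpha> z 0 = z" by (simp add: \<alpha>)
    show "\<alpha> z differentiable (at 0)"
      using der[of z 0] by (auto simp: has_vector_derivative_def differentiable_def)
  next
    fix z w t
    have "cis (\<theta> * t) * plane z - cis (\<theta> * t) * plane w = cis (\<theta> * t) * (plane z - plane w)"
      by (simp add: algebra_simps)
    then show "norm (\<alpha> z t - \<alpha> w t) = norm (z - w)"
      by (simp add: \<alpha> norm_cyl norm_mult)
  qed
  moreover have "(\<alpha> z has_vector_derivative planar_motion \<theta> c d e z) (at 0)" for z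
    using der[of z 0] by (simp add: planar_motion_def)
  ultimately show ?thesis unfolding inf_rigid_motions_def by blast
qed

text \<open>The distance of two moving points is constant, so the chain rule applies wherever the
  norm is differentiable. The classification below uses \<eta> only through this equation.\<close>

lemma inf_rigid_motion_norm_deriv:
  assumes "\<eta> \<in> inf_rigid_motions" "smooth_dir (z - w)"
  shows "norm_deriv (z - w) (\<eta> z - \<eta> w) = 0"
proof -
  obtain \<alpha> where \<alpha>: "rigid_motion \<alpha>" "\<And>x. (\<alpha> x has_vector_derivative \<eta> x) (at 0)"
    using assms(1) by (auto simp: inf_rigid_motions_def)
  have \<alpha>0: "\<alpha> x 0 = x" for x using \<alpha>(1) by (simp add: rigid_motion_def)
  have "((\<lambda>t. \<alpha> z t - \<alpha> w t) has_derivative (\<lambda>t. t *\<^sub>R (\<eta> z - \<eta> w))) (at 0)"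
    using has_vector_derivative_diff[OF \<alpha>(2)[of z] \<alpha>(2)[of w]] by (simp add: has_vector_derivative_def)
  from has_derivative_compose[OF this, of norm "norm_deriv (z - w)"]
  have "((\<lambda>t. norm (\<alpha> z t - \<alpha> w t)) has_derivative (\<lambda>t. norm_deriv (z - w) (t *\<^sub>R (\<eta> z - \<eta> w)))) (at 0)"
    using norm_has_derivative_cyl[OF assms(2)] by (simp add: \<alpha>0)
  moreover have "((\<lambda>t. norm (\<alpha> z t - \<alpha> w t)) has_derivative (\<lambda>t. 0)) (at 0)"
  proof (rule has_derivative_transform_within_open)
    show "((\<lambda>t. norm (z - w)) has_derivative (\<lambda>t. 0)) (at (0::real))" by simp
    show "open {-1<..<1::real}" by simp
    show "norm (z - w) = norm (\<alpha> z t - \<alpha> w t)" if "t \<in> {-1<..<1}" for t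
      using \<alpha>(1) that by (simp add: rigid_motion_def)
  qed simp
  ultimately have "(\<lambda>t. norm_deriv (z - w) (t *\<^sub>R (\<eta> z - \<eta> w))) = (\<lambda>t. 0)"
    by (rule has_derivative_unique)
  from fun_cong[OF this, of 1] show ?thesis by simp
qed

text \<open>Both points are timelike related to a third one, \<open>?u\<close>, chosen far up the
  axis.\<close>

lemma inf_rigid_motion_axial_const:
  assumes \<eta>: "\<eta> \<in> inf_rigid_motions"
  shows "axial (\<eta> z) = axial (\<eta> w)"
proof -
  have step: "axial (\<eta> z) = axial (\<eta> w)" if "norm (plane (z - w)) + \<bar>height (z - w)\<bar> < \<bar>axial (z - w)\<bar>" for z w
  proof -
    have "smooth_dir (z - w)" using that by (simp add: smooth_dir_def)
    from inf_rigid_motion_norm_deriv[OF \<eta> this]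
    have "sgn (axial (z - w)) * axial (\<eta> z - \<eta> w) = 0" using that by (simp add: norm_deriv_def)
    moreover have "axial (z - w) \<noteq> 0" using that norm_ge_zero[of "plane (z - w)"] by linarith
    ultimately show ?thesis by (simp add: sgn_zero_iff)
  qed
  define M where "M = norm (plane (z - w)) + \<bar>height (z - w)\<bar> + \<bar>axial z\<bar> + \<bar>axial w\<bar> + 1"
  let ?u = "mk_cyl (plane z) (height z) (axial z + M + \<bar>axial z\<bar> + \<bar>axial w\<bar>)"
  have "M > 0" using norm_ge_zero[of "plane (z - w)"] unfolding M_def by linarith
  then have "axial (\<eta> ?u) = axial (\<eta> z)" by (intro step) simp
  moreover have "axial (\<eta> ?u) = axial (\<eta> w)"
  proof (rule step)
    show "norm (plane (?u - w)) + \<bar>height (?u - w)\<bar> < \<bar>axial (?u - w)\<bar>"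
      unfolding M_def by simp
  qed
  ultimately show ?thesis by simp
qed

definition spacelike :: "cyl_space \<Rightarrow> bool" where
  "spacelike z \<longleftrightarrow> \<bar>axial z\<bar> < norm (plane z) + \<bar>height z\<bar>"

lemma inf_rigid_motion_spacelike:
  assumes "\<eta> \<in> inf_rigid_motions" "spacelike (z - w)" "plane z \<noteq> plane w" "height z \<noteq> height w"
  shows "sgn (plane z - plane w) \<bullet> (plane (\<eta> z) - plane (\<eta> w)) +
    sgn (height z - height w) * (height (\<eta> z) - height (\<eta> w)) = 0"
proof -
  have "smooth_dir (z - w)" using assms by (simp add: smooth_dir_def spacelike_def)
  from inf_rigid_motion_norm_deriv[OF assms(1) this] show ?thesis
    using assms(2) by (simp add: norm_deriv_def spacelike_def)
qed

text \<open>Three points whose plane parts lie on a line, with the top one in the middle.\<close>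

lemma inf_rigid_motion_height_eq:
  assumes \<eta>: "\<eta> \<in> inf_rigid_motions" and sp: "spacelike (q - r)"
    and ne: "plane q \<noteq> plane r" and lt: "height q < height r"
  shows "height (\<eta> q) = height (\<eta> r)"
proof -
  define d where "d = plane r - plane q"
  have d: "norm d > 0" using ne by (simp add: d_def)
  \<comment> \<open>Chosen to make \<open>(M - 1) * norm d\<close> exceed the axial coordinates of q
    and r in absolute value, so that p is spacelike to both.\<close>
  define M where "M = 1 + (\<bar>axial q\<bar> + \<bar>axial r\<bar> + 1) / norm d"
  have M: "M > 1" using d by (simp add: M_def add_nonneg_pos)
  have Md: "(M - 1) * norm d = \<bar>axial q\<bar> + \<bar>axial r\<bar> + 1" using d by (simp add: M_def)
  define p where "p = mk_cyl (plane q + M *\<^sub>R d) (height q - 1) 0"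
  have pq: "plane p - plane q = M *\<^sub>R d" and pr: "plane p - plane r = (M - 1) *\<^sub>R d"
    by (simp_all add: p_def d_def algebra_simps)
  have "spacelike (p - r)"
    using pr Md M lt by (simp add: spacelike_def p_def[THEN arg_cong[of _ _ axial]] p_def[THEN arg_cong[of _ _ height]])
  moreover have "spacelike (p - q)"
  proof -
    have "(M - 1) * norm d \<le> M * norm d" using d by simp
    then show ?thesis
      using pq Md M by (simp add: spacelike_def p_def[THEN arg_cong[of _ _ axial]] p_def[THEN arg_cong[of _ _ height]])
  qed
  moreover have "plane p \<noteq> plane r" "plane p \<noteq> plane q" using pq pr M d by auto
  moreover have "height p < height q" "height p < height r" using lt by (simp_all add: p_def)
  moreover have "sgn (plane q - plane r) = - sgn d" by (simp add: d_def flip: sgn_minus)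
  moreover have "sgn (M *\<^sub>R d) = sgn d" "sgn ((M - 1) *\<^sub>R d) = sgn d" using M by (simp_all add: sgn_scaleR)
  \<comment> \<open>Subtracting the equation for p, r from that for p, q gives \<open>sgn d
    \<bullet> (plane (\<eta> r) - plane (\<eta> q)) + height (\<eta> q) - height (\<eta> r) =
    0\<close>. The equation for q, r has the same planar term but the opposite height term.\<close>
  ultimately show ?thesis
    using inf_rigid_motion_spacelike[OF \<eta> sp ne] inf_rigid_motion_spacelike[OF \<eta>, of p r]
      inf_rigid_motion_spacelike[OF \<eta>, of p q] lt pq pr
    by (simp add: inner_diff_right)
qed

lemma spacelike_minus: "spacelike (z - w) \<longleftrightarrow> spacelike (w - z)"
  by (simp add: spacelike_def norm_minus_commute abs_minus_commute)

text \<open>Both points are compared with one point \<open>u\<close> that is higher than either and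
  so far away in the plane that the differences are spacelike.\<close>

lemma inf_rigid_motion_height_const:
  assumes \<eta>: "\<eta> \<in> inf_rigid_motions"
  shows "height (\<eta> z) = height (\<eta> w)"
proof -
  define B where "B = norm (plane z) + norm (plane w) + \<bar>axial z\<bar> + \<bar>axial w\<bar> + 1"
  define u where "u = mk_cyl (complex_of_real B) (\<bar>height z\<bar> + \<bar>height w\<bar> + 1) 0"
  have B: "B > 0" unfolding B_def using norm_ge_zero[of "plane z"] norm_ge_zero[of "plane w"] by linarith
  have "height (\<eta> y) = height (\<eta> u)" if y: "y = z \<or> y = w" for y
  proof (rule inf_rigid_motion_height_eq[OF \<eta>])
    have "B - norm (plane y) \<le> norm (plane y - plane u)"
      using norm_triangle_ineq3[of "plane u" "plane y"] B by (simp add: u_def norm_minus_commute)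
    moreover have "\<bar>axial y\<bar> < B - norm (plane y)"
      using y
    proof
      assume "y = z"
      then show ?thesis using norm_ge_zero[of "plane w"] unfolding B_def by (simp del: norm_ge_zero)
    next
      assume "y = w"
      then show ?thesis using norm_ge_zero[of "plane z"] unfolding B_def by (simp del: norm_ge_zero)
    qed
    ultimately have far: "\<bar>axial y\<bar> < norm (plane y - plane u)" by linarith
    then show "spacelike (y - u)" by (simp add: spacelike_def u_def add_pos_nonneg)
    show "plane y \<noteq> plane u" using far by auto
    show "height y < height u" using y by (auto simp: u_def)
  qed
  then show ?thesis by metis
qed

lemma inf_rigid_motion_plane_orthogonal:
  assumes \<eta>: "\<eta> \<in> inf_rigid_motions" and "spacelike (z - w)" "height z \<noteq> height w"
  shows "(plane z - plane w) \<bullet> (plane (\<eta> z) - plane (\<eta> w)) = 0"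
proof (cases "plane z = plane w")
  case False
  from inf_rigid_motion_spacelike[OF assms(1,2) this assms(3)]
  have "sgn (plane z - plane w) \<bullet> (plane (\<eta> z) - plane (\<eta> w)) = 0"
    using inf_rigid_motion_height_const[OF \<eta>, of z w] by simp
  then show ?thesis using False by (simp add: sgn_div_norm)
qed simp

text \<open>Seen from a point displaced by B in direction d, both points have the same planar
  direction d, so their velocities agree in the component along d; the directions 1 and i
  suffice.\<close>

lemma inf_rigid_motion_plane_depends:
  assumes \<eta>: "\<eta> \<in> inf_rigid_motions" and "plane z = plane w"
  shows "plane (\<eta> z) = plane (\<eta> w)"
proof -
  define B where "B = \<bar>axial z\<bar> + \<bar>axial w\<bar> + 1"
  have "d \<bullet> (plane (\<eta> z) - plane (\<eta> w)) = 0" if "d = 1 \<or> d = \<i>" for d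
  proof -
    define u where "u = mk_cyl (plane z + B *\<^sub>R d) (\<bar>height z\<bar> + \<bar>height w\<bar> + 1) 0"
    have B: "B > 0" by (simp add: B_def)
    have nd: "norm d = 1" using that by auto
    have "d \<bullet> plane (\<eta> u) = d \<bullet> plane (\<eta> y)" if y: "y = z \<or> y = w" for y
    proof -
      have uy: "plane u - plane y = B *\<^sub>R d" using y assms(2) by (auto simp: u_def)
      then have "norm (plane u - plane y) = B" using nd B by simp
      then have "spacelike (u - y)" "height u \<noteq> height y"
        using y by (auto simp: spacelike_def u_def B_def)
      from inf_rigid_motion_plane_orthogonal[OF \<eta> this] show ?thesis
        using B by (simp add: uy inner_diff_right)
    qed
    from this[of z] this[of w] show ?thesis by (simp add: inner_diff_right)
  qed
  from this[of 1] this[of \<i>] show ?thesis by (simp add: inner_complex_def complex_eq_iff)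
qed

text \<open>After subtracting the value at 0, polarisation makes \<zeta> skew-symmetric. Pairing
  with 1 and i recovers \<zeta> from its values there, and skewness leaves only a multiple of the
  rotation by a right angle.\<close>

lemma skew_plane_field:
  assumes "\<And>X Y. (X - Y) \<bullet> (\<xi> X - \<xi> Y) = (0::real)"
  shows "\<xi> X = \<i> * complex_of_real (Im (\<xi> 1 - \<xi> 0)) * X + \<xi> 0"
proof -
  define \<zeta> where "\<zeta> Y = \<xi> Y - \<xi> 0" for Y
  have z: "Y \<bullet> \<zeta> Y = 0" for Y using assms[of Y 0] by (simp add: \<zeta>_def)
  have zz: "X \<bullet> \<zeta> Y = - (Y \<bullet> \<zeta> X)" for X Y
  proof -
    have "(X - Y) \<bullet> (\<zeta> X - \<zeta> Y) = 0" using assms[of X Y] by (simp add: \<zeta>_def)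
    then show ?thesis using z[of X] z[of Y] by (simp add: inner_diff_left inner_diff_right)
  qed
  have "Re (\<zeta> 1) = 0" using z[of 1] by (simp add: inner_complex_def)
  moreover have "Im (\<zeta> \<i>) = 0" using z[of \<i>] by (simp add: inner_complex_def)
  moreover have "Re (\<zeta> \<i>) = - Im (\<zeta> 1)" using zz[of 1 \<i>] by (simp add: inner_complex_def)
  moreover have "Re (\<zeta> X) = - (X \<bullet> \<zeta> 1)" using zz[of 1 X] by (simp add: inner_complex_def)
  moreover have "Im (\<zeta> X) = - (X \<bullet> \<zeta> \<i>)" using zz[of \<i> X] by (simp add: inner_complex_def)
  ultimately have "\<zeta> X = \<i> * complex_of_real (Im (\<zeta> 1)) * X"
    by (simp add: complex_eq_iff inner_complex_def)
  then show ?thesis by (simp add: \<zeta>_def algebra_simps)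
qed

lemma inf_rigid_motions_cyl: "inf_rigid_motions = {planar_motion \<theta> c d e | \<theta> c d e. True}"
proof (intro equalityI subsetI)
  fix \<eta> :: "cyl_space \<Rightarrow> cyl_space" assume \<eta>: "\<eta> \<in> inf_rigid_motions"
  define \<xi> where "\<xi> X = plane (\<eta> (mk_cyl X 0 0))" for X
  have \<xi>: "plane (\<eta> z) = \<xi> (plane z)" for z
    unfolding \<xi>_def by (rule inf_rigid_motion_plane_depends[OF \<eta>]) simp
  have "(X - Y) \<bullet> (\<xi> X - \<xi> Y) = 0" for X Y
  proof (cases "X = Y")
    case False
    \<comment> \<open>The heights 1 and 0 keep the height difference away from the corner.\<close>
    then have "spacelike (mk_cyl X 1 0 - mk_cyl Y 0 0)" by (simp add: spacelike_def add_nonneg_pos)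
    from inf_rigid_motion_plane_orthogonal[OF \<eta> this] show ?thesis by (simp add: \<xi>)
  qed simp
  note skew = skew_plane_field[of \<xi>, OF this]
  define \<theta> where "\<theta> = Im (\<xi> 1 - \<xi> 0)"
  define c where "c = \<xi> 0"
  have "plane (\<eta> z) = \<i> * complex_of_real \<theta> * plane z + c" for z
    unfolding \<xi> \<theta>_def c_def by (rule skew)
  then have "\<eta> z = planar_motion \<theta> c (height (\<eta> 0)) (axial (\<eta> 0)) z" for z
    using inf_rigid_motion_height_const[OF \<eta>, of z 0] inf_rigid_motion_axial_const[OF \<eta>, of z 0]
    by (intro cyl_space_eqI) (simp_all add: planar_motion_def)
  then have "\<eta> = planar_motion \<theta> c (height (\<eta> 0)) (axial (\<eta> 0))" by (rule ext)
  then show "\<eta> \<in> {planar_motion \<theta> c d e | \<theta> c d e. True}" by blast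
qed (auto simp: planar_motion_inf_rigid)

section \<open>Trees as intersection graphs of discs\<close>

text \<open>The point \<open>g v\<close> lies on the circle around \<open>x v\<close> and outside all other discs: a new leaf at \<open>v\<close> is
  placed on that circle next to \<open>g v\<close>, with a tiny disc. The colouring \<open>\<sigma>\<close> is the bipartition of the tree.\<close>

definition ball_config :: "'v set set \<Rightarrow> 'v set \<Rightarrow> ('v \<Rightarrow> complex) \<Rightarrow> ('v \<Rightarrow> real) \<Rightarrow> ('v \<Rightarrow> complex) \<Rightarrow>
    ('v \<Rightarrow> bool) \<Rightarrow> bool" where
  "ball_config T S x \<rho> g \<sigma> \<longleftrightarrow>
     (\<forall>v\<in>S. \<rho> v > 0 \<and> norm (g v - x v) = \<rho> v) \<and>
     (\<forall>v\<in>S. \<forall>y\<in>S. y \<noteq> v \<longrightarrow> \<rho> y < norm (g v - x y)) \<and>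
     (\<forall>v\<in>S. \<forall>w\<in>S. v \<noteq> w \<longrightarrow> {v, w} \<in> T \<longrightarrow> norm (x v - x w) < \<rho> v + \<rho> w \<and> \<sigma> v \<noteq> \<sigma> w) \<and>
     (\<forall>v\<in>S. \<forall>w\<in>S. v \<noteq> w \<longrightarrow> {v, w} \<notin> T \<longrightarrow> \<rho> v + \<rho> w < norm (x v - x w))"

lemma ball_config_extend:
  fixes T :: "'v::finite set set"
  assumes C: "ball_config T S x \<rho> g \<sigma>" and w: "w \<notin> S" and v: "v \<in> S" "{v, w} \<in> T"
    and other: "\<And>y. y \<in> S \<Longrightarrow> y \<noteq> v \<Longrightarrow> {y, w} \<notin> T"
  shows "\<exists>x \<rho> g \<sigma>. ball_config T (insert w S) x \<rho> g \<sigma>"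
proof -
  have C1: "\<rho> u > 0" "norm (g u - x u) = \<rho> u" if "u \<in> S" for u using C that by (auto simp: ball_config_def)
  have C2: "\<rho> y < norm (g u - x y)" if "u \<in> S" "y \<in> S" "y \<noteq> u" for u y
    using C that by (auto simp: ball_config_def)
  have C3: "norm (x u - x y) < \<rho> u + \<rho> y \<and> \<sigma> u \<noteq> \<sigma> y" if "u \<in> S" "y \<in> S" "u \<noteq> y" "{u, y} \<in> T" for u y
    using C that unfolding ball_config_def by blast
  have C4: "\<rho> u + \<rho> y < norm (x u - x y)" if "u \<in> S" "y \<in> S" "u \<noteq> y" "{u, y} \<notin> T" for u y
    using C that unfolding ball_config_def by blast
  \<comment> \<open>The point \<open>g v\<close> rotated about the centre \<open>x v\<close>. It
    stays on the circle, and for small angles outside all other discs.\<close>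
  define z where "z \<theta> = x v + (g v - x v) * cis \<theta>" for \<theta>
  have "\<forall>\<^sub>F \<theta> in at_right 0. \<forall>y\<in>S - {v}. \<rho> y < norm (z \<theta> - x y)"
  proof (intro eventually_ball_finite ballI)
    fix y assume y: "y \<in> S - {v}"
    have "isCont (\<lambda>\<theta>. norm (z \<theta> - x y)) 0"
      unfolding z_def cis_conv_exp by (intro continuous_intros)
    then have "((\<lambda>\<theta>. norm (z \<theta> - x y)) \<longlongrightarrow> norm (g v - x y)) (at_right 0)"
      unfolding isCont_def by (auto simp: z_def intro: tendsto_mono at_le)
    then show "\<forall>\<^sub>F \<theta> in at_right 0. \<rho> y < norm (z \<theta> - x y)"
      using C2[OF v(1), of y] y by (intro order_tendstoD(1)) auto
  qed simp
  moreover have "\<forall>\<^sub>F \<theta> in at_right (0::real). 0 < \<theta>" by (rule eventually_at_right_less)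
  moreover have "\<forall>\<^sub>F \<theta> in at_right 0. \<theta> < pi"
    by (rule order_tendstoD(2)[OF tendsto_ident_at pi_gt_zero])
  ultimately have "\<exists>\<theta>. (\<forall>y\<in>S - {v}. \<rho> y < norm (z \<theta> - x y)) \<and> 0 < \<theta> \<and> \<theta> < pi"
    by (intro eventually_happens'[OF trivial_limit_at_right_real] eventually_conj)
  then obtain \<theta> where \<theta>: "\<And>y. y \<in> S \<Longrightarrow> y \<noteq> v \<Longrightarrow> \<rho> y < norm (z \<theta> - x y)" "0 < \<theta>" "\<theta> < pi"
    by blast
  define p where "p = z \<theta>"
  have pv: "norm (p - x v) = \<rho> v"
    using C1[OF v(1)] by (simp add: p_def z_def norm_mult)
  \<comment> \<open>A genuine rotation moves the centre off \<open>g v\<close>, so that a small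
    enough disc leaves \<open>g v\<close> uncovered for later leaves at \<open>v\<close>.\<close>
  have "cis \<theta> \<noteq> 1"
    using sin_gt_zero[OF \<theta>(2,3)] by (auto simp: complex_eq_iff)
  moreover have "g v \<noteq> x v" using C1[OF v(1)] by auto
  moreover have "p - g v = (g v - x v) * (cis \<theta> - 1)" by (simp add: p_def z_def algebra_simps)
  ultimately have "p \<noteq> g v" by auto
  then have pg: "p \<noteq> g y" if "y \<in> S" for y
    using C2[OF that v(1)] pv by (cases "y = v") auto
  have "\<forall>\<^sub>F r in at_right 0. \<forall>y\<in>S. r < norm (p - g y)"
  proof (intro eventually_ball_finite ballI)
    fix y assume "y \<in> S"
    then show "\<forall>\<^sub>F r in at_right 0. r < norm (p - g y)"
      using pg by (intro order_tendstoD(2)[OF tendsto_ident_at]) auto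
  qed simp
  moreover have "\<forall>\<^sub>F r in at_right 0. \<forall>y\<in>S - {v}. r < norm (p - x y) - \<rho> y"
  proof (intro eventually_ball_finite ballI)
    fix y assume "y \<in> S - {v}"
    then show "\<forall>\<^sub>F r in at_right 0. r < norm (p - x y) - \<rho> y"
      using \<theta>(1) unfolding p_def by (intro order_tendstoD(2)[OF tendsto_ident_at]) auto
  qed simp
  moreover have "\<forall>\<^sub>F r in at_right (0::real). 0 < r" by (rule eventually_at_right_less)
  ultimately have "\<exists>r. (\<forall>y\<in>S. r < norm (p - g y)) \<and> (\<forall>y\<in>S - {v}. r < norm (p - x y) - \<rho> y) \<and> 0 < r"
    by (intro eventually_happens'[OF trivial_limit_at_right_real] eventually_conj)
  then obtain r where r: "\<And>y. y \<in> S \<Longrightarrow> r < norm (p - g y)"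
    "\<And>y. y \<in> S \<Longrightarrow> y \<noteq> v \<Longrightarrow> r + \<rho> y < norm (p - x y)" "0 < r"
    by (auto simp: less_diff_eq)
  \<comment> \<open>The free boundary point of the new disc is the one pointing radially away from
    \<open>x v\<close>, hence outside the disc of \<open>v\<close>.\<close>
  define q where "q = p + (r / \<rho> v) *\<^sub>R (p - x v)"
  have \<rho>v: "\<rho> v > 0" using C1 v by blast
  have qp: "norm (q - p) = r" using pv \<rho>v r(3) by (simp add: q_def)
  have "q - x v = (1 + r / \<rho> v) *\<^sub>R (p - x v)" by (simp add: q_def algebra_simps)
  then have "norm (q - x v) = (1 + r / \<rho> v) * \<rho> v" using pv \<rho>v r(3) by simp
  then have qv: "norm (q - x v) = \<rho> v + r" using \<rho>v by (simp add: distrib_right)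
  have qy: "\<rho> y < norm (q - x y)" if y: "y \<in> S" for y
  proof (cases "y = v")
    case False
    have "norm (p - x y) \<le> norm (q - p) + norm (q - x y)"
      using norm_triangle_ineq4[of "q - x y" "q - p"] by simp
    then show ?thesis using r(2)[OF y False] qp by linarith
  qed (use qv r(3) in simp)
  have gw: "r < norm (g y - p)" if "y \<in> S" for y using r(1)[OF that] by (simp add: norm_minus_commute)
  have edge: "norm (p - x y) < r + \<rho> y" "y = v" if "y \<in> S" "{y, w} \<in> T" for y
  proof -
    show "y = v" using other[of y] that by blast
    then show "norm (p - x y) < r + \<rho> y" using pv r(3) by simp
  qed
  have edge': "norm (x y - p) < \<rho> y + r" if "y \<in> S" "{y, w} \<in> T" for y
    using edge(1)[OF that] by (simp add: norm_minus_commute add.commute)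
  have nonedge: "r + \<rho> y < norm (p - x y)" if "y \<in> S" "{y, w} \<notin> T" for y
    using r(2)[of y] v(2) that by auto
  have nonedge': "\<rho> y + r < norm (x y - p)" if "y \<in> S" "{y, w} \<notin> T" for y
    using nonedge[OF that] by (simp add: norm_minus_commute add.commute)
  have "ball_config T (insert w S) (x(w := p)) (\<rho>(w := r)) (g(w := q)) (\<sigma>(w := \<not> \<sigma> v))"
    unfolding ball_config_def
  proof (intro conjI)
    show "\<forall>u\<in>insert w S. 0 < (\<rho>(w := r)) u \<and> norm ((g(w := q)) u - (x(w := p)) u) = (\<rho>(w := r)) u"
      using C1 r(3) qp w by auto
    show "\<forall>u\<in>insert w S. \<forall>y\<in>insert w S. y \<noteq> u \<longrightarrow> (\<rho>(w := r)) y < norm ((g(w := q)) u - (x(w := p)) y)"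
      using C2 qy gw w by auto
    show "\<forall>u\<in>insert w S. \<forall>y\<in>insert w S. u \<noteq> y \<longrightarrow> {u, y} \<in> T \<longrightarrow>
        norm ((x(w := p)) u - (x(w := p)) y) < (\<rho>(w := r)) u + (\<rho>(w := r)) y \<and>
        (\<sigma>(w := \<not> \<sigma> v)) u \<noteq> (\<sigma>(w := \<not> \<sigma> v)) y"
    proof (intro ballI impI)
      fix u y assume uy: "u \<in> insert w S" "y \<in> insert w S" "u \<noteq> y" "{u, y} \<in> T"
      consider "u \<in> S" "y \<in> S" | "u = w" "y \<in> S" | "u \<in> S" "y = w" using uy by blast
      then show "norm ((x(w := p)) u - (x(w := p)) y) < (\<rho>(w := r)) u + (\<rho>(w := r)) y \<and>
        (\<sigma>(w := \<not> \<sigma> v)) u \<noteq> (\<sigma>(w := \<not> \<sigma> v)) y"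
      proof cases
        case 1
        then have "u \<noteq> w" "y \<noteq> w" using w by auto
        then show ?thesis using C3[OF 1 uy(3,4)] by simp
      next
        case 2
        then have "{y, w} \<in> T" "y \<noteq> w" using uy(4) w by (auto simp: insert_commute)
        then show ?thesis using edge[OF 2(2)] 2 by auto
      next
        case 3
        then have "{u, w} \<in> T" "u \<noteq> w" using uy(4) w by auto
        then show ?thesis using edge'[OF 3(1)] edge(2)[OF 3(1)] 3 by auto
      qed
    qed
    show "\<forall>u\<in>insert w S. \<forall>y\<in>insert w S. u \<noteq> y \<longrightarrow> {u, y} \<notin> T \<longrightarrow>
        (\<rho>(w := r)) u + (\<rho>(w := r)) y < norm ((x(w := p)) u - (x(w := p)) y)"
    proof (intro ballI impI)
      fix u y assume uy: "u \<in> insert w S" "y \<in> insert w S" "u \<noteq> y" "{u, y} \<notin> T"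
      consider "u \<in> S" "y \<in> S" | "u = w" "y \<in> S" | "u \<in> S" "y = w" using uy by blast
      then show "(\<rho>(w := r)) u + (\<rho>(w := r)) y < norm ((x(w := p)) u - (x(w := p)) y)"
      proof cases
        case 1
        then have "u \<noteq> w" "y \<noteq> w" using w by auto
        then show ?thesis using C4[OF 1 uy(3,4)] by simp
      next
        case 2
        then have "{y, w} \<notin> T" "y \<noteq> w" using uy(4) w by (auto simp: insert_commute)
        then show ?thesis using nonedge[OF 2(2)] 2 by auto
      next
        case 3
        then have "{u, w} \<notin> T" "u \<noteq> w" using uy(4) w by auto
        then show ?thesis using nonedge'[OF 3(1)] 3 by auto
      qed
    qed
  qed
  then show ?thesis by blast
qed

text \<open>The subtree grows by one vertex at a time. Its connectedness is carried along because it
  makes the new vertex adjacent to just one old vertex: a second neighbour would close a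
  cycle.\<close>

lemma tree_ball_config:
  fixes T :: "'v::finite set set"
  assumes tree: "is_tree UNIV T" and "n < CARD('v)"
  shows "\<exists>S x \<rho> g \<sigma>. card S = Suc n \<and> ball_config T S x \<rho> g \<sigma> \<and>
    (\<forall>v\<in>S. \<forall>w\<in>S. (v, w) \<in> {(a, b). {a, b} \<in> {e \<in> T. e \<subseteq> S}}\<^sup>*)"
  using assms(2)
proof (induction n)
  case 0
  have "ball_config T {undefined} (\<lambda>_. 0) (\<lambda>_. 1) (\<lambda>_. 1) \<sigma>" for \<sigma>
    by (auto simp: ball_config_def)
  then show ?case
    by (intro exI[of _ "{undefined}"] exI[of _ "\<lambda>_. 0"] exI[of _ "\<lambda>_. 1"] exI[of _ "\<lambda>_. True"]) auto
next
  case (Suc n)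
  from Suc.IH[OF Suc_lessD[OF Suc.prems]]
  obtain S x \<rho> g \<sigma> where S: "card S = Suc n" "ball_config T S x \<rho> g \<sigma>"
    and conn0: "\<forall>v\<in>S. \<forall>w\<in>S. (v, w) \<in> {(a, b). {a, b} \<in> {e \<in> T. e \<subseteq> S}}\<^sup>*"
    by (elim exE conjE)
  note conn = conn0[rule_format]
  have "S \<noteq> {}" "S \<noteq> UNIV" using S(1) Suc.prems by auto
  then obtain v0 w0 where "v0 \<in> S" "w0 \<notin> S" by blast
  have "\<exists>v w. v \<in> S \<and> w \<notin> S \<and> {v, w} \<in> T"
  proof (rule ccontr)
    assume contra: "\<not> ?thesis"
    have "(v0, w0) \<in> {(a, b). {a, b} \<in> T}\<^sup>*"
      using tree by (auto simp: is_tree_def connected_graph_def)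
    then have "w0 \<in> S"
      by (induction rule: rtrancl_induct) (use contra \<open>v0 \<in> S\<close> in auto)
    then show False using \<open>w0 \<notin> S\<close> by simp
  qed
  then obtain v w where vw: "v \<in> S" "w \<notin> S" "{v, w} \<in> T" by blast
  have other: "{y, w} \<notin> T" if y: "y \<in> S" "y \<noteq> v" for y
  proof
    assume yw: "{y, w} \<in> T"
    let ?F = "insert {v, w} {e \<in> T. e \<subseteq> S}"
    have "{(a, b). {a, b} \<in> {e \<in> T. e \<subseteq> S}} \<subseteq> {(a, b). {a, b} \<in> ?F}" by auto
    then have "(y, v) \<in> {(a, b). {a, b} \<in> ?F}\<^sup>*"
      using conn[OF y(1) vw(1)] rtrancl_mono by blast
    moreover have "(v, w) \<in> {(a, b). {a, b} \<in> ?F}" by simp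
    ultimately have "(y, w) \<in> {(a, b). {a, b} \<in> ?F}\<^sup>*" by (rule rtrancl.rtrancl_into_rtrancl)
    moreover have "y \<noteq> w" "{y, w} \<notin> ?F" using y vw by (auto simp: doubleton_eq_iff)
    moreover have "?F \<subseteq> T" using vw by auto
    ultimately have "\<exists>c. is_cycle T c" using yw by (intro path_closes_cycle[of y w ?F T])
    then show False using tree by (simp add: is_tree_def)
  qed
  obtain x' \<rho>' g' \<sigma>' where C: "ball_config T (insert w S) x' \<rho>' g' \<sigma>'"
    using ball_config_extend[OF S(2) vw(2,1,3) other] by blast
  let ?R = "{(a, b). {a, b} \<in> {e \<in> T. e \<subseteq> insert w S}}"
  have "{(a, b). {a, b} \<in> {e \<in> T. e \<subseteq> S}} \<subseteq> ?R" by auto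
  then have connS: "(a, b) \<in> ?R\<^sup>*" if "a \<in> S" "b \<in> S" for a b
    using conn[OF that] rtrancl_mono by blast
  have R: "(v, w) \<in> ?R" "(w, v) \<in> ?R" using vw by (auto simp: insert_commute)
  have "(a, b) \<in> ?R\<^sup>*" if "a \<in> insert w S" "b \<in> insert w S" for a b
  proof -
    have "(a, v) \<in> ?R\<^sup>*" using that(1) connS[of a v] vw(1) R(2) by (cases "a = w") auto
    moreover have "(v, b) \<in> ?R\<^sup>*" using that(2) connS[of v b] vw(1) R(1) by (cases "b = w") auto
    ultimately show ?thesis by (rule rtrancl_trans)
  qed
  moreover have "card (insert w S) = Suc (Suc n)" using S(1) vw(2) by simp
  ultimately show ?case using C by blast
qed

text \<open>The two colour classes get radii of opposite sign. Adjacent vertices differ in colour,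
  so \<open>\<bar>s v - s w\<bar>\<close> is the sum of the radii, larger than the distance; for
  nonadjacent ones the sum still bounds it and is smaller than the distance.\<close>

lemma tree_light_cone_representation:
  fixes T :: "'v::finite set set"
  assumes "is_tree UNIV T"
  obtains x :: "'v \<Rightarrow> complex" and s :: "'v \<Rightarrow> real" where
    "\<And>v w. {v, w} \<in> T \<Longrightarrow> norm (x v - x w) < \<bar>s v - s w\<bar>"
    "\<And>v w. v \<noteq> w \<Longrightarrow> {v, w} \<notin> T \<Longrightarrow> \<bar>s v - s w\<bar> < norm (x v - x w)"
proof -
  have "CARD('v) - 1 < CARD('v)" by simp
  from tree_ball_config[OF assms this]
  obtain S x \<rho> g \<sigma> where S: "card S = Suc (CARD('v) - 1)" "ball_config T S x \<rho> g \<sigma>"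
    by (elim exE conjE)
  then have "S = UNIV" by (intro card_eq_UNIV_imp_eq_UNIV) auto
  then have C: "\<And>v. \<rho> v > 0"
    "\<And>v w. v \<noteq> w \<Longrightarrow> {v, w} \<in> T \<Longrightarrow> norm (x v - x w) < \<rho> v + \<rho> w \<and> \<sigma> v \<noteq> \<sigma> w"
    "\<And>v w. v \<noteq> w \<Longrightarrow> {v, w} \<notin> T \<Longrightarrow> \<rho> v + \<rho> w < norm (x v - x w)"
    using S(2) unfolding ball_config_def by auto
  define s where "s v = (if \<sigma> v then \<rho> v else - \<rho> v)" for v
  have sg: "simple_graph UNIV T" using assms by (simp add: is_tree_def)
  show ?thesis
  proof (rule that[of x s])
    fix v w assume e: "{v, w} \<in> T"
    then have "v \<noteq> w" using simple_graph_neq[OF sg] by blast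
    from C(2)[OF this e] show "norm (x v - x w) < \<bar>s v - s w\<bar>"
      using C(1)[of v] C(1)[of w] by (auto simp: s_def)
  next
    fix v w assume "v \<noteq> w" "{v, w} \<notin> T"
    from C(3)[OF this] show "\<bar>s v - s w\<bar> < norm (x v - x w)"
      using C(1)[of v] C(1)[of w] by (auto simp: s_def)
  qed
qed

section \<open>The rigidity matrix\<close>

text \<open>The two translations and the rotation about the origin, for \<open>k\<close> = 0, 1, 2.
  Extension by zero outside \<open>V'\<close> keeps subgraphs inside the same vector space.\<close>

definition planar_flex :: "'v set \<Rightarrow> complex ^ 'v::finite \<Rightarrow> nat \<Rightarrow> complex ^ 'v" where
  "planar_flex V' x k = (\<chi> v. if v \<in> V' then (if k = 0 then 1 else if k = 1 then \<i> else \<i> * x $ v) else 0)"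

lemma planar_flex_indep:
  assumes "v \<in> V'" "w \<in> V'" "x $ v \<noteq> x $ w"
  shows "indep_family {0, 1, 2} (planar_flex V' x)"
proof (rule indep_familyI)
  fix c and i :: nat assume s: "(\<Sum>k\<in>{0, 1, 2}. c k *\<^sub>R planar_flex V' x k) = 0" and i: "i \<in> {0, 1, 2}"
  have eq: "complex_of_real (c 0) + complex_of_real (c 1) * \<i> + complex_of_real (c 2) * (\<i> * x $ u) = 0"
    if "u \<in> V'" for u
  proof -
    have "c 0 *\<^sub>R 1 + c 1 *\<^sub>R \<i> + c 2 *\<^sub>R (\<i> * x $ u) = 0"
      using arg_cong[OF s, of "\<lambda>a. a $ u"] that by (simp add: planar_flex_def add.assoc)
    then show ?thesis by (simp only: scaleR_conv_of_real mult_1_right)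
  qed
  have "complex_of_real (c 2) * \<i> * (x $ v - x $ w) = 0"
  proof -
    have "complex_of_real (c 2) * \<i> * (x $ v - x $ w) =
        (complex_of_real (c 0) + complex_of_real (c 1) * \<i> + complex_of_real (c 2) * (\<i> * x $ v)) -
        (complex_of_real (c 0) + complex_of_real (c 1) * \<i> + complex_of_real (c 2) * (\<i> * x $ w))"
      by (simp add: algebra_simps)
    also have "\<dots> = 0" unfolding eq[OF assms(1)] eq[OF assms(2)] by simp
    finally show ?thesis .
  qed
  then have c2: "c 2 = 0" using assms(3) by simp
  then have "complex_of_real (c 0) + complex_of_real (c 1) * \<i> = 0" using eq[OF assms(1)] by simp
  then have "c 0 = 0" "c 1 = 0" by (simp_all add: complex_eq_iff)
  then show "c i = 0" using c2 i by auto
qed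

lemma dim_supported_on:
  "dim {a :: complex ^ 'v::finite. \<forall>v. v \<notin> V' \<longrightarrow> a $ v = 0} = 2 * card V'"
proof -
  let ?d = "(\<lambda>(v, b). axis v b) ` (V' \<times> {1, \<i>}) :: (complex ^ 'v) set"
  have B: "?d \<subseteq> Basis" by (auto simp: Basis_vec_def Basis_complex_def)
  have "(\<forall>i\<in>Basis. i \<notin> ?d \<longrightarrow> a \<bullet> i = 0) \<longleftrightarrow> (\<forall>v. v \<notin> V' \<longrightarrow> a $ v = 0)" for a :: "complex ^ 'v"
  proof
    assume L: "\<forall>i\<in>Basis. i \<notin> ?d \<longrightarrow> a \<bullet> i = 0"
    show "\<forall>v. v \<notin> V' \<longrightarrow> a $ v = 0"
    proof (intro allI impI)
      fix v assume "v \<notin> V'"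
      then have "axis v b \<notin> ?d" if "b = 1 \<or> b = \<i>" for b using that by (auto simp: axis_eq_axis)
      then have "a \<bullet> axis v 1 = 0" "a \<bullet> axis v \<i> = 0"
        using L by (auto simp: Basis_vec_def Basis_complex_def)
      then show "a $ v = 0" by (simp add: inner_axis inner_complex_def complex_eq_iff)
    qed
  next
    assume R: "\<forall>v. v \<notin> V' \<longrightarrow> a $ v = 0"
    show "\<forall>i\<in>Basis. i \<notin> ?d \<longrightarrow> a \<bullet> i = 0"
    proof (intro ballI impI)
      fix i assume i: "i \<in> Basis" "i \<notin> ?d"
      then obtain v b where vb: "i = axis v b" "b = 1 \<or> b = \<i>" by (auto simp: Basis_vec_def Basis_complex_def)
      then have "v \<notin> V'" using i(2) by force
      then show "a \<bullet> i = 0" using R vb by (simp add: inner_axis)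
    qed
  qed
  then have "dim {a :: complex ^ 'v. \<forall>v. v \<notin> V' \<longrightarrow> a $ v = 0} = card ?d"
    using dim_substandard[OF B] by simp
  also have "\<dots> = card (V' \<times> {1, \<i>})"
    by (intro card_image) (auto simp: inj_on_def axis_eq_axis)
  also have "\<dots> = 2 * card V'" by (simp add: card_cartesian_product complex_eq_iff card_insert_if)
  finally show ?thesis .
qed

text \<open>Every planar row of an edge within \<open>V'\<close> lies here, and the dimension is 2
  |V'| - 3 once two points of \<open>V'\<close> are placed apart: this is where the sparsity count
  originates.\<close>

definition planar_row_space :: "'v set \<Rightarrow> complex ^ 'v::finite \<Rightarrow> (complex ^ 'v) set" where
  "planar_row_space V' x = {a \<in> {a. \<forall>v. v \<notin> V' \<longrightarrow> a $ v = 0}. \<forall>k\<in>{0, 1, 2}. planar_flex V' x k \<bullet> a = 0}"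

lemma dim_planar_row_space:
  assumes "v \<in> V'" "w \<in> V'" "x $ v \<noteq> x $ w"
  shows "dim (planar_row_space V' x) + 3 = 2 * card V'"
proof -
  have "dim (planar_row_space V' x) + dim (span (planar_flex V' x ` {0, 1, 2})) =
      dim {a :: complex ^ 'a. \<forall>v. v \<notin> V' \<longrightarrow> a $ v = 0}"
    unfolding planar_row_space_def
    by (rule dim_annihilator) (auto simp: subspace_def planar_flex_def)
  moreover have "dim (span (planar_flex V' x ` {0, 1, 2})) = card {0, 1, 2 :: nat}"
    by (rule indep_family_dim_span[OF planar_flex_indep[OF assms]]) simp
  ultimately show ?thesis by (simp add: dim_supported_on)
qed

lemma subspace_planar_row_space: "subspace (planar_row_space V' x)"
  by (auto simp: planar_row_space_def subspace_def inner_add_right)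

abbreviation prow :: "complex ^ 'v::finite \<Rightarrow> 'v set \<Rightarrow> complex ^ 'v" where
  "prow x \<equiv> erow (\<lambda>v w. sgn (x $ v - x $ w))"

abbreviation lrow :: "real ^ 'v::finite \<Rightarrow> 'v set \<Rightarrow> real ^ 'v" where
  "lrow h \<equiv> erow (\<lambda>v w. sgn (h $ v - h $ w))"

lemma sgn_diff_anti: "sgn (f w - f v) = - sgn (f v - f w :: 'a::real_normed_vector)"
  by (metis minus_diff_eq sgn_minus)

lemma prow_inner:
  "v \<noteq> w \<Longrightarrow> prow x {v, w} \<bullet> U = sgn (x $ v - x $ w) \<bullet> (U $ v - U $ w)"
  by (rule erow_inner[OF _ sgn_diff_anti[of "\<lambda>v. x $ v"]])

lemma lrow_inner:
  "v \<noteq> w \<Longrightarrow> lrow h {v, w} \<bullet> U = sgn (h $ v - h $ w) * (U $ v - U $ w)"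
  by (subst erow_inner) (auto intro: sgn_diff_anti)

lemma inner_i_times_self: "z \<bullet> (\<i> * z) = (0::real)" "sgn z \<bullet> (\<i> * z) = (0::real)"
  by (simp_all add: inner_complex_def sgn_div_norm)

lemma prow_in_planar_row_space:
  assumes "v \<noteq> w" "v \<in> V'" "w \<in> V'"
  shows "prow x {v, w} \<in> planar_row_space V' x"
proof -
  have "prow x {v, w} \<bullet> planar_flex V' x k = 0" if "k \<in> {0, 1, 2}" for k
    using that assms inner_i_times_self(2)[of "x $ v - x $ w"]
    by (auto simp: prow_inner planar_flex_def right_diff_distrib)
  then have "planar_flex V' x k \<bullet> prow x {v, w} = 0" if "k \<in> {0, 1, 2}" for k
    using that by (simp only: inner_commute)
  then show ?thesis using assms by (auto simp: planar_row_space_def erow_nth)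
qed

lemma prow_indep_sparse:
  fixes H :: "'v::finite set set"
  assumes ind: "indep_family H (prow x)" and ne: "\<And>v w. {v, w} \<in> H \<Longrightarrow> x $ v \<noteq> x $ w"
  shows "sparse_2_3 UNIV H"
  unfolding sparse_2_3_def
proof (intro allI impI)
  fix V' E' assume "subgraph V' E' UNIV H \<and> E' \<noteq> {}"
  then have E': "simple_graph V' E'" "E' \<subseteq> H" "E' \<noteq> {}" by (auto simp: subgraph_def)
  then obtain e where "e \<in> E'" by blast
  then obtain v w where vw: "v \<noteq> w" "e = {v, w}" "v \<in> V'" "w \<in> V'"
    using simple_graph_edgeE[OF E'(1)] by metis
  then have "x $ v \<noteq> x $ w" using ne \<open>e \<in> E'\<close> E'(2) by blast
  from dim_planar_row_space[OF vw(3,4) this]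
  have dim: "dim (planar_row_space V' x) + 3 = 2 * card V'" .
  have "prow x ` E' \<subseteq> planar_row_space V' x"
  proof safe
    fix f assume "f \<in> E'"
    then obtain a b where "a \<noteq> b" "f = {a, b}" "a \<in> V'" "b \<in> V'"
      using simple_graph_edgeE[OF E'(1)] by metis
    then show "prow x f \<in> planar_row_space V' x" by (simp add: prow_in_planar_row_space)
  qed
  then have "card E' \<le> dim (planar_row_space V' x)"
    by (intro indep_family_card_le[OF indep_family_subset[OF ind finite E'(2)] finite subspace_planar_row_space])
  then show "int (card E') \<le> 2 * int (card V') - 3" using dim by linarith
qed

section \<open>Rows of the cylindrical rigidity matrix\<close>

definition plane_part :: "cyl_space ^ 'v \<Rightarrow> complex ^ 'v" where "plane_part p = (\<chi> v. plane (p $ v))"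
definition height_part :: "cyl_space ^ 'v \<Rightarrow> real ^ 'v" where "height_part p = (\<chi> v. height (p $ v))"
definition axial_part :: "cyl_space ^ 'v \<Rightarrow> real ^ 'v" where "axial_part p = (\<chi> v. axial (p $ v))"

text \<open>The norm of \<open>cyl_space\<close> does not come from an inner product. Derivatives
  are therefore written as inner products with rows in this Euclidean copy, where the dimension
  arguments apply.\<close>

definition parts :: "cyl_space ^ 'v \<Rightarrow> (complex ^ 'v) \<times> (real ^ 'v) \<times> (real ^ 'v)" where
  "parts p = (plane_part p, height_part p, axial_part p)"

lemma bij_parts: "bij parts"
proof (rule bijI')
  fix p q :: "cyl_space ^ 'v"
  show "(parts p = parts q) = (p = q)"
    by (auto simp: parts_def plane_part_def height_part_def axial_part_def vec_eq_iff intro: cyl_space_eqI)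
next
  fix y :: "(complex ^ 'v) \<times> (real ^ 'v) \<times> (real ^ 'v)"
  show "\<exists>p. y = parts p"
    by (cases y, rule exI[of _ "\<chi> v. mk_cyl (fst y $ v) (fst (snd y) $ v) (snd (snd y) $ v)"])
      (auto simp: parts_def plane_part_def height_part_def axial_part_def vec_eq_iff)
qed

definition spacelike_edges :: "cyl_space ^ 'v \<Rightarrow> 'v set set" where
  "spacelike_edges p = {e. \<exists>v w. e = {v, w} \<and> spacelike (p $ v - p $ w)}"

lemma spacelike_edges_iff: "{v, w} \<in> spacelike_edges p \<longleftrightarrow> spacelike (p $ v - p $ w)"
  using spacelike_minus[of "p $ v" "p $ w"] by (auto simp: spacelike_edges_def doubleton_eq_iff)

definition cyl_row :: "cyl_space ^ 'v::finite \<Rightarrow> 'v set \<Rightarrow> (complex ^ 'v) \<times> (real ^ 'v) \<times> (real ^ 'v)" where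
  "cyl_row p e = (if e \<in> spacelike_edges p then (prow (plane_part p) e, lrow (height_part p) e, 0)
     else (0, 0, lrow (axial_part p) e))"

lemma cyl_row_inner_parts:
  assumes "v \<noteq> w"
  shows "cyl_row p {v, w} \<bullet> parts u = norm_deriv (p $ v - p $ w) (u $ v - u $ w)"
proof -
  have nth: "plane_part q $ a = plane (q $ a)" "height_part q $ a = height (q $ a)"
    "axial_part q $ a = axial (q $ a)" for q :: "cyl_space ^ 'a" and a
    by (simp_all add: plane_part_def height_part_def axial_part_def)
  show ?thesis
  proof (cases "spacelike (p $ v - p $ w)")
    case True
    then have "cyl_row p {v, w} = (prow (plane_part p) {v, w}, lrow (height_part p) {v, w}, 0)"
      by (simp only: cyl_row_def spacelike_edges_iff if_True)
    then have "cyl_row p {v, w} \<bullet> parts u =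
        prow (plane_part p) {v, w} \<bullet> plane_part u + lrow (height_part p) {v, w} \<bullet> height_part u"
      by (simp add: parts_def)
    from this[unfolded prow_inner[OF assms] lrow_inner[OF assms], unfolded nth] show ?thesis
      using True by (simp add: norm_deriv_def spacelike_def)
  next
    case False
    then have "cyl_row p {v, w} = (0, 0, lrow (axial_part p) {v, w})"
      by (simp only: cyl_row_def spacelike_edges_iff if_False)
    then have "cyl_row p {v, w} \<bullet> parts u = lrow (axial_part p) {v, w} \<bullet> axial_part u"
      by (simp add: parts_def)
    from this[unfolded lrow_inner[OF assms], unfolded nth] show ?thesis
      using False by (simp add: norm_deriv_def spacelike_def)
  qed
qed

lemma edge_length_has_derivative:
  fixes p :: "cyl_space ^ 'v::finite"
  assumes "v \<noteq> w" "smooth_dir (p $ v - p $ w)"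
  shows "((\<lambda>q. edge_length q {v, w}) has_derivative (\<lambda>u. cyl_row p {v, w} \<bullet> parts u)) (at p)"
proof -
  have "((\<lambda>q. q $ v - q $ w) has_derivative (\<lambda>u. u $ v - u $ w)) (at p)"
    by (intro has_derivative_diff bounded_linear.has_derivative[OF bounded_linear_vec_nth] has_derivative_ident)
  from has_derivative_compose[OF this norm_has_derivative_cyl[OF assms(2)]]
  show ?thesis using assms(1) by (simp add: edge_length_doubleton cyl_row_inner_parts)
qed

definition row_map :: "'v::finite set set \<Rightarrow> ('v set \<Rightarrow> 'a::real_inner) \<Rightarrow> 'a \<Rightarrow> real ^ ('v set)" where
  "row_map E f U = (\<chi> e. if e \<in> E then f e \<bullet> U else 0)"

lemma rigidity_map_has_derivative:
  fixes p :: "cyl_space ^ 'v::finite"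
  assumes sg: "simple_graph UNIV E" and sm: "\<And>v w. {v, w} \<in> E \<Longrightarrow> smooth_dir (p $ v - p $ w)"
  shows "(rigidity_map E has_derivative (\<lambda>u. row_map E (cyl_row p) (parts u))) (at p)"
  unfolding has_derivative_componentwise_within[of "rigidity_map E"]
proof
  fix i :: "real ^ ('v set)" assume "i \<in> Basis"
  then obtain e where e: "i = axis e 1" by (auto simp: Basis_vec_def)
  show "((\<lambda>q. rigidity_map E q \<bullet> i) has_derivative (\<lambda>u. row_map E (cyl_row p) (parts u) \<bullet> i)) (at p)"
  proof (cases "e \<in> E")
    case True
    then obtain v w where vw: "v \<noteq> w" "e = {v, w}" using simple_graph_edgeE[OF sg] by metis
    then show ?thesis
      using edge_length_has_derivative[OF vw(1) sm] True
      by (simp add: e inner_axis rigidity_map_def row_map_def)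
  qed (simp add: e inner_axis rigidity_map_def row_map_def)
qed

lemma smooth_dir_zero: "\<not> smooth_dir 0"
  by (simp add: smooth_dir_def)

lemma well_positioned_cyl_iff:
  fixes p :: "cyl_space ^ 'v::finite"
  assumes sg: "simple_graph UNIV E"
  shows "well_positioned E p \<longleftrightarrow> (\<forall>v w. {v, w} \<in> E \<longrightarrow> smooth_dir (p $ v - p $ w))"
proof
  assume wp: "well_positioned E p"
  show "\<forall>v w. {v, w} \<in> E \<longrightarrow> smooth_dir (p $ v - p $ w)"
  proof (intro allI impI)
    fix v w assume e: "{v, w} \<in> E"
    have vw: "v \<noteq> w" using simple_graph_neq[OF sg e] .
    have diff: "rigidity_map E differentiable (at p)" and "p $ v \<noteq> p $ w"
      using wp e by (auto simp: well_positioned_def framework_def)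
    show "smooth_dir (p $ v - p $ w)"
    proof (rule smooth_dir_if_differentiable)
      show "p $ v - p $ w \<noteq> 0" using \<open>p $ v \<noteq> p $ w\<close> by simp
      fix k :: cyl_space
      \<comment> \<open>Moving only the endpoint v in direction k makes the entry of the rigidity
        map at vw the norm along a line.\<close>
      have "(\<lambda>t. p + t *\<^sub>R axis v k) differentiable (at (0::real))" by (intro derivative_intros)
      then have "(\<lambda>t. rigidity_map E (p + t *\<^sub>R axis v k)) differentiable (at (0::real))"
        using differentiable_chain_at[of "\<lambda>t. p + t *\<^sub>R axis v k" 0 "rigidity_map E"] diff
        by (simp add: o_def)
      then have "(\<lambda>t. rigidity_map E (p + t *\<^sub>R axis v k) $ {v, w}) differentiable (at (0::real))"
        unfolding differentiable_def using bounded_linear.has_derivative[OF bounded_linear_vec_nth] by blast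
      then show "(\<lambda>t. norm (p $ v - p $ w + t *\<^sub>R k)) differentiable (at 0)"
        using e vw by (simp add: rigidity_map_def edge_length_doubleton axis_def algebra_simps)
    qed
  qed
next
  assume sm: "\<forall>v w. {v, w} \<in> E \<longrightarrow> smooth_dir (p $ v - p $ w)"
  then have "p $ v \<noteq> p $ w" if "{v, w} \<in> E" for v w using that smooth_dir_zero by force
  then show "well_positioned E p"
    using rigidity_map_has_derivative[OF sg, of p] sm sg
    by (auto simp: well_positioned_def framework_def differentiable_def)
qed

text \<open>The coefficients of a relation form a vector of \<open>edge_space E\<close>; if it is
  the image of U, the sum of their squares is the relation paired with U, hence 0. Conversely the
  dual vectors are preimages of the coordinate vectors.\<close>

lemma range_row_map_iff:
  fixes f :: "'v::finite set \<Rightarrow> 'a::euclidean_space"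
  shows "range (row_map E f) = edge_space E \<longleftrightarrow> indep_family E f"
proof
  assume L: "range (row_map E f) = edge_space E"
  show "indep_family E f"
  proof (rule indep_familyI)
    fix c i assume s: "(\<Sum>e\<in>E. c e *\<^sub>R f e) = 0" and i: "i \<in> E"
    have "(\<chi> e. if e \<in> E then c e else 0) \<in> edge_space E" by (simp add: edge_space_def)
    then obtain U where U: "(\<chi> e. if e \<in> E then c e else 0) = row_map E f U" unfolding L[symmetric] by blast
    have cU: "c e = f e \<bullet> U" if "e \<in> E" for e
      using arg_cong[OF U, of "\<lambda>y. y $ e"] that by (simp add: row_map_def)
    have "(\<Sum>e\<in>E. c e * c e) = (\<Sum>e\<in>E. c e *\<^sub>R f e) \<bullet> U"
      using cU by (simp add: inner_sum_left)
    then have "(\<Sum>e\<in>E. c e * c e) = 0" using s by simp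
    then show "c i = 0" using i by (simp add: sum_nonneg_eq_0_iff)
  qed
next
  assume ind: "indep_family E f"
  obtain d where d: "\<And>i j. i \<in> E \<Longrightarrow> j \<in> E \<Longrightarrow> d i \<bullet> f j = (if i = j then 1 else 0)"
    using indep_family_dual[OF ind finite] by metis
  show "range (row_map E f) = edge_space E"
  proof (intro equalityI subsetI)
    fix y assume y: "y \<in> edge_space E"
    have "f e \<bullet> (\<Sum>i\<in>E. y $ i *\<^sub>R d i) = y $ e" if e: "e \<in> E" for e
    proof -
      have "f e \<bullet> (\<Sum>i\<in>E. y $ i *\<^sub>R d i) = (\<Sum>i\<in>E. y $ i * (d i \<bullet> f e))"
        by (simp add: inner_sum_right inner_commute)
      also have "\<dots> = (\<Sum>i\<in>E. if i = e then y $ i else 0)" using d e by (intro sum.cong) auto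
      finally show ?thesis using e by simp
    qed
    then have "row_map E f (\<Sum>i\<in>E. y $ i *\<^sub>R d i) = y"
      using y by (auto simp: row_map_def edge_space_def vec_eq_iff)
    then show "y \<in> range (row_map E f)" by (metis rangeI)
  qed (auto simp: row_map_def edge_space_def)
qed

section \<open>Trivial flexes and the criterion for minimal infinitesimal rigidity\<close>

definition trivial_space :: "complex ^ 'v::finite \<Rightarrow> ((complex ^ 'v) \<times> (real ^ 'v) \<times> (real ^ 'v)) set" where
  "trivial_space x = span (planar_flex UNIV x ` {0, 1, 2}) \<times> span {1} \<times> span {1}"

lemma span_planar_flex:
  "span (planar_flex UNIV x ` {0, 1, 2}) = {\<chi> v. \<i> * complex_of_real \<theta> * x $ v + c | \<theta> c. True}"
proof
  show "span (planar_flex UNIV x ` {0, 1, 2}) \<subseteq> {\<chi> v. \<i> * complex_of_real \<theta> * x $ v + c | \<theta> c. True}"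
  proof (rule span_minimal)
    have "planar_flex UNIV x 0 = (\<chi> v. \<i> * complex_of_real 0 * x $ v + 1)"
      "planar_flex UNIV x 1 = (\<chi> v. \<i> * complex_of_real 0 * x $ v + \<i>)"
      "planar_flex UNIV x 2 = (\<chi> v. \<i> * complex_of_real 1 * x $ v + 0)"
      by (auto simp: planar_flex_def vec_eq_iff)
    then show "planar_flex UNIV x ` {0, 1, 2} \<subseteq> {\<chi> v. \<i> * complex_of_real \<theta> * x $ v + c | \<theta> c. True}"
      by blast
    show "subspace {\<chi> v. \<i> * complex_of_real \<theta> * x $ v + c | \<theta> c. True}"
      unfolding subspace_def
    proof (intro conjI ballI allI)
      have "0 = (\<chi> v. \<i> * complex_of_real 0 * x $ v + 0)" by (simp add: vec_eq_iff)
      then show "0 \<in> {\<chi> v. \<i> * complex_of_real \<theta> * x $ v + c | \<theta> c. True}" by blast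
      fix a assume "a \<in> {\<chi> v. \<i> * complex_of_real \<theta> * x $ v + c | \<theta> c. True}"
      then obtain \<theta> c where a: "a = (\<chi> v. \<i> * complex_of_real \<theta> * x $ v + c)" by blast
      have "k *\<^sub>R a = (\<chi> v. \<i> * complex_of_real (k * \<theta>) * x $ v + k *\<^sub>R c)" for k
        by (auto simp: a vec_eq_iff complex_eq_iff algebra_simps)
      then show "k *\<^sub>R a \<in> {\<chi> v. \<i> * complex_of_real \<theta> * x $ v + c | \<theta> c. True}" for k by blast
      fix b assume "b \<in> {\<chi> v. \<i> * complex_of_real \<theta> * x $ v + c | \<theta> c. True}"
      then obtain \<theta>' c' where b: "b = (\<chi> v. \<i> * complex_of_real \<theta>' * x $ v + c')" by blast
      have "a + b = (\<chi> v. \<i> * complex_of_real (\<theta> + \<theta>') * x $ v + (c + c'))"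
        by (simp add: a b vec_eq_iff algebra_simps)
      then show "a + b \<in> {\<chi> v. \<i> * complex_of_real \<theta> * x $ v + c | \<theta> c. True}" by blast
    qed
  qed
  show "{\<chi> v. \<i> * complex_of_real \<theta> * x $ v + c | \<theta> c. True} \<subseteq> span (planar_flex UNIV x ` {0, 1, 2})"
  proof safe
    fix \<theta> c
    have "(\<chi> v. \<i> * complex_of_real \<theta> * x $ v + c) =
        Re c *\<^sub>R planar_flex UNIV x 0 + Im c *\<^sub>R planar_flex UNIV x 1 + \<theta> *\<^sub>R planar_flex UNIV x 2"
      by (simp add: planar_flex_def vec_eq_iff complex_eq_iff)
    then show "(\<chi> v. \<i> * complex_of_real \<theta> * x $ v + c) \<in> span (planar_flex UNIV x ` {0, 1, 2})"
      by (simp only:) (intro span_add span_scale span_base imageI; simp)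
  qed
qed

lemma parts_trivial_flexes: "parts ` trivial_flexes p = trivial_space (plane_part p)"
proof -
  have 1: "parts (\<chi> v. planar_motion \<theta> c d e (p $ v)) =
      (\<chi> v. \<i> * complex_of_real \<theta> * plane_part p $ v + c, d *\<^sub>R 1, e *\<^sub>R 1)" for \<theta> c d e
    by (simp add: parts_def plane_part_def height_part_def axial_part_def planar_motion_def vec_eq_iff)
  show ?thesis
    unfolding trivial_flexes_def inf_rigid_motions_cyl trivial_space_def span_planar_flex span_singleton
    by (auto simp: image_image image_iff 1) (metis 1)+
qed

lemma dim_trivial_space:
  "dim (trivial_space x) \<le> 5" "x $ v \<noteq> x $ w \<Longrightarrow> dim (trivial_space x) = 5"
proof -
  have eq: "dim (trivial_space x) = dim (span (planar_flex UNIV x ` {0, 1, 2})) + 2"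
    unfolding trivial_space_def by (simp add: dim_Times subspace_Times)
  have "dim (planar_flex UNIV x ` {0, 1, 2}) \<le> card (planar_flex UNIV x ` {0, 1, 2})"
    by (rule dim_le_card') simp
  also have "\<dots> \<le> 3" using card_image_le[of "{0, 1, 2}" "planar_flex UNIV x"] by simp
  finally show "dim (trivial_space x) \<le> 5" using eq by simp
  assume "x $ v \<noteq> x $ w"
  from indep_family_dim_span[OF planar_flex_indep[OF UNIV_I UNIV_I this]]
  show "dim (trivial_space x) = 5" using eq by simp
qed

lemma trivial_space_annihilates:
  assumes "simple_graph UNIV E" "e \<in> E" "U \<in> trivial_space (plane_part p)"
  shows "cyl_row p e \<bullet> U = 0"
proof -
  obtain v w where vw: "v \<noteq> w" "e = {v, w}" using simple_graph_edgeE[OF assms(1,2)] by metis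
  obtain \<theta> c d f where U: "U = (\<chi> v. \<i> * complex_of_real \<theta> * plane_part p $ v + c, d *\<^sub>R 1, f *\<^sub>R 1)"
    using assms(3) unfolding trivial_space_def span_planar_flex span_singleton by auto
  let ?z = "plane_part p $ v - plane_part p $ w"
  have "\<i> * complex_of_real \<theta> * plane_part p $ v - \<i> * complex_of_real \<theta> * plane_part p $ w = \<theta> *\<^sub>R (\<i> * ?z)"
    by (simp add: scaleR_conv_of_real algebra_simps)
  then show ?thesis
    using inner_i_times_self(2)[of ?z]
    by (simp add: vw cyl_row_def U inner_Pair prow_inner[OF vw(1)] lrow_inner[OF vw(1)])
qed

lemma min_inf_rigid_cyl_iff:
  fixes p :: "cyl_space ^ 'v::finite"
  assumes sg: "simple_graph UNIV E"
  shows "min_inf_rigid E p \<longleftrightarrow> (\<forall>v w. {v, w} \<in> E \<longrightarrow> smooth_dir (p $ v - p $ w)) \<and>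
    indep_family E (cyl_row p) \<and> {U. \<forall>e\<in>E. cyl_row p e \<bullet> U = 0} = trivial_space (plane_part p)"
proof (cases "\<forall>v w. {v, w} \<in> E \<longrightarrow> smooth_dir (p $ v - p $ w)")
  case True
  then have wp: "well_positioned E p" using well_positioned_cyl_iff[OF sg] by blast
  have D: "rigidity_derivative E p = (\<lambda>u. row_map E (cyl_row p) (parts u))"
    using frechet_derivative_at[OF rigidity_map_has_derivative[OF sg, of p]] True by metis
  have "range (rigidity_derivative E p) = range (row_map E (cyl_row p))"
    unfolding D using bij_is_surj[OF bij_parts] by (metis image_image)
  then have 1: "independent_framework E p \<longleftrightarrow> indep_family E (cyl_row p)"
    unfolding independent_framework_def using wp range_row_map_iff by metis
  let ?K = "{U. \<forall>e\<in>E. cyl_row p e \<bullet> U = 0}"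
  have "{u. rigidity_derivative E p u = 0} = parts -` ?K"
    unfolding D by (auto simp: row_map_def vec_eq_iff)
  then have "{u. rigidity_derivative E p u = 0} = trivial_flexes p \<longleftrightarrow> parts ` (parts -` ?K) = parts ` trivial_flexes p"
    by (simp only: inj_image_eq_iff[OF bij_is_inj[OF bij_parts]])
  also have "parts ` (parts -` ?K) = ?K" using bij_is_surj[OF bij_parts] by (rule surj_image_vimage_eq)
  finally have "{u. rigidity_derivative E p u = 0} = trivial_flexes p \<longleftrightarrow> ?K = trivial_space (plane_part p)"
    unfolding parts_trivial_flexes .
  then show ?thesis using 1 wp True by (simp add: min_inf_rigid_def inf_rigid_def conj_commute)
next
  case False
  then show ?thesis
    using well_positioned_cyl_iff[OF sg, of p] by (auto simp: min_inf_rigid_def inf_rigid_def)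
qed

section \<open>The equivalence\<close>

lemma indep_family_direct_sum:
  fixes a :: "'i \<Rightarrow> 'a::real_vector" and b :: "'i \<Rightarrow> 'b::real_vector"
  assumes fin: "finite A" "finite B" and disj: "A \<inter> B = {}"
  shows "indep_family (A \<union> B) (\<lambda>i. if i \<in> A then (a i, 0) else (0, b i)) \<longleftrightarrow>
    indep_family A a \<and> indep_family B b"
proof -
  have sum: "(\<Sum>i\<in>A \<union> B. c i *\<^sub>R (if i \<in> A then (a i, 0) else (0, b i))) =
      (\<Sum>i\<in>A. c i *\<^sub>R a i, \<Sum>i\<in>B. c i *\<^sub>R b i)" for c
  proof -
    have "(\<Sum>i\<in>A \<union> B. c i *\<^sub>R (if i \<in> A then (a i, 0) else (0, b i))) =
        (\<Sum>i\<in>A. c i *\<^sub>R (if i \<in> A then (a i, 0) else (0, b i))) +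
        (\<Sum>i\<in>B. c i *\<^sub>R (if i \<in> A then (a i, 0) else (0, b i)))"
      using fin disj by (rule sum.union_disjoint)
    also have "(\<Sum>i\<in>A. c i *\<^sub>R (if i \<in> A then (a i, 0) else (0, b i))) = (\<Sum>i\<in>A. (c i *\<^sub>R a i, 0))"
      by (intro sum.cong) auto
    also have "(\<Sum>i\<in>B. c i *\<^sub>R (if i \<in> A then (a i, 0) else (0, b i))) = (\<Sum>i\<in>B. (0, c i *\<^sub>R b i))"
      using disj by (intro sum.cong) auto
    finally show ?thesis by (simp add: prod_eq_iff fst_sum snd_sum)
  qed
  show ?thesis
  proof
    assume L: "indep_family (A \<union> B) (\<lambda>i. if i \<in> A then (a i, 0) else (0, b i))"
    show "indep_family A a \<and> indep_family B b"
    proof (intro conjI indep_familyI)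
      fix c i assume s: "(\<Sum>i\<in>A. c i *\<^sub>R a i) = 0" and i: "i \<in> A"
      have "(\<Sum>i\<in>A. (if i \<in> A then c i else 0) *\<^sub>R a i) = 0" using s by (simp cong: sum.cong)
      moreover have "(\<Sum>i\<in>B. (if i \<in> A then c i else 0) *\<^sub>R b i) = 0"
        using disj by (intro sum.neutral) auto
      ultimately show "c i = 0"
        using indep_familyD[OF L, of "\<lambda>i. if i \<in> A then c i else 0" i] i unfolding sum
        by (simp add: zero_prod_def)
    next
      fix c i assume s: "(\<Sum>i\<in>B. c i *\<^sub>R b i) = 0" and i: "i \<in> B"
      have "(\<Sum>i\<in>B. (if i \<in> B then c i else 0) *\<^sub>R b i) = 0" using s by (simp cong: sum.cong)
      moreover have "(\<Sum>i\<in>A. (if i \<in> B then c i else 0) *\<^sub>R a i) = 0"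
        using disj by (intro sum.neutral) auto
      ultimately show "c i = 0"
        using indep_familyD[OF L, of "\<lambda>i. if i \<in> B then c i else 0" i] i unfolding sum
        by (simp add: zero_prod_def)
    qed
  next
    assume R: "indep_family A a \<and> indep_family B b"
    show "indep_family (A \<union> B) (\<lambda>i. if i \<in> A then (a i, 0) else (0, b i))"
    proof (rule indep_familyI, unfold sum)
      fix c i assume "(\<Sum>i\<in>A. c i *\<^sub>R a i, \<Sum>i\<in>B. c i *\<^sub>R b i) = 0" and i: "i \<in> A \<union> B"
      then have "(\<Sum>i\<in>A. c i *\<^sub>R a i) = 0" "(\<Sum>i\<in>B. c i *\<^sub>R b i) = 0" by (simp_all add: zero_prod_def)
      then show "c i = 0" using R i by (auto dest: indep_familyD)
    qed
  qed
qed

lemma indep_cyl_rows_iff: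
  fixes E :: "'v::finite set set" and p :: "cyl_space ^ 'v"
  shows "indep_family E (cyl_row p) \<longleftrightarrow>
    indep_family (E \<inter> spacelike_edges p) (\<lambda>e. (prow (plane_part p) e, lrow (height_part p) e)) \<and>
    indep_family (E - spacelike_edges p) (lrow (axial_part p))"
proof -
  let ?A = "E \<inter> spacelike_edges p" and ?B = "E - spacelike_edges p"
  let ?a = "\<lambda>e. (prow (plane_part p) e, lrow (height_part p) e)" and ?b = "lrow (axial_part p)"
  let ?f = "\<lambda>e. if e \<in> ?A then (?a e, 0) else (0, ?b e)"
  \<comment> \<open>The triple of \<open>cyl_row\<close> is nested to the right, while the direct
    sum groups plane and height together; relations are compared component by component.\<close>
  have rel: "(\<Sum>e\<in>E. c e *\<^sub>R cyl_row p e) = 0 \<longleftrightarrow> (\<Sum>e\<in>E. c e *\<^sub>R ?f e) = 0" for c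
  proof -
    have 1: "fst (cyl_row p e) = fst (fst (?f e))" "fst (snd (cyl_row p e)) = snd (fst (?f e))"
      "snd (snd (cyl_row p e)) = snd (?f e)" if "e \<in> E" for e
      using that by (auto simp: cyl_row_def)
    have "fst (\<Sum>e\<in>E. c e *\<^sub>R cyl_row p e) = fst (fst (\<Sum>e\<in>E. c e *\<^sub>R ?f e))"
      "fst (snd (\<Sum>e\<in>E. c e *\<^sub>R cyl_row p e)) = snd (fst (\<Sum>e\<in>E. c e *\<^sub>R ?f e))"
      "snd (snd (\<Sum>e\<in>E. c e *\<^sub>R cyl_row p e)) = snd (\<Sum>e\<in>E. c e *\<^sub>R ?f e)"
      using 1 by (simp_all only: fst_sum snd_sum fst_scaleR snd_scaleR cong: sum.cong)
    then show ?thesis by (simp only: prod_eq_iff fst_zero snd_zero) blast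
  qed
  have "indep_family E (cyl_row p) \<longleftrightarrow> indep_family E ?f"
    unfolding indep_family_def rel ..
  moreover have "indep_family (?A \<union> ?B) ?f \<longleftrightarrow> indep_family ?A ?a \<and> indep_family ?B ?b"
    by (rule indep_family_direct_sum) auto
  moreover have "?A \<union> ?B = E" by blast
  ultimately show ?thesis by (simp only:)
qed

section \<open>From a rigid placement to the decomposition\<close>

lemma lrow_orthogonal_one: "v \<noteq> w \<Longrightarrow> lrow h {v, w} \<bullet> 1 = 0"
  by (simp add: lrow_inner)

lemma dim_orthogonal_one: "dim {b :: real ^ 'v::finite. 1 \<bullet> b = 0} + 1 = CARD('v)"
proof -
  have "indep_family {()} (\<lambda>_. 1 :: real ^ 'v)" by (rule indep_familyI) auto
  from indep_family_dim_annihilator[OF this] show ?thesis by simp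
qed

lemma dim_cyl_row_kernel:
  fixes p :: "cyl_space ^ 'v::finite"
  assumes "indep_family E (cyl_row p)"
  shows "dim {U. \<forall>e\<in>E. cyl_row p e \<bullet> U = 0} + card E = 4 * CARD('v)"
  using indep_family_dim_annihilator[OF assms finite] by simp

lemma min_inf_rigid_imp_decomposition:
  fixes p :: "cyl_space ^ 'v::finite"
  assumes sg: "simple_graph UNIV E" and n: "2 \<le> CARD('v)"
    and sm: "\<And>v w. {v, w} \<in> E \<Longrightarrow> smooth_dir (p $ v - p $ w)"
    and ind: "indep_family E (cyl_row p)"
    and ker: "{U. \<forall>e\<in>E. cyl_row p e \<bullet> U = 0} = trivial_space (plane_part p)"
  shows "\<exists>H T1 T2. E = H \<union> T1 \<union> T2 \<and> H \<inter> T1 = {} \<and> H \<inter> T2 = {} \<and> T1 \<inter> T2 = {} \<and>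
    tight_2_3 (UNIV :: 'v set) H \<and> is_tree (UNIV :: 'v set) T1 \<and> is_tree (UNIV :: 'v set) T2"
proof -
  let ?n = "CARD('v)"
  define A where "A = E \<inter> spacelike_edges p"
  define B where "B = E - spacelike_edges p"
  let ?x = "plane_part p" and ?h = "height_part p" and ?s = "axial_part p"
  have iA: "indep_family A (\<lambda>e. (prow ?x e, lrow ?h e))" and iB: "indep_family B (lrow ?s)"
    using ind unfolding indep_cyl_rows_iff A_def B_def by auto
  have sgA: "simple_graph UNIV A" and sgB: "simple_graph UNIV B"
    using simple_graph_subset[OF sg] by (auto simp: A_def B_def)
  have xA: "?x $ v \<noteq> ?x $ w" if "{v, w} \<in> A" for v w
    using sm[of v w] that
    by (auto simp: A_def spacelike_edges_iff spacelike_def smooth_dir_def plane_part_def)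
  have cE: "card E = card A + card B"
    unfolding A_def B_def by (rule card_Int_Diff) simp
  \<comment> \<open>Only the upper bound 5 is available here, as no two points are yet known to
    differ in the plane.\<close>
  have tot: "4 * ?n \<le> card E + 5"
    using dim_cyl_row_kernel[OF ind] dim_trivial_space(1)[of ?x] unfolding ker by linarith
  have cB: "card B + 1 \<le> ?n"
  proof -
    have "dim (span {1 :: real ^ 'v}) \<le> dim {c. \<forall>e\<in>B. lrow ?s e \<bullet> c = 0}"
    proof (rule dim_subset)
      have "1 \<in> {c. \<forall>e\<in>B. lrow ?s e \<bullet> c = 0}"
      proof safe
        fix e assume "e \<in> B"
        then obtain v w where "v \<noteq> w" "e = {v, w}" using simple_graph_edgeE[OF sgB] by metis
        then show "lrow ?s e \<bullet> 1 = 0" by (simp add: lrow_orthogonal_one)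
      qed
      moreover have "subspace {c. \<forall>e\<in>B. lrow ?s e \<bullet> c = 0}"
        by (auto simp: subspace_def inner_add_right)
      ultimately show "span {1} \<subseteq> {c. \<forall>e\<in>B. lrow ?s e \<bullet> c = 0}" by (simp add: span_minimal)
    qed
    then show ?thesis using indep_family_dim_annihilator[OF iB finite] by simp
  qed
  \<comment> \<open>Without spacelike edges \<open>tot\<close> and \<open>cB\<close> would give 4n -
    5 \<le> n - 1, impossible for n \<ge> 2.\<close>
  have "A \<noteq> {}" using tot cB cE n by auto
  then obtain e0 where "e0 \<in> A" by blast
  then obtain v0 w0 where "{v0, w0} \<in> A" using simple_graph_edgeE[OF sgA] by metis
  from dim_planar_row_space[OF UNIV_I UNIV_I xA[OF this]]
  have dU: "dim (planar_row_space UNIV ?x) + 3 = 2 * ?n" by simp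
  let ?U = "planar_row_space UNIV ?x" and ?W = "{b :: real ^ 'v. 1 \<bullet> b = 0}"
  have sub: "subspace ?U" "subspace ?W"
    using subspace_planar_row_space by (auto simp: subspace_def inner_add_right)
  have mem: "prow ?x e \<in> ?U" "lrow ?h e \<in> ?W" if e: "e \<in> A" for e
  proof -
    from simple_graph_edgeE[OF sgA e] obtain v w where vw: "v \<noteq> w" "e = {v, w}" .
    then show "prow ?x e \<in> ?U" by (simp add: prow_in_planar_row_space)
    show "lrow ?h e \<in> ?W" using vw by (simp add: inner_commute[of 1] lrow_orthogonal_one)
  qed
  have dW: "dim ?W + 1 = ?n" by (rule dim_orthogonal_one)
  have "card A \<le> dim (?U \<times> ?W)"
    using mem by (intro indep_family_card_le[OF iA finite subspace_Times[OF sub]]) auto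
  then have cA': "card A \<le> dim ?U + dim ?W" using sub by (simp add: dim_Times)
  \<comment> \<open>The upper bounds 3n - 4 for spacelike and n - 1 for timelike edges add up to the
    lower bound 4n - 5 for \<open>card E\<close>, so both are equalities.\<close>
  then have cA: "card A = dim ?U + dim ?W" and cB': "card B + 1 = ?n"
    using tot cB cE dU dW by linarith+
  obtain J where J: "J \<subseteq> A" "card J = dim ?W" "indep_family J (lrow ?h)" "indep_family (A - J) (prow ?x)"
    using indep_family_direct_sum_split[OF finite sub mem iA cA] .
  have "is_tree UNIV J"
    using J dW
    by (intro indep_rows_tree[OF simple_graph_subset[OF sgA J(1)], where G = "\<lambda>v w. sgn (?h $ v - ?h $ w)"])
      (auto intro: sgn_diff_anti)
  moreover have "is_tree UNIV B"
    by (rule indep_rows_tree[OF sgB _ iB cB']) (rule sgn_diff_anti)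
  moreover have "tight_2_3 UNIV (A - J)"
  proof -
    have "sparse_2_3 UNIV (A - J)" using J(4) xA by (intro prow_indep_sparse) auto
    moreover have "card (A - J) = card A - card J" using J(1) by (intro card_Diff_subset) auto
    then have "int (card (A - J)) = 2 * int ?n - 3" using cA J(2) dU by simp
    ultimately show ?thesis by (simp add: tight_2_3_def)
  qed
  moreover have "E = (A - J) \<union> J \<union> B" using J(1) unfolding A_def B_def by blast
  moreover have "(A - J) \<inter> J = {}" "(A - J) \<inter> B = {}" "J \<inter> B = {}" using J(1) unfolding A_def B_def by blast+
  ultimately show ?thesis by blast
qed

section \<open>From a decomposition to a rigid placement\<close>

lemma drow_eq_scaled_prow:
  assumes "v \<noteq> w"
  shows "drow x {v, w} = edge_length x {v, w} *\<^sub>R prow x {v, w}"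
  using assms
  by (cases "x $ v = x $ w")
    (auto simp: vec_eq_iff drow_nth erow_nth edge_length_doubleton sgn_div_norm norm_minus_commute)

lemma entries_in_vec_complex:
  "entries_in K (x :: complex ^ 'v::finite) \<longleftrightarrow> (\<forall>v. Re (x $ v) \<in> K \<and> Im (x $ v) \<in> K)"
  by (auto simp: entries_in_def Basis_vec_def Basis_complex_def inner_axis inner_complex_def)

lemma entries_in_vec_real:
  "entries_in K (x :: real ^ 'v::finite) \<longleftrightarrow> (\<forall>v. x $ v \<in> K)"
  by (auto simp: entries_in_def Basis_vec_def inner_axis)

lemma entries_in_Pair:
  assumes "entries_in K a" "entries_in K b" "0 \<in> K"
  shows "entries_in K (a, b)"
  using assms by (auto simp: entries_in_def Basis_prod_def)

lemma tight_tree_rows_indep: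
  fixes x :: "complex ^ 'v::finite" and h :: "real ^ 'v"
  assumes sg: "simple_graph UNIV (H \<union> T)" and disj: "H \<inter> T = {}"
    and H: "indep_family H (drow x)" and T: "is_tree UNIV T" and h: "\<And>v w. v \<noteq> w \<Longrightarrow> h $ v \<noteq> h $ w"
    and x: "\<And>v w. {v, w} \<in> H \<union> T \<Longrightarrow> x $ v \<noteq> x $ w"
    and K: "real_subfield K" "entries_in K x"
    and gen: "\<And>S. S \<subseteq> vertex_pairs UNIV \<Longrightarrow> S \<noteq> {} \<Longrightarrow> prod (edge_length x) S \<notin> K"
  shows "indep_family (H \<union> T) (\<lambda>e. (prow x e, lrow h e))"
proof -
  let ?A = "H \<union> T" and ?r = "edge_length x"
  note cl = real_subfield_closed[OF K(1)]
  define u where "u e = (drow x e, 0 :: real ^ 'v)" for e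
  define w where "w e = (0 :: complex ^ 'v, lrow h e)" for e
  have xK: "Re (x $ v) \<in> K" "Im (x $ v) \<in> K" for v using K(2) by (auto simp: entries_in_vec_complex)
  have edge: "\<exists>a b. a \<noteq> b \<and> e = {a, b}" if "e \<in> ?A" for e using simple_graph_edgeE[OF sg that] by metis
  have "indep_family ?A (\<lambda>e. u e + ?r e *\<^sub>R w e)"
  proof (rule indep_family_sqrt_combination[OF finite K(1)])
    fix e assume "e \<in> ?A"
    from edge[OF this] obtain a b where ab: "a \<noteq> b" "e = {a, b}" by (elim exE conjE)
    have "Re (x $ v - x $ w) \<in> K" "Im (x $ v - x $ w) \<in> K" for v w
      using cl(4)[OF xK(1) xK(1)] cl(4)[OF xK(2) xK(2)] by simp_all
    then have "entries_in K (drow x e)"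
      unfolding entries_in_vec_complex using cl(1) ab(1) by (simp add: ab(2) drow_nth)
    then show "entries_in K (u e)"
      unfolding u_def using cl(1) by (intro entries_in_Pair) (auto simp: entries_in_vec_real)
    \<comment> \<open>The heights are arbitrary reals, but only their signs appear in the rows, and
      these are in every field.\<close>
    have "sgn r \<in> K" for r :: real using cl(1,2) cl(8)[OF cl(2)] by (cases r "0 :: real" rule: linorder_cases) auto
    then have "entries_in K (lrow h e)"
      unfolding entries_in_vec_real using cl(1) ab(1) by (simp add: ab(2) erow_nth)
    then show "entries_in K (w e)"
      unfolding w_def using cl(1) by (intro entries_in_Pair) (auto simp: entries_in_vec_complex)
    have "(?r e)\<^sup>2 = (Re (x $ a) - Re (x $ b))\<^sup>2 + (Im (x $ a) - Im (x $ b))\<^sup>2"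
      by (simp add: ab edge_length_doubleton cmod_power2)
    then show "(?r e)\<^sup>2 \<in> K" using xK cl by simp
  next
    fix J assume J: "J \<subseteq> ?A" "J \<noteq> {}"
    have "J \<subseteq> vertex_pairs UNIV"
    proof
      fix e assume "e \<in> J"
      then show "e \<in> vertex_pairs UNIV" using J edge[of e] by (auto simp: vertex_pairs_def)
    qed
    then show "prod ?r J \<notin> K" using gen J(2) by blast
  next
    have "indep_family T (lrow h)"
    proof (rule tree_rows_indep[OF T])
      show "sgn (h $ b - h $ a) = - sgn (h $ a - h $ b)" for a b by (rule sgn_diff_anti)
      fix a b assume "{a, b} \<in> T"
      then have "a \<noteq> b" using simple_graph_neq[OF sg] by blast
      then show "sgn (h $ a - h $ b) \<noteq> 0" using h[of a b] by (simp add: sgn_zero_iff)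
    qed
    then have "indep_family ?A (\<lambda>i. if i \<in> H then (drow x i, 0) else (0, lrow h i))"
      by (subst indep_family_direct_sum[OF finite finite disj]) (use H in blast)
    then show "indep_family ?A (\<lambda>i. if i \<in> H then u i else w i)" by (simp only: u_def w_def)
  qed
  moreover have "u e + ?r e *\<^sub>R w e = ?r e *\<^sub>R (prow x e, lrow h e)" if "e \<in> ?A" for e
  proof -
    from edge[OF that] obtain a b where "a \<noteq> b" "e = {a, b}" by blast
    then show ?thesis by (simp add: u_def w_def drow_eq_scaled_prow)
  qed
  ultimately have "indep_family ?A (\<lambda>e. ?r e *\<^sub>R (prow x e, lrow h e))"
    by (simp only: cong: indep_family_cong)
  moreover have "?r e \<noteq> 0" if "e \<in> ?A" for e
  proof -
    from edge[OF that] obtain a b where "e = {a, b}" by blast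
    then show ?thesis using x[of a b] that by (simp add: edge_length_doubleton)
  qed
  ultimately show ?thesis using indep_family_scale[of ?A ?r] by blast
qed

lemma open_Collect_all_finite:
  "(\<And>v :: 'v::finite. open {x. P v x}) \<Longrightarrow> open {x. \<forall>v. P v x}"
  using open_INT[of UNIV "\<lambda>v. {x. P v x}"] by (simp add: INTER_eq)

text \<open>The heights are constants here. For pairs outside \<open>T\<close> the height term is
  omitted, which is stronger than being spacelike and also keeps the planar points apart.\<close>

lemma open_light_cone_region:
  fixes s h :: "'v::finite \<Rightarrow> real"
  shows "open {x :: complex ^ 'v. \<forall>v w.
    ({v, w} \<in> T \<longrightarrow> norm (x $ v - x $ w) + \<bar>h v - h w\<bar> < \<bar>s v - s w\<bar>) \<and>
    (v \<noteq> w \<longrightarrow> {v, w} \<notin> T \<longrightarrow> \<bar>s v - s w\<bar> < norm (x $ v - x $ w))}"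
proof (intro open_Collect_all_finite open_Collect_conj)
  fix v w
  show "open {x :: complex ^ 'v. {v, w} \<in> T \<longrightarrow> norm (x $ v - x $ w) + \<bar>h v - h w\<bar> < \<bar>s v - s w\<bar>}"
    by (cases "{v, w} \<in> T") (auto intro!: open_Collect_less continuous_intros)
  show "open {x :: complex ^ 'v. v \<noteq> w \<longrightarrow> {v, w} \<notin> T \<longrightarrow> \<bar>s v - s w\<bar> < norm (x $ v - x $ w)}"
    by (cases "v \<noteq> w \<and> {v, w} \<notin> T") (auto intro!: open_Collect_less continuous_intros)
qed

lemma decomposition_imp_min_inf_rigid:
  fixes E :: "'v::finite set set"
  assumes sg: "simple_graph UNIV E" and n: "2 \<le> CARD('v)"
    and E: "E = H \<union> T1 \<union> T2" "H \<inter> T1 = {}" "H \<inter> T2 = {}" "T1 \<inter> T2 = {}"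
    and H: "tight_2_3 UNIV H" and T1: "is_tree UNIV T1" and T2: "is_tree UNIV T2"
  shows "\<exists>p :: cyl_space ^ 'v. min_inf_rigid E p"
proof -
  let ?n = "CARD('v)"
  have sgA: "simple_graph UNIV (H \<union> T1)" and sgH: "simple_graph UNIV H"
    using simple_graph_subset[OF sg] E(1) by auto
  obtain x0 :: "'v \<Rightarrow> complex" and s :: "'v \<Rightarrow> real" where x0: "\<And>v w. {v, w} \<in> T2 \<Longrightarrow> norm (x0 v - x0 w) < \<bar>s v - s w\<bar>"
    "\<And>v w. v \<noteq> w \<Longrightarrow> {v, w} \<notin> T2 \<Longrightarrow> \<bar>s v - s w\<bar> < norm (x0 v - x0 w)"
  proof (rule tree_light_cone_representation[OF T2])
  qed (rule that)
  \<comment> \<open>Any injection gives distinct heights. Scaled by a small \<epsilon> they fit into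
    the slack of the strict inequalities for \<open>T2\<close>, so its edges remain
    timelike.\<close>
  obtain f :: "'v \<Rightarrow> nat" where f: "inj f"
    using finite_imp_inj_to_nat_seg[of "UNIV :: 'v set"] by auto
  have "\<forall>\<^sub>F \<epsilon> in at_right 0. \<forall>vw\<in>{(v, w). {v, w} \<in> T2}.
      \<epsilon> * \<bar>real (f (fst vw)) - real (f (snd vw))\<bar> <
      \<bar>s (fst vw) - s (snd vw)\<bar> - norm (x0 (fst vw) - x0 (snd vw))"
  proof (intro eventually_ball_finite ballI)
    fix vw assume vw: "vw \<in> {(v, w). {v, w} \<in> T2}"
    have "((\<lambda>\<epsilon>. \<epsilon> * \<bar>real (f (fst vw)) - real (f (snd vw))\<bar>) \<longlongrightarrow> 0 * \<bar>real (f (fst vw)) - real (f (snd vw))\<bar>) (at_right 0)"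
      by (intro tendsto_intros)
    then show "\<forall>\<^sub>F \<epsilon> in at_right 0. \<epsilon> * \<bar>real (f (fst vw)) - real (f (snd vw))\<bar> <
        \<bar>s (fst vw) - s (snd vw)\<bar> - norm (x0 (fst vw) - x0 (snd vw))"
      using x0(1)[of "fst vw" "snd vw"] vw by (intro order_tendstoD(2)) auto
  qed simp
  moreover have "\<forall>\<^sub>F \<epsilon> in at_right (0::real). 0 < \<epsilon>" by (rule eventually_at_right_less)
  ultimately have "\<exists>\<epsilon>. (\<forall>vw\<in>{(v, w). {v, w} \<in> T2}.
      \<epsilon> * \<bar>real (f (fst vw)) - real (f (snd vw))\<bar> <
      \<bar>s (fst vw) - s (snd vw)\<bar> - norm (x0 (fst vw) - x0 (snd vw))) \<and> 0 < \<epsilon>"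
    by (intro eventually_happens'[OF trivial_limit_at_right_real] eventually_conj)
  then obtain \<epsilon> where \<epsilon>: "\<forall>vw\<in>{(v, w). {v, w} \<in> T2}.
      \<epsilon> * \<bar>real (f (fst vw)) - real (f (snd vw))\<bar> <
      \<bar>s (fst vw) - s (snd vw)\<bar> - norm (x0 (fst vw) - x0 (snd vw))" "0 < \<epsilon>"
    by (elim exE conjE)
  define h where "h v = \<epsilon> * real (f v)" for v
  have h: "h v \<noteq> h w" if "v \<noteq> w" for v w using that f \<epsilon>(2) by (auto simp: h_def dest: injD)
  have habs: "\<bar>h v - h w\<bar> = \<epsilon> * \<bar>real (f v) - real (f w)\<bar>" for v w
    using \<epsilon>(2) by (simp add: h_def abs_mult flip: right_diff_distrib)
  have hx0: "norm (x0 v - x0 w) + \<bar>h v - h w\<bar> < \<bar>s v - s w\<bar>" if "{v, w} \<in> T2" for v w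
    using bspec[OF \<epsilon>(1), of "(v, w)"] that by (simp add: habs)
  define X where "X = {x :: complex ^ 'v. \<forall>v w.
    ({v, w} \<in> T2 \<longrightarrow> norm (x $ v - x $ w) + \<bar>h v - h w\<bar> < \<bar>s v - s w\<bar>) \<and>
    (v \<noteq> w \<longrightarrow> {v, w} \<notin> T2 \<longrightarrow> \<bar>s v - s w\<bar> < norm (x $ v - x $ w))}"
  have "open X" unfolding X_def by (rule open_light_cone_region)
  have "(\<chi> v. x0 v) \<in> X" using hx0 x0(2) by (simp add: X_def)
  have "sparse_2_3 UNIV H" using H by (simp add: tight_2_3_def)
  then obtain y where "indep_family H (drow y)"
    using laman_independent_placement[OF sgH sparse_count_if_sparse[OF sgH]] by blast
  \<comment> \<open>The Laman placement need not lie in \<open>X\<close>; genericity along lines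
    carries its independence to some point of \<open>X\<close>.\<close>
  from generic_on_lines_dense[OF generic_drow_indep[OF this] \<open>open X\<close>] \<open>_ \<in> X\<close>
  have ne: "X \<inter> {x. indep_family H (drow x)} \<noteq> {}" by blast
  have op: "open (X \<inter> {x. indep_family H (drow x)})" using \<open>open X\<close> open_drow_indep by (rule open_Int)
  obtain x K where xX: "x \<in> X \<inter> {x. indep_family H (drow x)}" and K: "real_subfield K" "entries_in K x"
    and gen: "\<And>S. S \<subseteq> vertex_pairs UNIV \<Longrightarrow> S \<noteq> {} \<Longrightarrow> prod (edge_length x) S \<notin> K"
  proof (rule generic_points_exist[OF op ne])
  qed (rule that)
  have timelike: "norm (x $ v - x $ w) + \<bar>h v - h w\<bar> < \<bar>s v - s w\<bar>" if "{v, w} \<in> T2" for v w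
    using xX that by (simp add: X_def)
  have space: "\<bar>s v - s w\<bar> < norm (x $ v - x $ w)" if "v \<noteq> w" "{v, w} \<notin> T2" for v w
    using xX that by (simp add: X_def)
  have xne: "x $ v \<noteq> x $ w" if "v \<noteq> w" "{v, w} \<notin> T2" for v w using space[OF that] by auto
  define p where "p = (\<chi> v. mk_cyl (x $ v) (h v) (s v))"
  have parts: "plane_part p = x" "height_part p = (\<chi> v. h v)" "axial_part p = (\<chi> v. s v)"
    by (simp_all add: p_def plane_part_def height_part_def axial_part_def vec_eq_iff)
  have sl: "{v, w} \<in> spacelike_edges p \<longleftrightarrow> {v, w} \<notin> T2" if "v \<noteq> w" for v w
    using timelike[of v w] space[OF that]
    by (cases "{v, w} \<in> T2") (auto simp: spacelike_edges_iff spacelike_def p_def add_strict_increasing2)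
  have EA: "E \<inter> spacelike_edges p = H \<union> T1" and EB: "E - spacelike_edges p = T2"
  proof -
    have "e \<in> spacelike_edges p \<longleftrightarrow> e \<notin> T2" if "e \<in> E" for e
      using simple_graph_edgeE[OF sg that] sl by metis
    then show "E \<inter> spacelike_edges p = H \<union> T1" "E - spacelike_edges p = T2" using E by blast+
  qed
  have smooth: "smooth_dir (p $ v - p $ w)" if e: "{v, w} \<in> E" for v w
  proof (cases "{v, w} \<in> T2")
    case True
    then show ?thesis using timelike[of v w] by (simp add: smooth_dir_def p_def)
  next
    case False
    have "v \<noteq> w" using simple_graph_neq[OF sg e] .
    note vw = this False
    have "\<bar>s v - s w\<bar> < norm (x $ v - x $ w) + \<bar>h v - h w\<bar>"
      using space[OF vw] by linarith
    then show ?thesis using xne[OF vw] h[OF vw(1)] by (simp add: smooth_dir_def p_def)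
  qed
  have xA: "x $ v \<noteq> x $ w" if "{v, w} \<in> H \<union> T1" for v w
    using xne[OF simple_graph_neq[OF sgA that]] that E by blast
  have "indep_family (H \<union> T1) (\<lambda>e. (prow x e, lrow (\<chi> v. h v) e))"
    using xX h by (intro tight_tree_rows_indep[OF sgA E(2) _ T1 _ xA K gen]) auto
  moreover have "indep_family T2 (lrow (\<chi> v. s v))"
  proof (rule tree_rows_indep[OF T2])
    show "sgn ((\<chi> v. s v) $ b - (\<chi> v. s v) $ a) = - sgn ((\<chi> v. s v) $ a - (\<chi> v. s v) $ b)" for a b
      by (rule sgn_diff_anti)
    fix a b assume "{a, b} \<in> T2"
    have "0 \<le> norm (x $ a - x $ b)" "0 \<le> \<bar>h a - h b\<bar>" by simp_all
    then have "0 < \<bar>s a - s b\<bar>" using timelike[OF \<open>{a, b} \<in> T2\<close>] by linarith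
    then show "sgn ((\<chi> v. s v) $ a - (\<chi> v. s v) $ b) \<noteq> 0" by (simp add: sgn_zero_iff)
  qed
  ultimately have ind: "indep_family E (cyl_row p)"
    unfolding indep_cyl_rows_iff EA EB parts by simp
  have cH: "card H + 3 = 2 * ?n" using H n by (simp add: tight_2_3_def)
  have "card E = card (H \<union> T1) + card T2"
    unfolding E(1) using E(3,4) by (intro card_Un_disjoint) auto
  also have "card (H \<union> T1) = card H + card T1" using E(2) by (intro card_Un_disjoint) auto
  \<comment> \<open>(2n - 3) + (n - 1) + (n - 1) = 4n - 5.\<close>
  finally have cE: "card E + 5 = 4 * ?n"
    using tree_card[OF T1] tree_card[OF T2] cH by linarith
  have "card H \<noteq> 0" using cH n by linarith
  then have "H \<noteq> {}" by auto
  then obtain e where "e \<in> H" by blast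
  then obtain v w where "{v, w} \<in> H" using simple_graph_edgeE[OF sgH] by metis
  then have "x $ v \<noteq> x $ w" using xA by blast
  then have d1: "dim (trivial_space x) = 5" by (rule dim_trivial_space(2))
  let ?K = "{U. \<forall>e\<in>E. cyl_row p e \<bullet> U = 0}"
  have d2: "dim ?K = 5" using dim_cyl_row_kernel[OF ind] cE by linarith
  have sub: "trivial_space x \<subseteq> ?K"
    using trivial_space_annihilates[OF sg, of _ _ p] parts(1) by auto
  have s1: "subspace (trivial_space x)"
    unfolding trivial_space_def by (intro subspace_Times subspace_span)
  have s2: "subspace ?K" by (auto simp: subspace_def inner_add_right)
  \<comment> \<open>Trivial flexes always lie in the kernel; by the edge count both have dimension
    5.\<close>
  have "trivial_space x = ?K" by (rule subspace_dim_equal[OF s1 s2 sub]) (simp only: d1 d2 order_refl)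
  then have "?K = trivial_space x" by (rule sym)
  then have "min_inf_rigid E p"
    unfolding min_inf_rigid_cyl_iff[OF sg] parts using smooth ind by blast
  then show ?thesis ..
qed

theorem theorem5p11:
  fixes E :: "'v::finite set set"
  assumes "simple_graph (UNIV :: 'v set) E"
    and "2 \<le> CARD('v)"
  shows "minimally_rigid_in TYPE(cyl_space) E \<longleftrightarrow>
    (\<exists>H T1 T2. E = H \<union> T1 \<union> T2 \<and> H \<inter> T1 = {} \<and> H \<inter> T2 = {} \<and> T1 \<inter> T2 = {} \<and>
       tight_2_3 (UNIV :: 'v set) H \<and>
       is_tree (UNIV :: 'v set) T1 \<and> is_tree (UNIV :: 'v set) T2)"
proof
  assume "minimally_rigid_in TYPE(cyl_space) E"
  then obtain p :: "cyl_space ^ 'v" where "min_inf_rigid E p"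
    by (auto simp: minimally_rigid_in_def)
  then show "\<exists>H T1 T2. E = H \<union> T1 \<union> T2 \<and> H \<inter> T1 = {} \<and> H \<inter> T2 = {} \<and> T1 \<inter> T2 = {} \<and>
       tight_2_3 (UNIV :: 'v set) H \<and>
       is_tree (UNIV :: 'v set) T1 \<and> is_tree (UNIV :: 'v set) T2"
    unfolding min_inf_rigid_cyl_iff[OF assms(1)]
    by (intro min_inf_rigid_imp_decomposition[OF assms]) blast+
next
  assume "\<exists>H T1 T2. E = H \<union> T1 \<union> T2 \<and> H \<inter> T1 = {} \<and> H \<inter> T2 = {} \<and> T1 \<inter> T2 = {} \<and>
       tight_2_3 (UNIV :: 'v set) H \<and>
       is_tree (UNIV :: 'v set) T1 \<and> is_tree (UNIV :: 'v set) T2"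
  then obtain p :: "cyl_space ^ 'v" where "min_inf_rigid E p"
    using decomposition_imp_min_inf_rigid[OF assms] by (elim exE conjE) metis
  then show "minimally_rigid_in TYPE(cyl_space) E"
    unfolding minimally_rigid_in_def min_inf_rigid_def inf_rigid_def by blast
qed

end
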